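(* Let $a=4$, $b=0.3$, $c=-2.375$, let $\xi\in(1,1.712]$, and let $f:\mathbb{R}^3\to\mathbb{R}^3$ be the diffeomorphism $$f(x,y,z)=(ax^2+by+c,\;x,\;\xi z+x).$$ Let $\mathcal{D}=[-1,1]\times[-1,1]\times\left[-\tfrac{1}{\xi-1},\tfrac{1}{\xi-1}\right]$ and let $\Lambda=\bigcap_{n\in\mathbb{Z}}f^n(\mathcal{D})$. Then there exists a hyperbolic cu-blender (of index $u=1$) for $f$ and $\Lambda$.
   Context: Discs. Let $M=\mathbb{R}^3$ and let $u$ be an integer with $1\le u<3$. A disc of dimension $u$ is the image of an element of $C^1(\mathbb{D}^u,M)$, where $\mathbb{D}^u$ is the closed unit disc in $\mathbb{R}^u$ (so for $u=1$ it is the image of a $C^1$ curve on a compact interval). Hyperbolic set. An invariant compact set $\Lambda\subset M$ is hyperbolic for $f$ if the tangent bundle over $\Lambda$ admits a continuous $Df$-invariant decomposition $T_\Lambda M=E^u\oplus E^s$ and there is $\lambda<1$ such that for all $p\in\Lambda$, $\|Df^{-1}(p)v_u\|<\lambda\|v_u\|$ and $\|Df(p)v_s\|<\lambda\|v_s\|$ for all (nonzero) $v_u\in E^u_p$, $v_s\in E^s_p$, for some choice of Riemannian metric on $M$. Stable manifolds. For $p$ in a hyperbolic set $\Lambda$ of a diffeomorphism $g$, $W^s(p)=\{q\in M:\lim_{k\to\infty}d(g^k(p),g^k(q))=0\}$. The local stable manifold $W^s_{\mathrm{loc}}(p)$ is the connected component containing $p$ of $W^s(p)\cap\mathcal{D}$,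 and $W^s_{\mathrm{loc}}(\Lambda)=\bigcup_{p\in\Lambda}W^s_{\mathrm{loc}}(p)$. Hyperbolic blender. Let $f:M\to M$ be a diffeomorphism and $\Lambda\subset M$ an invariant transitive hyperbolic set with $\dim E^u>u$. A hyperbolic cu-blender of index $u$ for $f$ and $\Lambda$ is a non-empty family $\Gamma$ of discs of dimension $u$ with the following property: there exists a $C^1$-open neighbourhood $\mathcal{F}$ of $f$ such that for every $g\in\mathcal{F}$ and every $\gamma\in\Gamma$, $\gamma\cap W^s_{\mathrm{loc}}(\Lambda_g)\ne\emptyset$, where $\Lambda_g$ is the (hyperbolic) continuation of $\Lambda$ for $g$. In particular, the existence of a hyperbolic blender for $f$ and $\Lambda$ includes that $\Lambda$ is a transitive hyperbolic set with $\dim E^u>u$. *)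

theory Defs
  imports "HOL-Analysis.Analysis"
begin

text \<open>The ambient manifold is a Euclidean space \<^typ>\<open>'a::euclidean_space\<close>; every tangent space
  is identified with \<^typ>\<open>'a\<close> itself.\<close>

definition C1_on :: "'a::real_normed_vector set \<Rightarrow> ('a \<Rightarrow> 'b::real_normed_vector) \<Rightarrow> bool" where
  "C1_on S f \<longleftrightarrow>
     (\<exists>f' :: 'a \<Rightarrow> 'a \<Rightarrow>\<^sub>L 'b.
        (\<forall>x\<in>S. (f has_derivative blinfun_apply (f' x)) (at x within S)) \<and> continuous_on S f')"

definition C1_diffeo :: "('a::euclidean_space \<Rightarrow> 'a) \<Rightarrow> bool" where
  "C1_diffeo f \<longleftrightarrow> bij f \<and> C1_on UNIV f \<and> C1_on UNIV (inv f)"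

abbreviation Df :: "('a::euclidean_space \<Rightarrow> 'a) \<Rightarrow> 'a \<Rightarrow> 'a \<Rightarrow> 'a" where
  "Df f p \<equiv> frechet_derivative f (at p)"

definition int_iterate :: "('a \<Rightarrow> 'a) \<Rightarrow> int \<Rightarrow> 'a \<Rightarrow> 'a" where
  "int_iterate f n = (if n \<ge> 0 then f ^^ nat n else inv f ^^ nat (- n))"

subsection \<open>The space of diffeomorphisms\<close>

definition C1_close :: "'a set \<Rightarrow> real \<Rightarrow> ('a::euclidean_space \<Rightarrow> 'a) \<Rightarrow> ('a \<Rightarrow> 'a) \<Rightarrow> bool" where
  "C1_close K \<epsilon> f g \<longleftrightarrow>
     (\<forall>x\<in>K. dist (f x) (g x) < \<epsilon> \<and> onorm (\<lambda>v. Df f x v - Df g x v) < \<epsilon>)"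

text \<open>Openness in the set of $C^1$ diffeomorphisms, for the topology of $C^1$ convergence on compact
  sets. The ambient space is not compact, and this is the coarsest of the customary $C^1$
  topologies: a set that is open here is also open for the uniform and for the Whitney
  $C^1$ topology.\<close>

definition C1_open :: "('a::euclidean_space \<Rightarrow> 'a) set \<Rightarrow> bool" where
  "C1_open F \<longleftrightarrow> (\<forall>g\<in>F. C1_diffeo g) \<and>
     (\<forall>g\<in>F. \<exists>K. compact K \<and>
        (\<exists>\<epsilon>>0. \<forall>g'. C1_diffeo g' \<and> C1_close K \<epsilon> g g' \<longrightarrow> g' \<in> F))"

subsection \<open>Hyperbolic sets\<close>

text \<open>Infinitely often differentiable functions: all iterated directional derivatives exist and
  are themselves (Frechet) differentiable, hence continuous.\<close>

coinductive smooth :: "('a::euclidean_space \<Rightarrow> real) \<Rightarrow> bool" where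
  "\<lbrakk>\<forall>x. \<phi> differentiable (at x); \<forall>v. smooth (\<lambda>x. frechet_derivative \<phi> (at x) v)\<rbrakk> \<Longrightarrow> smooth \<phi>"

definition riemannian_metric :: "('a::euclidean_space \<Rightarrow> 'a \<Rightarrow> 'a \<Rightarrow> real) \<Rightarrow> bool" where
  "riemannian_metric G \<longleftrightarrow>
     (\<forall>p. bilinear (G p) \<and> (\<forall>v w. G p v w = G p w v) \<and> (\<forall>v. v \<noteq> 0 \<longrightarrow> G p v v > 0)) \<and>
     (\<forall>v w. smooth (\<lambda>p. G p v w))"

definition riemannian_norm :: "('a \<Rightarrow> 'a \<Rightarrow> 'a \<Rightarrow> real) \<Rightarrow> 'a \<Rightarrow> 'a \<Rightarrow> real" where
  "riemannian_norm G p v = sqrt (G p v v)"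

text \<open>A continuous subbundle has, near each base point, a continuous frame
  $X_0, \dots, X_{k-1}$, where $k$ is the (locally constant) rank.\<close>

definition continuous_subbundle :: "'a set \<Rightarrow> ('a::euclidean_space \<Rightarrow> 'a set) \<Rightarrow> bool" where
  "continuous_subbundle \<Lambda> E \<longleftrightarrow>
     (\<forall>p\<in>\<Lambda>. subspace (E p)) \<and>
     (\<forall>p\<in>\<Lambda>. \<exists>U X. open U \<and> p \<in> U \<and>
        (\<forall>i<dim (E p). continuous_on (\<Lambda> \<inter> U) (X i)) \<and>
        (\<forall>q\<in>\<Lambda> \<inter> U. dim (E q) = dim (E p) \<and> span ((\<lambda>i. X i q) ` {..<dim (E p)}) = E q))"

definition hyperbolic_splitting ::
  "('a::euclidean_space \<Rightarrow> 'a) \<Rightarrow> 'a set \<Rightarrow> ('a \<Rightarrow> 'a set) \<Rightarrow> ('a \<Rightarrow> 'a set) \<Rightarrow> bool" where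
  "hyperbolic_splitting f \<Lambda> Eu Es \<longleftrightarrow>
     continuous_subbundle \<Lambda> Eu \<and> continuous_subbundle \<Lambda> Es \<and>
     (\<forall>p\<in>\<Lambda>. Eu p \<inter> Es p = {0} \<and> {v + w |v w. v \<in> Eu p \<and> w \<in> Es p} = UNIV) \<and>
     (\<forall>p\<in>\<Lambda>. Df f p ` Eu p = Eu (f p) \<and> Df f p ` Es p = Es (f p)) \<and>
     (\<exists>G \<kappa>. riemannian_metric G \<and> \<kappa> < 1 \<and>
        (\<forall>p\<in>\<Lambda>.
           (\<forall>v\<in>Eu p - {0}. riemannian_norm G (inv f p) (Df (inv f) p v) < \<kappa> * riemannian_norm G p v) \<and>
           (\<forall>v\<in>Es p - {0}. riemannian_norm G (f p) (Df f p v) < \<kappa> * riemannian_norm G p v)))"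

definition hyperbolic_set :: "('a::euclidean_space \<Rightarrow> 'a) \<Rightarrow> 'a set \<Rightarrow> bool" where
  "hyperbolic_set f \<Lambda> \<longleftrightarrow>
     compact \<Lambda> \<and> f ` \<Lambda> = \<Lambda> \<and> (\<exists>Eu Es. hyperbolic_splitting f \<Lambda> Eu Es)"

text \<open>Transitivity: existence of a dense forward orbit.\<close>

definition transitive_set :: "('a::topological_space \<Rightarrow> 'a) \<Rightarrow> 'a set \<Rightarrow> bool" where
  "transitive_set f \<Lambda> \<longleftrightarrow> (\<exists>x\<in>\<Lambda>. closure (range (\<lambda>n. (f ^^ n) x)) = \<Lambda>)"

text \<open>The continuation $\Lambda_g = h_g(\Lambda)$ for $g$ in a neighbourhood $F$ of $f$: here $h_g$ is a
  homeomorphism conjugating $f|_\Lambda$ to $g|_{\Lambda_g}$, with $h_f$ the identity, and $g \mapsto h_g$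
  is continuous from the $C^1$ to the $C^0$ topology. By expansivity of hyperbolic sets, any two
  such families agree on a neighbourhood of $f$.\<close>

definition hyperbolic_continuation ::
  "('a::euclidean_space \<Rightarrow> 'a) \<Rightarrow> 'a set \<Rightarrow> ('a \<Rightarrow> 'a) set \<Rightarrow> (('a \<Rightarrow> 'a) \<Rightarrow> 'a \<Rightarrow> 'a) \<Rightarrow> bool" where
  "hyperbolic_continuation f \<Lambda> F h \<longleftrightarrow>
     C1_open F \<and> f \<in> F \<and>
     (\<forall>x\<in>\<Lambda>. h f x = x) \<and>
     (\<forall>g\<in>F. hyperbolic_set g (h g ` \<Lambda>) \<and>
        (\<exists>k. homeomorphism \<Lambda> (h g ` \<Lambda>) (h g) k) \<and>
        (\<forall>x\<in>\<Lambda>. h g (f x) = g (h g x))) \<and>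
     (\<forall>g\<in>F. \<forall>\<epsilon>>0. \<exists>V. C1_open V \<and> g \<in> V \<and>
        (\<forall>g'\<in>V \<inter> F. \<forall>x\<in>\<Lambda>. dist (h g' x) (h g x) < \<epsilon>))"

subsection \<open>Stable manifolds, discs and blenders\<close>

definition stable_manifold :: "('a::metric_space \<Rightarrow> 'a) \<Rightarrow> 'a \<Rightarrow> 'a set" where
  "stable_manifold g p = {q. (\<lambda>k. dist ((g ^^ k) p) ((g ^^ k) q)) \<longlonglongrightarrow> 0}"

text \<open>Local stable manifolds are taken relative to a fixed region \<open>R\<close>, which does not change
  with the diffeomorphism.\<close>

definition local_stable_manifold :: "'a set \<Rightarrow> ('a::metric_space \<Rightarrow> 'a) \<Rightarrow> 'a \<Rightarrow> 'a set" where
  "local_stable_manifold R g p = connected_component_set (stable_manifold g p \<inter> R) p"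

definition local_stable_set :: "'a set \<Rightarrow> ('a::metric_space \<Rightarrow> 'a) \<Rightarrow> 'a set \<Rightarrow> 'a set" where
  "local_stable_set R g \<Lambda> = (\<Union>p\<in>\<Lambda>. local_stable_manifold R g p)"

text \<open>The dimension of a disc, and below the index of a blender, is the cardinality of the finite
  index type \<open>'u\<close>.\<close>

definition is_disc :: "'u::finite itself \<Rightarrow> 'a::euclidean_space set \<Rightarrow> bool" where
  "is_disc (_ :: 'u itself) \<gamma> \<longleftrightarrow>
     (\<exists>\<phi> :: real ^ 'u \<Rightarrow> 'a. C1_on (cball 0 1) \<phi> \<and> \<gamma> = \<phi> ` cball 0 1)"

definition hyperbolic_cu_blender ::
  "'u::finite itself \<Rightarrow> 'a set \<Rightarrow> ('a::euclidean_space \<Rightarrow> 'a) \<Rightarrow> 'a set \<Rightarrow> 'a set set \<Rightarrow> bool" where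
  "hyperbolic_cu_blender (u :: 'u itself) R f \<Lambda> \<Gamma> \<longleftrightarrow>
     C1_diffeo f \<and>
     hyperbolic_set f \<Lambda> \<and> transitive_set f \<Lambda> \<and>
     (\<exists>Eu Es. hyperbolic_splitting f \<Lambda> Eu Es \<and> (\<forall>p\<in>\<Lambda>. dim (Eu p) > CARD('u))) \<and>
     \<Gamma> \<noteq> {} \<and> (\<forall>\<gamma>\<in>\<Gamma>. is_disc u \<gamma>) \<and>
     (\<exists>F h. hyperbolic_continuation f \<Lambda> F h \<and>
        (\<forall>g\<in>F. \<forall>\<gamma>\<in>\<Gamma>. \<gamma> \<inter> local_stable_set R g (h g ` \<Lambda>) \<noteq> {}))"

end

(* For x in the relevant range |8x| > 4, so the orbit equation of f, and of every C1-small perturbation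
   g, can be solved backwards for x and z and forwards for y; in a weighted maximum norm this is a
   contraction on sequences. Hence every itinerary of signs of x is realised by exactly one full
   orbit in the box, which gives the continuation, and by exactly one point with prescribed y for
   one-sided itineraries, which gives the local stable manifolds as curves over y. The linearised
   version of the same contraction produces the hyperbolic splitting.

   For the blender take the single disc {(t, 0, 0)}, and let height(s) be the z-coordinate of the
   point with y = 0 and forward itinerary s. The disc meets a local stable manifold as soon as
   height vanishes somewhere. Since height(+++...) < 0 < height(---...), bisection over the first
   symbols finds a zero provided that no finite word w has
   height(w+---...) <= height(w-+++...). This gap inequality is where xi <= 1.712 is used. *)

theory Submission
  imports Defs
begin

section \<open>Contraction and cone estimates for real sequences\<close>

text \<open>Robustness is not deduced from the unperturbed map: every estimate is made directly for
  each \<open>g\<close> whose deviation from \<open>henon_skew\<close> on the box is at most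
  \<open>tol\<close> in value and in Lipschitz constant, so the gap inequality holds for all of them
  at once. The delicate direction is z, where the expansion \<xi> may be arbitrarily close to 1; the
  weight \<open>wt\<close>, the radius \<open>tol\<close> and the factor \<open>rate\<close>
  therefore all depend on \<xi> - 1. For the gap inequality, the orbits of w+---... and w-+++...
  start with equal y. After the differing symbol their x-difference dx stays below -1.536, and
  boundedness of z turns this into a z-difference dz of at least 1.5359/(\<xi> - 1). Each backward
  step replaces dz by about (dz - dx)/\<xi>, so dz can lose its sign only through a large positive
  dx; but dx is divided by a slope of modulus at least 4.13 as long as the symbols agree. The
  numerical bounds for x near the differing symbol come from feeding interval bounds for the
  neighbours repeatedly into the inverse branches.\<close>

lemma decay:
  fixes d :: "int \<Rightarrow> real" and n :: nat
  assumes k: "0 \<le> \<kappa>" "\<kappa> < 1" and \<rho>: "0 \<le> \<rho>" and B: "0 \<le> B"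
    and step: "\<And>k M. \<bar>k - c\<bar> \<le> int n \<Longrightarrow> 0 \<le> M \<Longrightarrow> d (k-1) \<le> M \<Longrightarrow> d k \<le> M \<Longrightarrow> d (k+1) \<le> M \<Longrightarrow> d k \<le> \<kappa> * M + \<rho>"
    and bnd: "\<And>k. \<bar>k - c\<bar> \<le> int n + 1 \<Longrightarrow> d k \<le> B"
  shows "d c \<le> \<kappa> ^ (n+1) * B + \<rho> / (1 - \<kappa>)"
proof -
  \<comment> \<open>The window shrinks by one per round because the estimate at k consults k - 1 and
    k + 1; after n + 1 rounds only c is left. The summand \<rho> / (1 - \<kappa>) is the fixed point
    of M -> \<kappa> * M + \<rho>, so only the first summand contracts.\<close>
  have "\<forall>k. \<bar>k - c\<bar> \<le> int n + 1 - int m \<longrightarrow> d k \<le> \<kappa> ^ m * B + \<rho> / (1 - \<kappa>)" if "m \<le> n + 1" for m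
    using that
  proof (induction m)
    case 0
    have "0 \<le> \<rho> / (1 - \<kappa>)" using k \<rho> by simp
    then show ?case using bnd by fastforce
  next
    case (Suc m)
    define M where "M = \<kappa> ^ m * B + \<rho> / (1 - \<kappa>)"
    have M0: "0 \<le> M" unfolding M_def using k \<rho> B by simp
    have IH: "d k \<le> M" if "\<bar>k - c\<bar> \<le> int n + 1 - int m" for k
      using Suc that unfolding M_def by auto
    have eq: "\<kappa> * M + \<rho> = \<kappa> ^ Suc m * B + \<rho> / (1 - \<kappa>)"
      unfolding M_def using k by (simp add: field_simps)
    show ?case
    proof (intro allI impI)
      fix j assume j: "\<bar>j - c\<bar> \<le> int n + 1 - int (Suc m)"
      have "d j \<le> \<kappa> * M + \<rho>" using j by (intro step M0 IH) auto
      then show "d j \<le> \<kappa> ^ Suc m * B + \<rho> / (1 - \<kappa>)" using eq by simp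
    qed
  qed
  from this[of "n+1"] show ?thesis by simp
qed

lemma geometric_bound_imp_le:
  fixes a c \<kappa> B :: real
  assumes "0 \<le> \<kappa>" "\<kappa> < 1" and "\<And>n::nat. a \<le> \<kappa> ^ n * B + c"
  shows "a \<le> c"
proof -
  have "(\<lambda>n. \<kappa> ^ n * B + c) \<longlonglongrightarrow> 0 * B + c"
    using assms by (intro tendsto_intros LIMSEQ_realpow_zero)
  then show ?thesis using assms(3) by (intro LIMSEQ_le_const[where X = "\<lambda>n. \<kappa> ^ n * B + c"]) auto
qed

text \<open>Iterating the step lets any a priori bound decay to c. Here c collects the free data of
  a solution, while every other equation contracts.\<close>

lemma sup_contraction_le:
  fixes d :: "nat \<Rightarrow> real"
  assumes k: "0 \<le> \<kappa>" "\<kappa> < 1" and c: "0 \<le> c" and bnd: "\<And>k. d k \<le> B"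
    and step: "\<And>k M. 0 \<le> M \<Longrightarrow> (\<And>j. d j \<le> M) \<Longrightarrow> d k \<le> max c (\<kappa> * M)"
  shows "d k \<le> c"
proof -
  define B' where "B' = max B 0"
  have B': "0 \<le> B'" "\<And>k. d k \<le> B'" using bnd unfolding B'_def by (auto simp: le_max_iff_disj)
  have "\<forall>k. d k \<le> max c (\<kappa> ^ m * B')" for m
  proof (induction m)
    case 0 then show ?case using B' by (auto simp: le_max_iff_disj)
  next
    case (Suc m)
    have "d k \<le> max c (\<kappa> * max c (\<kappa> ^ m * B'))" for k
      using Suc c by (intro step) auto
    moreover have "\<kappa> * max c (\<kappa> ^ m * B') \<le> max c (\<kappa> ^ Suc m * B')"
      using k c mult_left_le_one_le[of c \<kappa>] by (auto simp: max_def mult.assoc)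
    ultimately show ?case using c by (meson max.bounded_iff max.cobounded1 order.trans)
  qed
  then have "d k \<le> \<kappa> ^ m * B' + c" for m
    using k B' c by (smt (verit) max_def mult_nonneg_nonneg zero_le_power)
  then show ?thesis using geometric_bound_imp_le[OF k] by blast
qed

text \<open>D / (\<xi> - 1) is the fixed point of a = \<xi> * a - D. A deficit below it would be
  multiplied by at least \<xi> in every step and contradict boundedness. Applied to z-coordinates,
  it reads off their present value from the future of x.\<close>

lemma bounded_recursion_lower:
  fixes a :: "nat \<Rightarrow> real"
  assumes xi: "1 < \<xi>" and bnd: "\<And>k. \<bar>a k\<bar> \<le> B" and step: "\<And>k. a (Suc k) + D \<le> \<xi> * a k"
  shows "D / (\<xi> - 1) \<le> a k"
proof -
  define d where "d k = D / (\<xi> - 1) - a k" for k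
  have st: "d k \<le> d (Suc k) / \<xi>" for k
  proof -
    have "\<xi> * d k = D + D / (\<xi> - 1) - \<xi> * a k" unfolding d_def using xi by (simp add: field_simps)
    also have "\<dots> \<le> d (Suc k)" unfolding d_def using step[of k] by simp
    finally show ?thesis using xi by (simp add: field_simps)
  qed
  have bd: "d k \<le> \<bar>D / (\<xi> - 1)\<bar> + B" for k unfolding d_def using bnd[of k] by linarith
  have "d k \<le> 0"
  proof (rule sup_contraction_le[where \<kappa> = "1 / \<xi>" and c = 0, OF _ _ _ bd])
    show "d k \<le> max 0 (1 / \<xi> * M)" if "0 \<le> M" "\<And>j. d j \<le> M" for k M
      using st[of k] that(2)[of "Suc k"] xi by (smt (verit) divide_right_mono max.coboundedI2 mult_cancel_right2 times_divide_eq_left)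
  qed (use xi in auto)
  then show ?thesis unfolding d_def by simp
qed

text \<open>The new |x'| is at least about 4.13 |x|, so 3/10 |x'| exceeds |y'|, which is about |x|.
  The term 2 \<epsilon> |z| absorbs the share of z in the perturbation, and \<xi> >= 1 + 2
  \<epsilon> keeps |z| from shrinking up to multiples of |x| and |y|. The slack r is halved, so the
  cone also attracts: r = 0 serves for two orbits with equal initial y, r > 0 for vectors with a
  long past.\<close>

lemma cone_step:
  fixes \<epsilon> \<xi> :: real
  assumes eps: "0 \<le> \<epsilon>" "\<epsilon> \<le> 1 / 1000000" and xi: "1 + 2 * \<epsilon> \<le> \<xi>" and mu: "413/100 \<le> \<bar>\<mu>\<bar>"
    and x: "x' = \<mu> * x + 3/10 * y + e1" and y: "y' = x + e2" and z: "z' = \<xi> * z + x + e3"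
    and e1: "\<bar>e1\<bar> \<le> \<epsilon> * (\<bar>x\<bar> + \<bar>y\<bar> + \<bar>z\<bar>)" and e2: "\<bar>e2\<bar> \<le> \<epsilon> * (\<bar>x\<bar> + \<bar>y\<bar> + \<bar>z\<bar>)"
    and e3: "\<bar>e3\<bar> \<le> \<epsilon> * (\<bar>x\<bar> + \<bar>y\<bar> + \<bar>z\<bar>)"
    and r: "\<bar>y\<bar> \<le> 3/10 * \<bar>x\<bar> + 2 * \<epsilon> * \<bar>z\<bar> + r" "0 \<le> r"
  shows "\<bar>y'\<bar> \<le> 3/10 * \<bar>x'\<bar> + 2 * \<epsilon> * \<bar>z'\<bar> + r / 2"
proof -
  define X Y Z where "X = \<bar>x\<bar>" and "Y = \<bar>y\<bar>" and "Z = \<epsilon> * \<bar>z\<bar>"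
  have nn: "0 \<le> X" "0 \<le> Y" "0 \<le> Z" using eps by (auto simp: X_def Y_def Z_def)
  have eX: "0 \<le> \<epsilon> * X" "\<epsilon> * X \<le> X / 1000000" using eps nn by (auto simp: mult_right_mono[of \<epsilon> "1/1000000" X, simplified])
  have eY: "0 \<le> \<epsilon> * Y" "\<epsilon> * Y \<le> Y / 1000000" using eps nn by (auto simp: mult_right_mono[of \<epsilon> "1/1000000" Y, simplified])
  have eZ: "0 \<le> \<epsilon> * Z" "\<epsilon> * Z \<le> Z / 1000000" using eps nn by (auto simp: mult_right_mono[of \<epsilon> "1/1000000" Z, simplified])
  have E: "\<epsilon> * (\<bar>x\<bar> + \<bar>y\<bar> + \<bar>z\<bar>) \<le> X / 1000000 + Y / 1000000 + Z"
    using eX eY by (simp add: X_def Y_def Z_def algebra_simps)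
  have r': "Y \<le> 3/10 * X + 2 * Z + r" using r by (simp add: X_def Y_def Z_def)
  have mX: "413/100 * X \<le> \<bar>\<mu> * x\<bar>" unfolding X_def abs_mult using mu by (intro mult_right_mono) auto
  have "\<bar>\<mu> * x\<bar> \<le> \<bar>x'\<bar> + 3/10 * Y + (X / 1000000 + Y / 1000000 + Z)"
    using x e1 E unfolding Y_def by linarith
  then have x'1: "413/100 * X - (3/10) * Y - (X / 1000000 + Y / 1000000 + Z) \<le> \<bar>x'\<bar>" using mX by linarith
  have xz: "\<bar>z\<bar> + 2 * Z \<le> \<bar>\<xi> * z\<bar>" unfolding Z_def abs_mult
    using mult_right_mono[OF xi, of "\<bar>z\<bar>"] xi eps by (simp add: algebra_simps)
  have "\<bar>z\<bar> + 2 * Z \<le> \<bar>z'\<bar> + X + (X / 1000000 + Y / 1000000 + Z)"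
    using xz z e3 E unfolding X_def by linarith
  then have "\<bar>z\<bar> - X - (X / 1000000 + Y / 1000000) \<le> \<bar>z'\<bar>" using nn by linarith
  then have "\<epsilon> * (\<bar>z\<bar> - X - (X / 1000000 + Y / 1000000)) \<le> \<epsilon> * \<bar>z'\<bar>" using eps by (intro mult_left_mono) auto
  then have z'1: "Z - \<epsilon> * X - (\<epsilon> * X / 1000000 + \<epsilon> * Y / 1000000) \<le> \<epsilon> * \<bar>z'\<bar>"
    by (simp add: Z_def algebra_simps)
  have "\<bar>y'\<bar> \<le> X + (X / 1000000 + Y / 1000000 + Z)" using y e2 E unfolding X_def by linarith
  then show ?thesis using x'1 z'1 r' eX eY eZ nn r(2) by linarith
qed

section \<open>Itineraries of perturbed Henon sequences\<close>

lemma four_sq_lower: "0 \<le> x \<Longrightarrow> 4 * c * c \<le> 4 * x\<^sup>2 \<Longrightarrow> (c::real) \<le> x"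
  by (rule power2_le_imp_le) (auto simp: power2_eq_square)

lemma four_sq_upper: "4 * x\<^sup>2 \<le> 4 * c * c \<Longrightarrow> 0 \<le> c \<Longrightarrow> (x::real) \<le> c"
  by (rule power2_le_imp_le) (auto simp: power2_eq_square)

text \<open>Only absolute errors enter, so the dependence of a perturbed map on z is hidden in
  \<epsilon> and the first two coordinates form a planar pseudo-orbit.\<close>

locale henon_seq =
  fixes \<epsilon> :: real and x y :: "nat \<Rightarrow> real"
  assumes eps: "0 \<le> \<epsilon>" "\<epsilon> \<le> 1 / 1000000"
    and x_le: "\<bar>x k\<bar> \<le> 1" and y_le: "\<bar>y k\<bar> \<le> 1"
    and x_Suc: "\<bar>x (Suc k) - (4 * (x k)\<^sup>2 + 3/10 * y k - (2375/1000))\<bar> \<le> \<epsilon>"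
    and y_Suc: "\<bar>y (Suc k) - x k\<bar> \<le> \<epsilon>"
begin

lemma sq_bounds:
  assumes "L \<le> x (Suc k)" "x (Suc k) \<le> U" "l \<le> y k" "y k \<le> u"
  shows "L - (3/10) * u + 2374999/1000000 \<le> 4 * (x k)\<^sup>2" "4 * (x k)\<^sup>2 \<le> U - (3/10) * l + 2375001/1000000"
proof -
  have "x (Suc k) - (4 * (x k)\<^sup>2 + 3/10 * y k - (2375/1000)) \<le> 1/1000000"
    "- (1/1000000) \<le> x (Suc k) - (4 * (x k)\<^sup>2 + 3/10 * y k - (2375/1000))"
    using x_Suc[of k] eps by linarith+
  then show "L - (3/10) * u + 2374999/1000000 \<le> 4 * (x k)\<^sup>2" "4 * (x k)\<^sup>2 \<le> U - (3/10) * l + 2375001/1000000"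
    using assms by linarith+
qed

text \<open>This and the next three rules are interval arithmetic for the inverse branches:
  \<open>4 * (x k)\<^sup>2\<close> equals x_(k+1) - 0.3 y_k + 2.375 up to 10^-6, is enclosed by
  means of bounds for the two neighbours, and c is a rounded root. The bounds for y come in turn
  from the preceding x.\<close>

lemma pos_lower:
  assumes "0 < x k" "L \<le> x (Suc k)" "y k \<le> u" "4 * c * c \<le> L - (3/10) * u + 2374999/1000000"
  shows "c \<le> x k"
  by (rule four_sq_lower) (use sq_bounds(1)[OF assms(2) order.refl order.refl assms(3)] assms in simp_all)

lemma pos_upper:
  assumes "x (Suc k) \<le> U" "l \<le> y k" "U - (3/10) * l + 2375001/1000000 \<le> 4 * c * c" "0 \<le> c"
  shows "x k \<le> c"
  by (rule four_sq_upper) (use sq_bounds(2)[OF order.refl assms(1) assms(2) order.refl] assms in simp_all)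

lemma neg_upper:
  assumes "x k < 0" "L \<le> x (Suc k)" "y k \<le> u" "4 * c * c \<le> L - (3/10) * u + 2374999/1000000"
  shows "x k \<le> - c"
proof -
  have "c \<le> - x k"
    by (rule four_sq_lower) (use sq_bounds(1)[OF assms(2) order.refl order.refl assms(3)] assms in simp_all)
  then show ?thesis by simp
qed

lemma neg_lower:
  assumes "x (Suc k) \<le> U" "l \<le> y k" "U - (3/10) * l + 2375001/1000000 \<le> 4 * c * c" "0 \<le> c"
  shows "- c \<le> x k"
proof -
  have "- x k \<le> c"
    by (rule four_sq_upper) (use sq_bounds(2)[OF order.refl assms(1) assms(2) order.refl] assms in simp_all)
  then show ?thesis by simp
qed

text \<open>With |x| and |y| at most 1, the square of x lies between about 1.075/4 and 3.675/4. The
  lower bound is the source of the expansion: 8 * 0.517 = 4.136.\<close>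

lemma x_bounds: "517/1000 \<le> \<bar>x k\<bar>" "\<bar>x k\<bar> \<le> 959/1000"
proof -
  have 1: "-1 \<le> x (Suc k)" "x (Suc k) \<le> 1" "-1 \<le> y k" "y k \<le> 1"
    using x_le[of "Suc k"] y_le[of k] by auto
  note b = sq_bounds[OF 1]
  show "517/1000 \<le> \<bar>x k\<bar>" by (rule four_sq_lower) (use b in \<open>simp_all add: power2_abs\<close>)
  have "4 * \<bar>x k\<bar>\<^sup>2 \<le> 4 * (959/1000) * (959/1000)" using b(2) unfolding power2_abs by simp
  then show "\<bar>x k\<bar> \<le> 959/1000" by (rule four_sq_upper) simp
qed

lemma x_pos_bounds: "0 < x k \<Longrightarrow> (517/1000) \<le> x k \<and> x k \<le> 959/1000"
  and x_neg_bounds: "x k < 0 \<Longrightarrow> -(959/1000) \<le> x k \<and> x k \<le> -(517/1000)"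
  using x_bounds[of k] by auto

lemma y_le': "\<bar>y (Suc k)\<bar> \<le> 96/100"
  using y_Suc[of k] x_bounds[of k] eps by linarith

lemma y_near: "x k - (1/1000000) \<le> y (Suc k)" "y (Suc k) \<le> x k + 1/1000000"
  using y_Suc[of k] eps by auto

text \<open>Bootstrapping: crude bounds for all later x are fed back into the inverse branches, in
  the rounds A to D and a last one, until the intervals are narrow enough. The final interval
  surrounds the negative fixed point of x -> \<open>4 * x\<^sup>2\<close> + 0.3 x - 2.375, about
  -0.688.\<close>

lemma plus_minus_tail:
  assumes n: "0 < x n" "\<bar>y n\<bar> \<le> 96/100" and tl: "\<And>k. k > n \<Longrightarrow> x k < 0"
  shows "602/1000 \<le> x n" "x n \<le> 722/1000" "-(617/1000) \<le> x (Suc n)" "x (Suc n) \<le> -(603/1000)"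
    and "\<And>k. k \<ge> n + 2 \<Longrightarrow> -(702/1000) \<le> x k \<and> x k \<le> -(680/1000)"
proof -
  have yn: "-(96/100) \<le> y n" "y n \<le> 96/100" using n by auto
  have A: "-(733/1000) \<le> x (Suc (Suc k)) \<and> x (Suc (Suc k)) \<le> -(626/1000)" if k: "k \<ge> n" for k
  proof -
    have s: "x (Suc k) < 0" "x (Suc (Suc k)) < 0" "x (Suc (Suc (Suc k))) < 0" using tl k by auto
    note b = x_neg_bounds[OF s(1)] x_neg_bounds[OF s(3)] y_near[of "Suc k"]
    have "-(733/1000) \<le> x (Suc (Suc k))" by (rule neg_lower[where U = "-(517/1000)" and l = "-(96/100)"]) (use b in auto)
    moreover have "x (Suc (Suc k)) \<le> -(626/1000)"
      by (rule neg_upper[OF s(2), where L = "-(959/1000)" and u = "-(516/1000)"]) (use b in auto)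
    ultimately show ?thesis by blast
  qed
  have s1: "x (Suc n) < 0" using tl by auto
  have B: "-(632/1000) \<le> x (Suc n) \<and> x (Suc n) \<le> -(581/1000)"
  proof -
    note b = x_pos_bounds[OF n(1)] A[OF order.refl] y_near[of n]
    have "-(632/1000) \<le> x (Suc n)" by (rule neg_lower[where U = "-(626/1000)" and l = "516/1000"]) (use b in auto)
    moreover have "x (Suc n) \<le> -(581/1000)"
      by (rule neg_upper[OF s1, where L = "-(733/1000)" and u = "96/100"]) (use b in auto)
    ultimately show ?thesis by blast
  qed
  have B': "-(733/1000) \<le> x (Suc k) \<and> x (Suc k) \<le> -(581/1000)" if "k \<ge> n" for k
    using that B A[of "k - 1"] by (cases "k = n"; cases k) auto
  have C: "-(702/1000) \<le> x (Suc (Suc k)) \<and> x (Suc (Suc k)) \<le> -(673/1000)" if k: "k \<ge> n" for k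
  proof -
    have s: "x (Suc (Suc k)) < 0" using tl k by auto
    note b = B'[OF k] A[of "Suc k"] y_near[of "Suc k"] k
    have "-(702/1000) \<le> x (Suc (Suc k))" by (rule neg_lower[where U = "-(626/1000)" and l = "-(734/1000)"]) (use b in auto)
    moreover have "x (Suc (Suc k)) \<le> -(673/1000)"
      by (rule neg_upper[OF s, where L = "-(733/1000)" and u = "-(580/1000)"]) (use b in auto)
    ultimately show ?thesis by blast
  qed
  show xn: "602/1000 \<le> x n" by (rule pos_lower[OF n(1), where L = "-(632/1000)" and u = "96/100"]) (use B yn in auto)
  show xn': "x n \<le> 722/1000" by (rule pos_upper[where U = "-(581/1000)" and l = "-(96/100)"]) (use B yn in auto)
  show D: "-(617/1000) \<le> x (Suc n)"
    by (rule neg_lower[where U = "-(673/1000)" and l = "601/1000"]) (use C[of n] xn xn' y_near[of n] in auto)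
  show D': "x (Suc n) \<le> -(603/1000)"
    by (rule neg_upper[OF s1, where L = "-(702/1000)" and u = "723/1000"]) (use C[of n] xn xn' y_near[of n] in auto)
  have D'': "x (Suc k) \<le> -(603/1000)" if "k \<ge> n" for k
    using that D' C[of "k - 1"] by (cases "k = n"; cases k) auto
  have "-(702/1000) \<le> x (Suc (Suc k)) \<and> x (Suc (Suc k)) \<le> -(680/1000)" if k: "k \<ge> n" for k
  proof -
    have s: "x (Suc (Suc k)) < 0" using tl k by auto
    note b = D''[OF k] C[of "Suc k"] y_near[of "Suc k"] k
    have "x (Suc (Suc k)) \<le> -(680/1000)"
      by (rule neg_upper[OF s, where L = "-(702/1000)" and u = "-(602/1000)"]) (use b in auto)
    then show ?thesis using C[OF k] by blast
  qed
  note F = this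
  show "-(702/1000) \<le> x k \<and> x k \<le> -(680/1000)" if "k \<ge> n + 2" for k
    using F[of "k - 2"] that by (simp add: numeral_2_eq_2 Suc_diff_Suc)
qed

text \<open>The same bootstrap at the positive fixed point, about 0.863. The late tail enters the
  gap argument through a lower bound, the times n and n + 1 through two-sided ones.\<close>

lemma minus_plus_tail:
  assumes n: "x n < 0" "\<bar>y n\<bar> \<le> 96/100" and tl: "\<And>k. k > n \<Longrightarrow> 0 < x k"
  shows "-(950/1000) \<le> x n" "x n \<le> -(866/1000)" "933/1000 \<le> x (Suc n)" "x (Suc n) \<le> 943/1000"
    and "\<And>k. k \<ge> n + 2 \<Longrightarrow> (857/1000) \<le> x k"
proof -
  have yn: "-(96/100) \<le> y n" "y n \<le> 96/100" using n by auto
  have A: "806/1000 \<le> x (Suc (Suc k)) \<and> x (Suc (Suc k)) \<le> 892/1000" if k: "k \<ge> n" for k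
  proof -
    have s: "x (Suc k) > 0" "x (Suc (Suc k)) > 0" "x (Suc (Suc (Suc k))) > 0" using tl k by auto
    note b = x_pos_bounds[OF s(1)] x_pos_bounds[OF s(3)] y_near[of "Suc k"]
    have "x (Suc (Suc k)) \<le> 892/1000" by (rule pos_upper[where U = "959/1000" and l = "516/1000"]) (use b in auto)
    moreover have "806/1000 \<le> x (Suc (Suc k))"
      by (rule pos_lower[OF s(2), where L = "517/1000" and u = "96/100"]) (use b in auto)
    ultimately show ?thesis by blast
  qed
  have s1: "x (Suc n) > 0" using tl by auto
  have B: "913/1000 \<le> x (Suc n) \<and> x (Suc n) \<le> 943/1000"
  proof -
    note b = x_neg_bounds[OF n(1)] A[OF order.refl] y_near[of n]
    have "x (Suc n) \<le> 943/1000" by (rule pos_upper[where U = "892/1000" and l = "-(96/100)"]) (use b in auto)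
    moreover have "913/1000 \<le> x (Suc n)"
      by (rule pos_lower[OF s1, where L = "806/1000" and u = "-(516/1000)"]) (use b in auto)
    ultimately show ?thesis by blast
  qed
  have B': "806/1000 \<le> x (Suc k) \<and> x (Suc k) \<le> 943/1000" if "k \<ge> n" for k
    using that B A[of "k - 1"] by (cases "k = n"; cases k) auto
  have C: "851/1000 \<le> x (Suc (Suc k))" if k: "k \<ge> n" for k
    by (rule pos_lower[where L = "806/1000" and u = "944/1000"])
      (use B'[OF k] A[of "Suc k"] y_near[of "Suc k"] k tl in auto)
  show xn: "x n \<le> -(866/1000)" by (rule neg_upper[OF n(1), where L = "913/1000" and u = "96/100"]) (use B yn in auto)
  show xn': "-(950/1000) \<le> x n" by (rule neg_lower[where U = "943/1000" and l = "-(96/100)"]) (use B yn in auto)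
  show "x (Suc n) \<le> 943/1000" using B by simp
  show D: "933/1000 \<le> x (Suc n)"
    by (rule pos_lower[OF s1, where L = "851/1000" and u = "-(8659/10000)"]) (use C[of n] xn y_near[of n] in auto)
  have "857/1000 \<le> x (Suc (Suc k))" if k: "k \<ge> n" for k
    by (rule pos_lower[where L = "851/1000" and u = "944/1000"])
      (use B'[OF k] C[of "Suc k"] y_near[of "Suc k"] k tl in auto)
  note F = this
  show "857/1000 \<le> x k" if "k \<ge> n + 2" for k
    using F[of "k - 2"] that by (simp add: numeral_2_eq_2 Suc_diff_Suc)
qed

end

section \<open>Backward invariant cones for the difference of two orbits\<close>

text \<open>Here x and z are coordinate differences at one time, x' and z' those one step later, w
  is slope times x, and t and s are the perturbation shares \<epsilon> |z| and \<epsilon> |x|. Since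
  |x| is at most about z'/2, the equation z' = \<xi> z + x leaves z at least about z'/3.4 when \<xi>
  <= 1.712, and 2 z still dominates |x|.\<close>

lemma cone_backward_steep:
  fixes x z x' z' w :: real
  assumes xi: "1 < \<xi>" "\<xi> \<le> 1712/1000" and w: "413/100 * \<bar>x\<bar> \<le> \<bar>w\<bar>"
    and t: "0 \<le> t" "t \<le> \<bar>z\<bar> / 1000000" and s: "0 \<le> s" "s \<le> \<bar>x\<bar> / 1000000"
    and a: "\<bar>x' - w\<bar> \<le> 1/10 * \<bar>x\<bar> + 2 * t" and b: "\<bar>z' - \<xi> * z - x\<bar> \<le> 2 * s + 2 * t"
    and c: "0 < z'" "\<bar>x'\<bar> \<le> 2 * z'"
  shows "0 < z \<and> \<bar>x\<bar> \<le> 2 * z"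
proof -
  have x: "403/100 * \<bar>x\<bar> \<le> 2 * z' + 2 * t" using w a c by linarith
  show ?thesis
  proof (cases "0 < z")
    case True
    then have "\<xi> * z \<le> 1712/1000 * z" using xi by (intro mult_right_mono) auto
    moreover have "z' \<le> \<xi> * z + \<bar>x\<bar> + 2 * s + 2 * t" using b by linarith
    ultimately show ?thesis using True x t s by (intro conjI) linarith+
  next
    case False
    then have "\<xi> * z \<le> z" using xi mult_right_mono_neg[of 1 \<xi> z] by auto
    moreover have "z' \<le> \<xi> * z + \<bar>x\<bar> + 2 * s + 2 * t" using b by linarith
    ultimately show ?thesis using False x t s c by linarith
  qed
qed

text \<open>The wide cone x' <= z'/0.22 survives a step of slope at least 6.8: then x is at most
  about 0.68 z', which leaves z about 0.187 z'. With a negative slope the sign of x flips, so -x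
  adds to z and the narrow cone |x| <= 2 z is entered at once. The edge - z / 100 tolerates the
  small negative x left by the perturbation.\<close>

lemma cone_backward_right:
  fixes x z x' z' w :: real
  assumes xi: "1 < \<xi>" "\<xi> \<le> 1712/1000"
    and t: "0 \<le> t" "t \<le> \<bar>z\<bar> / 1000000" and s: "0 \<le> s" "s \<le> \<bar>x\<bar> / 1000000"
    and a: "\<bar>x' - w\<bar> \<le> 1/10 * \<bar>x\<bar> + 2 * t" and b: "\<bar>z' - \<xi> * z - x\<bar> \<le> 2 * s + 2 * t"
    and c: "0 < z'" "- z' / 100 \<le> x'" "22/100 * x' \<le> z'"
  shows "(0 \<le> x \<longrightarrow> (68/10) * x \<le> w) \<Longrightarrow> (x \<le> 0 \<longrightarrow> w \<le> 68/10 * x) \<Longrightarrow> 0 < z \<and> - z / 100 \<le> x \<and> (22/100) * x \<le> z"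
    and "(0 \<le> x \<longrightarrow> w \<le> - (413/100) * x) \<Longrightarrow> (x \<le> 0 \<longrightarrow> - (413/100) * x \<le> w) \<Longrightarrow> 0 < z \<and> \<bar>x\<bar> \<le> 2 * z"
proof -
  have z: "0 < z \<and> \<xi> * z \<le> 1712/1000 * z \<or> z \<le> 0 \<and> \<xi> * z \<le> z"
  proof (cases "0 < z")
    case True
    then have "\<xi> * z \<le> 1712/1000 * z" using xi by (intro mult_right_mono) auto
    then show ?thesis using True by blast
  next
    case False
    then have "\<xi> * z \<le> z" using xi mult_right_mono_neg[of 1 \<xi> z] by auto
    then show ?thesis using False by auto
  qed
  have bz: "z' \<le> \<xi> * z + x + 2 * s + 2 * t" using b by linarith
  have aw: "x' - (1/10) * \<bar>x\<bar> - 2 * t \<le> w" "w \<le> x' + 1/10 * \<bar>x\<bar> + 2 * t" using a by linarith+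
  show "0 < z \<and> - z / 100 \<le> x \<and> (22/100) * x \<le> z"
    if h: "0 \<le> x \<longrightarrow> (68/10) * x \<le> w" "x \<le> 0 \<longrightarrow> w \<le> 68/10 * x"
  proof (cases "0 \<le> x")
    case True
    then have *: "\<bar>x\<bar> = x" "68/10 * x \<le> w" using h by auto
    show ?thesis using z * True bz aw t s c by (elim disjE conjE) (intro conjI; simp only: abs_of_pos abs_of_nonpos; linarith)+
  next
    case False
    then have *: "\<bar>x\<bar> = - x" "w \<le> 68/10 * x" using h by auto
    show ?thesis using z * False bz aw t s c by (elim disjE conjE) (intro conjI; simp only: abs_of_pos abs_of_nonpos; linarith)+
  qed
  show "0 < z \<and> \<bar>x\<bar> \<le> 2 * z"
    if h: "0 \<le> x \<longrightarrow> w \<le> - (413/100) * x" "x \<le> 0 \<longrightarrow> - (413/100) * x \<le> w"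
  proof (cases "0 \<le> x")
    case True
    then have *: "\<bar>x\<bar> = x" "w \<le> - (413/100) * x" using h by auto
    show ?thesis using z * True bz aw t s c by (elim disjE conjE) (intro conjI; simp only: abs_of_pos abs_of_nonpos; linarith)+
  next
    case False
    then have *: "\<bar>x\<bar> = - x" "- (413/100) * x \<le> w" using h by auto
    show ?thesis using z * False bz aw t s c by (elim disjE conjE) (intro conjI; simp only: abs_of_pos abs_of_nonpos; linarith)+
  qed
qed

section \<open>The gap inequality\<close>

text \<open>Orbit p carries w+---... and q carries w-+++..., with n the length of w. Errors are
  bounded twice: absolutely, for the tails where the symbols disagree, and relative to the
  difference, for the common prefix, whose length is arbitrary.\<close>

locale gap_pair = p: henon_seq \<epsilon> xp yp + q: henon_seq \<epsilon> xq yq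
  for \<epsilon> :: real and xp yp xq yq :: "nat \<Rightarrow> real" +
  fixes zp zq :: "nat \<Rightarrow> real" and \<xi> B :: real and n :: nat
  assumes xi: "1 < \<xi>" "\<xi> \<le> 1712/1000" "2 * \<epsilon> \<le> \<xi> - 1"
    and z_le: "\<bar>zp k\<bar> \<le> B" "\<bar>zq k\<bar> \<le> B" and eps_B: "\<epsilon> * B \<le> 1/1000000"
    and z_Suc: "\<bar>zp (Suc k) - (\<xi> * zp k + xp k)\<bar> \<le> \<epsilon>" "\<bar>zq (Suc k) - (\<xi> * zq k + xq k)\<bar> \<le> \<epsilon>"
    and diff_x: "\<bar>(xp (Suc k) - xq (Suc k)) - (4 * (xp k + xq k) * (xp k - xq k) + 3/10 * (yp k - yq k))\<bar>
      \<le> \<epsilon> * (\<bar>xp k - xq k\<bar> + \<bar>yp k - yq k\<bar> + \<bar>zp k - zq k\<bar>)"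
    and diff_y: "\<bar>(yp (Suc k) - yq (Suc k)) - (xp k - xq k)\<bar>
      \<le> \<epsilon> * (\<bar>xp k - xq k\<bar> + \<bar>yp k - yq k\<bar> + \<bar>zp k - zq k\<bar>)"
    and diff_z: "\<bar>(zp (Suc k) - zq (Suc k)) - (\<xi> * (zp k - zq k) + (xp k - xq k))\<bar>
      \<le> \<epsilon> * (\<bar>xp k - xq k\<bar> + \<bar>yp k - yq k\<bar> + \<bar>zp k - zq k\<bar>)"
    and y0: "\<bar>yp 0\<bar> \<le> 96/100" "yp 0 = yq 0"
    and before: "k < n \<Longrightarrow> 0 < xp k \<longleftrightarrow> 0 < xq k"
    and at: "0 < xp n" "xq n < 0"
    and after: "k > n \<Longrightarrow> xp k < 0" "k > n \<Longrightarrow> 0 < xq k"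
begin

definition "dx k = xp k - xq k"
definition "dy k = yp k - yq k"
definition "dz k = zp k - zq k"
definition "w k = 4 * (xp k + xq k) * dx k"

lemmas diffs = diff_x[folded dx_def dy_def dz_def, folded w_def] diff_y[folded dx_def dy_def dz_def]
  diff_z[folded dx_def dy_def dz_def]

lemma y_bounds: "\<bar>yp k\<bar> \<le> 96/100" "\<bar>yq k\<bar> \<le> 96/100"
  using y0 p.y_le' q.y_le' by (cases k; simp)+

lemma eps_dz: "\<epsilon> * \<bar>dz k\<bar> \<le> 2/1000000" "\<epsilon> * \<bar>dz k\<bar> \<le> \<bar>dz k\<bar> / 1000000" "0 \<le> \<epsilon> * \<bar>dz k\<bar>"
  and eps_dx: "\<epsilon> * \<bar>dx k\<bar> \<le> \<bar>dx k\<bar> / 1000000" "0 \<le> \<epsilon> * \<bar>dx k\<bar>"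
proof -
  have "\<bar>dz k\<bar> \<le> 2 * B" using z_le[of k] unfolding dz_def by linarith
  then have "\<epsilon> * \<bar>dz k\<bar> \<le> \<epsilon> * (2 * B)" using p.eps by (intro mult_left_mono) auto
  then show "\<epsilon> * \<bar>dz k\<bar> \<le> 2/1000000" using eps_B by simp
  show "\<epsilon> * \<bar>dz k\<bar> \<le> \<bar>dz k\<bar> / 1000000" "\<epsilon> * \<bar>dx k\<bar> \<le> \<bar>dx k\<bar> / 1000000"
    using mult_right_mono[OF p.eps(2), of "\<bar>dz k\<bar>"] mult_right_mono[OF p.eps(2), of "\<bar>dx k\<bar>"] by auto
qed (use p.eps in auto)

lemma slope_bound:
  assumes "k < n" shows "413/100 \<le> \<bar>4 * (xp k + xq k)\<bar>"
proof -
  have "0 < xp k \<and> 0 < xq k \<or> xp k < 0 \<and> xq k < 0"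
    using before[OF assms] p.x_bounds[of k] q.x_bounds[of k] by linarith
  then show ?thesis
    using p.x_pos_bounds[of k] q.x_pos_bounds[of k] p.x_neg_bounds[of k] q.x_neg_bounds[of k]
    by (elim disjE conjE) (simp_all add: abs_if)
qed

lemma dy_cone: "k \<le> n \<Longrightarrow> \<bar>dy k\<bar> \<le> 3/10 * \<bar>dx k\<bar> + 2 * \<epsilon> * \<bar>dz k\<bar>"
proof (induction k)
  case 0
  then show ?case using y0 p.eps by (simp add: dy_def)
next
  case (Suc k)
  have "\<bar>dy (Suc k)\<bar> \<le> 3/10 * \<bar>dx (Suc k)\<bar> + 2 * \<epsilon> * \<bar>dz (Suc k)\<bar> + 0 / 2"
  proof (rule cone_step[OF p.eps _ slope_bound[of k], where \<xi> = \<xi> and x = "dx k" and y = "dy k" and z = "dz k"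
      and ?e1.0 = "dx (Suc k) - (w k + 3/10 * dy k)" and ?e2.0 = "dy (Suc k) - dx k"
      and ?e3.0 = "dz (Suc k) - (\<xi> * dz k + dx k)"])
    show "\<bar>dy k\<bar> \<le> 3/10 * \<bar>dx k\<bar> + 2 * \<epsilon> * \<bar>dz k\<bar> + 0" using Suc by auto
  qed (use Suc xi diffs[of k] in \<open>auto simp: w_def\<close>)
  then show ?case by simp
qed

text \<open>The cone for dy removes y from the recursion: 0.3 |dy| costs 0.09 |dx|, and a planar
  system in dx and dz remains. It is confined to times before n, where the common sign supplies the
  slope bound.\<close>

lemma step:
  assumes "k < n"
  shows step_x: "\<bar>dx (Suc k) - w k\<bar> \<le> 1/10 * \<bar>dx k\<bar> + 2 * (\<epsilon> * \<bar>dz k\<bar>)"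
    and step_z: "\<bar>dz (Suc k) - \<xi> * dz k - dx k\<bar> \<le> 2 * (\<epsilon> * \<bar>dx k\<bar>) + 2 * (\<epsilon> * \<bar>dz k\<bar>)"
proof -
  have c: "\<bar>dy k\<bar> \<le> 3/10 * \<bar>dx k\<bar> + 2 * (\<epsilon> * \<bar>dz k\<bar>)" using dy_cone[of k] assms by simp
  have ec: "\<epsilon> * \<bar>dy k\<bar> \<le> \<epsilon> * ((3/10) * \<bar>dx k\<bar> + 2 * (\<epsilon> * \<bar>dz k\<bar>))"
    using c p.eps by (intro mult_left_mono) auto
  have ee: "\<epsilon> * (\<epsilon> * \<bar>dz k\<bar>) \<le> 1/1000000 * (\<epsilon> * \<bar>dz k\<bar>)"
    using p.eps eps_dz(3)[of k] by (intro mult_right_mono) auto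
  have ec': "\<epsilon> * \<bar>dy k\<bar> \<le> 3/10 * (\<epsilon> * \<bar>dx k\<bar>) + 2 * (\<epsilon> * (\<epsilon> * \<bar>dz k\<bar>))"
    using ec by (simp add: algebra_simps)
  have E: "\<epsilon> * (\<bar>dx k\<bar> + \<bar>dy k\<bar> + \<bar>dz k\<bar>) = \<epsilon> * \<bar>dx k\<bar> + \<epsilon> * \<bar>dy k\<bar> + \<epsilon> * \<bar>dz k\<bar>"
    by (simp add: algebra_simps)
  have F: "\<epsilon> * (\<bar>dx k\<bar> + \<bar>dy k\<bar> + \<bar>dz k\<bar>) \<le> 13/10 * (\<epsilon> * \<bar>dx k\<bar>) + 10001/10000 * (\<epsilon> * \<bar>dz k\<bar>)"
    unfolding E using ec' ee eps_dz(3)[of k] by linarith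
  have "\<bar>dx (Suc k) - w k\<bar> \<le> 3/10 * \<bar>dy k\<bar> + ((13/10) * (\<epsilon> * \<bar>dx k\<bar>) + 10001/10000 * (\<epsilon> * \<bar>dz k\<bar>))"
    using diffs(1)[of k] F by linarith
  then show "\<bar>dx (Suc k) - w k\<bar> \<le> 1/10 * \<bar>dx k\<bar> + 2 * (\<epsilon> * \<bar>dz k\<bar>)"
    using c eps_dx[of k] eps_dz(3)[of k] by linarith
  show "\<bar>dz (Suc k) - \<xi> * dz k - dx k\<bar> \<le> 2 * (\<epsilon> * \<bar>dx k\<bar>) + 2 * (\<epsilon> * \<bar>dz k\<bar>)"
    using diffs(3)[of k] F eps_dx(2)[of k] eps_dz(3)[of k] by linarith
qed

text \<open>No cone is involved, so these hold at every time. They serve from time n on, where the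
  slope bound is lost, and in the last steps before n, where the differences are known
  numerically.\<close>

lemma step_abs: "\<bar>dx (Suc k) - (w k + 3/10 * dy k)\<bar> \<le> 2 * \<epsilon>" "\<bar>dy (Suc k) - dx k\<bar> \<le> 2 * \<epsilon>"
  "\<bar>dz (Suc k) - (\<xi> * dz k + dx k)\<bar> \<le> 2 * \<epsilon>"
proof -
  have "dx (Suc k) - (w k + 3/10 * dy k) = (xp (Suc k) - (4 * (xp k)\<^sup>2 + 3/10 * yp k - (2375/1000)))
      - (xq (Suc k) - (4 * (xq k)\<^sup>2 + 3/10 * yq k - (2375/1000)))"
    unfolding w_def dx_def dy_def by (simp add: power2_eq_square field_simps)
  then show "\<bar>dx (Suc k) - (w k + 3/10 * dy k)\<bar> \<le> 2 * \<epsilon>"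
    using p.x_Suc[of k] q.x_Suc[of k] by linarith
  show "\<bar>dy (Suc k) - dx k\<bar> \<le> 2 * \<epsilon>" using p.y_Suc[of k] q.y_Suc[of k] unfolding dx_def dy_def by linarith
  have "\<xi> * dz k = \<xi> * zp k - \<xi> * zq k" by (simp add: dz_def algebra_simps)
  then show "\<bar>dz (Suc k) - (\<xi> * dz k + dx k)\<bar> \<le> 2 * \<epsilon>"
    using z_Suc[of k] unfolding dx_def dz_def by linarith
qed

text \<open>The differences are followed backwards from time \<open>n\<close>, where \<open>dx\<close> is too large compared with \<open>dz\<close> for the
  cone \<open>\<bar>dx\<bar> \<le> 2 * dz\<close>, which is invariant under all backward steps. The second alternative is the weaker cone that
  is still invariant as long as the orbits stay to the right, where the slope is at least \<open>6.8\<close>. The critical case is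
  that of two symbols \<open>+\<close> before time \<open>n\<close>; for \<open>\<xi> = 1.712\<close> the numerical margin in \<open>dz n\<close> is then
  less than a tenth of its value.\<close>

definition aligned where "aligned k \<longleftrightarrow> 0 < dz k \<and> (\<bar>dx k\<bar> \<le> 2 * dz k \<or>
    - dz k / 100 \<le> dx k \<and> (22/100) * dx k \<le> dz k \<and> (81/100) \<le> xp k \<and> (81/100) \<le> xq k)"

lemma w_lower:
  assumes "0 < xp k" "0 < xq k" "c \<le> 4 * (xp k + xq k)"
  shows "0 \<le> dx k \<Longrightarrow> c * dx k \<le> w k" "dx k \<le> 0 \<Longrightarrow> w k \<le> c * dx k"
  using mult_right_mono[OF assms(3), of "dx k"] mult_right_mono_neg[OF assms(3), of "dx k"] unfolding w_def by auto

lemma w_upper: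
  assumes "k < n" "xp k < 0"
  shows "0 \<le> dx k \<Longrightarrow> w k \<le> - (413/100) * dx k" "dx k \<le> 0 \<Longrightarrow> - (413/100) * dx k \<le> w k"
proof -
  have "xq k < 0" using before[OF assms(1)] assms(2) q.x_bounds[of k] by linarith
  then have "4 * (xp k + xq k) \<le> - (413/100)" using assms p.x_neg_bounds[of k] q.x_neg_bounds[of k] by simp
  then show "0 \<le> dx k \<Longrightarrow> w k \<le> - (413/100) * dx k" "dx k \<le> 0 \<Longrightarrow> - (413/100) * dx k \<le> w k"
    unfolding w_def by (metis mult_right_mono, metis mult_right_mono_neg)
qed

lemma sign_cases:
  assumes "k < n"
  obtains "0 < xp k" "0 < xq k" | "xp k < 0" "xq k < 0"
  using before[OF assms] p.x_bounds[of k] q.x_bounds[of k] by linarith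

text \<open>The bound 0.81 reproduces itself: if the next x is at least 0.81 and the symbol is +,
  the inverse branch gives at least 0.851, hence slope at least 8 * 0.851 > 6.8. A symbol - leads to
  the narrow cone instead.\<close>

lemma aligned_backward_right:
  assumes k: "k < n" and pos: "0 < dz (Suc k)"
    and c: "- dz (Suc k) / 100 \<le> dx (Suc k)" "22/100 * dx (Suc k) \<le> dz (Suc k)"
    and x: "0 < xp k \<Longrightarrow> (81/100) \<le> xp (Suc k) \<and> (81/100) \<le> xq (Suc k)"
  shows "aligned k"
proof -
  note bw = cone_backward_right[OF xi(1,2) eps_dz(3) eps_dz(2) eps_dx(2) eps_dx(1) step_x[OF k] step_z[OF k] pos c]
  show ?thesis
  proof (rule sign_cases[OF k])
    assume s: "0 < xp k" "0 < xq k"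
    have "851/1000 \<le> xp k" by (rule p.pos_lower[OF s(1), where L = "81/100" and u = "96/100"]) (use x s y_bounds[of k] in auto)
    moreover have "851/1000 \<le> xq k" by (rule q.pos_lower[OF s(2), where L = "81/100" and u = "96/100"]) (use x s y_bounds[of k] in auto)
    ultimately show ?thesis using bw(1) w_lower[OF s, of "68/10"] unfolding aligned_def by auto
  next
    assume s: "xp k < 0" "xq k < 0"
    show ?thesis using bw(2) w_upper[OF k s(1)] unfolding aligned_def by auto
  qed
qed

lemma aligned_backward:
  assumes k: "k < n" and J: "aligned (Suc k)"
  shows "aligned k"
proof (cases "\<bar>dx (Suc k)\<bar> \<le> 2 * dz (Suc k)")
  case True
  have "413/100 * \<bar>dx k\<bar> \<le> \<bar>w k\<bar>"
    using mult_right_mono[OF slope_bound[OF k], of "\<bar>dx k\<bar>"] unfolding w_def abs_mult by simp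
  from cone_backward_steep[OF xi(1,2) this eps_dz(3) eps_dz(2) eps_dx(2) eps_dx(1) step_x[OF k] step_z[OF k] _ True]
  show ?thesis using J unfolding aligned_def by auto
next
  case False
  then show ?thesis using J by (intro aligned_backward_right[OF k]) (auto simp: aligned_def)
qed

lemma aligned_imp_pos:
  assumes "aligned k" "k \<le> n"
  shows "0 < dz 0"
  using assms
proof (induction k)
  case (Suc k)
  then show ?case using aligned_backward[of k] by simp
qed (simp add: aligned_def)

lemma xi_mult_le: "0 < \<xi> * z \<Longrightarrow> \<xi> * z \<le> 1712/1000 * z \<and> 0 < z"
  using xi by (auto simp: zero_less_mult_iff mult_right_mono)

lemmas p_tail = p.plus_minus_tail[OF at(1) y_bounds(1) after(1)]
lemmas q_tail = q.minus_plus_tail[OF at(2) y_bounds(2) after(2)]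

text \<open>All later dx are at most -1.536, by -0.603 - 0.933 at time n + 1 and -0.680 - 0.857
  afterwards. With \<xi> - 1 <= 0.712, the quotient 1.5359 / 0.712 lies just above 2.157.\<close>

lemma dz_Suc_n: "2157/1000 \<le> dz (Suc n)"
proof -
  have dxk: "dx k \<le> -(1536/1000)" if "k \<ge> n + 1" for k
  proof (cases "k = Suc n")
    case True
    then show ?thesis using p_tail(4) q_tail(3) by (simp add: dx_def)
  next
    case False
    then show ?thesis using p_tail(5)[of k] q_tail(5)[of k] that by (simp add: dx_def)
  qed
  have "(15359/10000) / (\<xi> - 1) \<le> dz (Suc n + 0)"
  proof (rule bounded_recursion_lower[OF xi(1), where a = "\<lambda>k. dz (Suc n + k)" and B = "2 * B" and k = 0])
    show "\<bar>dz (Suc n + k)\<bar> \<le> 2 * B" for k using z_le[of "Suc n + k"] unfolding dz_def by linarith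
    show "dz (Suc n + Suc k) + 15359/10000 \<le> \<xi> * dz (Suc n + k)" for k
      using step_abs(3)[of "Suc n + k"] dxk[of "Suc n + k"] p.eps by simp
  qed
  moreover have "2157/1000 * (\<xi> - 1) \<le> 15359/10000" using xi by simp
  then have "2157/1000 \<le> (15359/10000) / (\<xi> - 1)" using xi by (simp add: field_simps)
  ultimately show ?thesis by simp
qed

text \<open>dx n is at most 0.722 + 0.950 = 1.672, and (2.157 - 1.672) / 1.712 exceeds 0.28.\<close>

lemma dz_n: "28/100 \<le> dz n"
proof -
  have "48/100 \<le> \<xi> * dz n" using step_abs(3)[of n] dz_Suc_n p_tail(2) q_tail(1) p.eps by (simp add: dx_def)
  then show ?thesis using xi_mult_le[of "dz n"] by simp
qed

text \<open>The bounds at time n do not place the difference in either cone. So the last steps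
  before n are computed explicitly, branching on the common symbols at n - 1 and n - 2, until
  \<open>aligned\<close> or time 0 is reached.\<close>

lemma gap: "0 < dz 0"
proof (cases n)
  case 0
  then show ?thesis using dz_n by simp
next
  case (Suc m)
  then have mn: "m < n" by simp
  note sx = step_x[OF mn, folded Suc] and sz = step_z[OF mn, folded Suc]
  have dxn: "1468/1000 \<le> dx n" using p_tail(1) q_tail(2) by (simp add: dx_def)
  show ?thesis
  proof (rule sign_cases[OF mn])
    assume s: "xp m < 0" "xq m < 0"
    \<comment> \<open>A common symbol - makes the slope negative, so dx m is negative, adds to dz m,
      and the narrow cone holds at once.\<close>
    have neg: "dx m \<le> 0" using w_upper(1)[OF mn s(1)] sx dxn eps_dz(1)[of m] by (cases "0 \<le> dx m") auto
    have "dz n + \<bar>dx m\<bar> - 2 * (\<epsilon> * \<bar>dx m\<bar>) - 2 * (\<epsilon> * \<bar>dz m\<bar>) \<le> \<xi> * dz m" using sz neg by linarith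
    then have "9/10 * \<bar>dx m\<bar> + 27/100 \<le> \<xi> * dz m" using dz_n eps_dx(1)[of m] eps_dz(1)[of m] by linarith
    then have "0 < dz m \<and> \<bar>dx m\<bar> \<le> 2 * dz m" using xi_mult_le[of "dz m"] by linarith
    then show ?thesis using aligned_imp_pos[of m] mn unfolding aligned_def by auto
  next
    assume s: "0 < xp m" "0 < xq m"
    have ym: "-(96/100) \<le> yp m" "yp m \<le> 96/100" "-(96/100) \<le> yq m" "yq m \<le> 96/100" using y_bounds[of m] by auto
    have pm: "819/1000 \<le> xp m" "xp m \<le> 920/1000"
      by (rule p.pos_lower[OF s(1), where L = "602/1000" and u = "96/100"]; use ym p_tail(1) Suc in simp)
        (rule p.pos_upper[where U = "722/1000" and l = "-(96/100)"]; use ym p_tail(2) Suc in simp)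
    have qm: "533/1000 \<le> xq m" "xq m \<le> 671/1000"
      by (rule q.pos_lower[OF s(2), where L = "-(950/1000)" and u = "96/100"]; use ym q_tail(1) Suc in simp)
        (rule q.pos_upper[where U = "-(866/1000)" and l = "-(96/100)"]; use ym q_tail(2) Suc in simp)
    \<comment> \<open>The common + at m confines y at time n to a short interval for each orbit.
      This sharpens both x at time n and lowers the bound on dx n from 1.672 to 1.507.\<close>
    have yn: "818/1000 \<le> yp n" "yp n \<le> 921/1000" "532/1000 \<le> yq n" "yq n \<le> 672/1000"
      using p.y_near[of m] q.y_near[of m] pm qm Suc by auto
    have pn: "608/1000 \<le> xp n" "xp n \<le> 618/1000"
      by (rule p.pos_lower[OF at(1), where L = "-(617/1000)" and u = "921/1000"]; use yn p_tail(3) in simp)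
        (rule p.pos_upper[where U = "-(603/1000)" and l = "818/1000"]; use yn p_tail(4) in simp)
    have qn: "xq n \<le> -(881/1000)" "-(889/1000) \<le> xq n"
      by (rule q.neg_upper[OF at(2), where L = "933/1000" and u = "672/1000"]; use yn q_tail(3) in simp)
        (rule q.neg_lower[where U = "943/1000" and l = "532/1000"]; use yn q_tail(4) in simp)
    have dxn': "dx n \<le> 1507/1000" using pn qn by (simp add: dx_def)
    have "6499/10000 \<le> \<xi> * dz n" using step_abs(3)[of n] dz_Suc_n dxn' p.eps by simp
    then have dzn: "379/1000 \<le> dz n" using xi_mult_le[of "dz n"] by simp
    have pm': "820/1000 \<le> xp m" by (rule p.pos_lower[OF s(1), where L = "608/1000" and u = "96/100"]) (use ym pn Suc in simp_all)
    have qm': "547/1000 \<le> xq m" by (rule q.pos_lower[OF s(2), where L = "-(889/1000)" and u = "96/100"]) (use ym qn Suc in simp_all)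
    have wm: "0 \<le> dx m \<Longrightarrow> (5468/1000) * dx m \<le> w m" "dx m \<le> 0 \<Longrightarrow> w m \<le> 5468/1000 * dx m"
      using w_lower[OF s, of "5468/1000"] pm' qm' by auto
    have dxm: "0 < dx m"
    proof (rule ccontr)
      assume "\<not> 0 < dx m"
      then show False using wm(2) sx dxn eps_dz(1)[of m] by linarith
    qed
    \<comment> \<open>0.2757 is 1.5071 / 5.468 rounded up, and 0.103 is 0.379 - 0.2757 rounded
      down.\<close>
    have main: "6/100 \<le> dz m" if "dx m \<le> 2757/10000"
    proof -
      have "103/1000 \<le> \<xi> * dz m" using step_abs(3)[of m] dzn that p.eps Suc by simp
      then show ?thesis using xi_mult_le[of "dz m"] by simp
    qed
    show ?thesis
    proof (cases m)
      case 0
      then have "w m \<le> 15071/10000" using step_abs(1)[of m] y0 dxn' p.eps Suc by (simp add: dy_def)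
      then have "dx m \<le> 2757/10000" using wm(1) dxm by simp
      then show ?thesis using main 0 by simp
    next
      case (Suc l)
      then have ln: "l < n" using mn by simp
      note lx = step_x[OF ln, folded Suc]
      show ?thesis
      proof (rule sign_cases[OF ln])
        assume sl: "xp l < 0" "xq l < 0"
        \<comment> \<open>The preceding - makes y at time m negative. This pushes both x at time m
          to the right and raises the slope from 5.468 to 6.1.\<close>
        have yl: "yp m \<le> -(51/100)" "yq m \<le> -(51/100)"
          using sl p.x_neg_bounds[of l] q.x_neg_bounds[of l] p.y_near[of l] q.y_near[of l] Suc by auto
        have "885/1000 \<le> xp m" by (rule p.pos_lower[OF s(1), where L = "608/1000" and u = "-(51/100)"]) (use yl pn \<open>n = Suc m\<close> in simp_all)
        moreover have "640/1000 \<le> xq m" by (rule q.pos_lower[OF s(2), where L = "-(889/1000)" and u = "-(51/100)"]) (use yl qn \<open>n = Suc m\<close> in simp_all)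
        ultimately have "61/10 * dx m \<le> w m" using w_lower(1)[OF s, of "61/10"] dxm by simp
        then have dxm': "dx m \<le> 252/1000" using sx dxn' eps_dz(1)[of m] dxm by simp
        have "126/1000 \<le> \<xi> * dz m" using step_abs(3)[of m] dzn dxm' p.eps \<open>n = Suc m\<close> by simp
        then have "7/100 \<le> dz m" using xi_mult_le[of "dz m"] by simp
        then have "aligned l" using dxm dxm' sl Suc by (intro aligned_backward_right[OF ln]) auto
        then show ?thesis using aligned_imp_pos ln by auto
      next
        assume sl: "0 < xp l" "0 < xq l"
        have pl: "852/1000 \<le> xp l" by (rule p.pos_lower[OF sl(1), where L = "820/1000" and u = "96/100"]) (use y_bounds[of l] pm' Suc in auto)
        have ql: "811/1000 \<le> xq l" by (rule q.pos_lower[OF sl(2), where L = "547/1000" and u = "96/100"]) (use y_bounds[of l] qm' Suc in auto)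
        have wl: "0 \<le> dx l \<Longrightarrow> (6652/1000) * dx l \<le> w l" "dx l \<le> 0 \<Longrightarrow> w l \<le> 6652/1000 * dx l"
          using w_lower[OF sl, of "6652/1000"] pl ql by auto
        \<comment> \<open>A negative dx l would enlarge w m through - 0.3 * dy m. It is excluded up
          to the perturbation because dx m > 0 and the slope at l is positive; the same bound gives
          the lower edge of the wide cone.\<close>
        have dxl: "- (1/100000) \<le> dx l"
          using wl(2) lx dxm eps_dz(1)[of l] by (cases "dx l \<le> 0") auto
        have "w m \<le> 15071/10000" using step_abs(1)[of m] step_abs(2)[of l] dxl dxn' p.eps Suc \<open>n = Suc m\<close> by simp
        then have dxm': "dx m \<le> 2757/10000" using wm(1) dxm by simp
        have dzm: "6/100 \<le> dz m" by (rule main[OF dxm'])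
        have dxl': "dx l \<le> 422/10000"
          using wl(1) lx dxm' eps_dz(1)[of l] by (cases "0 \<le> dx l") auto
        \<comment> \<open>0.06 - 0.0422 leaves a little more than 0.0177, and 0.22 * 0.0422 < 0.0103
          puts time l into the wide cone.\<close>
        have "177/10000 \<le> \<xi> * dz l" using step_abs(3)[of l] dzm dxl' p.eps Suc by simp
        then have "103/10000 \<le> dz l" using xi_mult_le[of "dz l"] by simp
        then have "aligned l" unfolding aligned_def using dxl dxl' pl ql by auto
        then show ?thesis using aligned_imp_pos ln by auto
      qed
    qed
  qed
qed

end

section \<open>The skew product, its box and the weighted norm\<close>

definition henon_skew :: "real \<Rightarrow> real ^ 3 \<Rightarrow> real ^ 3" where
  "henon_skew \<xi> p = vector [4 * (p $ 1)\<^sup>2 + 3/10 * p $ 2 - (2375/1000), p $ 1, \<xi> * p $ 3 + p $ 1]"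

definition region :: "real \<Rightarrow> (real ^ 3) set" where
  "region \<xi> = {p. \<bar>p $ 1\<bar> \<le> 1 \<and> \<bar>p $ 2\<bar> \<le> 1 \<and> \<bar>p $ 3\<bar> \<le> 1 / (\<xi> - 1)}"

text \<open>The margin in x keeps the fixed point operator inside: the new y is the previous x plus
  an error and must not exceed 1, and (z - x)/\<xi> respects the bound 1/(\<xi> - 1) when |x| plus
  the error is at most 1.\<close>

definition core :: "real \<Rightarrow> (real ^ 3) set" where
  "core \<xi> = {p. \<bar>p $ 1\<bar> \<le> (97/100) \<and> \<bar>p $ 2\<bar> \<le> 1 \<and> \<bar>p $ 3\<bar> \<le> 1 / (\<xi> - 1)}"

lemma core_region: "p \<in> core \<xi> \<Longrightarrow> p \<in> region \<xi>"
  by (auto simp: core_def region_def)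

lemma closed_core: "closed (core \<xi>)"
proof -
  have "core \<xi> = {p. \<bar>p $ 1\<bar> \<le> (97/100)} \<inter> {p. \<bar>p $ 2\<bar> \<le> 1} \<inter> {p. \<bar>p $ 3\<bar> \<le> 1 / (\<xi> - 1)}"
    by (auto simp: core_def)
  also have "closed \<dots>" by (intro closed_Int closed_Collect_le continuous_intros)
  finally show ?thesis .
qed

lemma closed_region: "closed (region \<xi>)"
proof -
  have "region \<xi> = {p. \<bar>p $ 1\<bar> \<le> 1} \<inter> {p. \<bar>p $ 2\<bar> \<le> 1} \<inter> {p. \<bar>p $ 3\<bar> \<le> 1 / (\<xi> - 1)}"
    by (auto simp: region_def)
  also have "closed \<dots>" by (intro closed_Int closed_Collect_le continuous_intros)
  finally show ?thesis .
qed

lemma norm_le_sum3: "norm (v :: real ^ 3) \<le> \<bar>v $ 1\<bar> + \<bar>v $ 2\<bar> + \<bar>v $ 3\<bar>"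
  using norm_le_l1_cart[of v] unfolding sum_3 .

lemma vec3_eqI: "(p :: real ^ 3) $ 1 = q $ 1 \<Longrightarrow> p $ 2 = q $ 2 \<Longrightarrow> p $ 3 = q $ 3 \<Longrightarrow> p = q"
  by (simp add: vec_eq_iff forall_3)

lemma compact_region: "compact (region \<xi>)"
proof -
  have "norm p \<le> 2 + \<bar>1 / (\<xi> - 1)\<bar>" if "p \<in> region \<xi>" for p
    using that norm_le_sum3[of p] abs_ge_self[of "1 / (\<xi> - 1)"] unfolding region_def mem_Collect_eq by linarith
  then have "bounded (region \<xi>)" by (auto simp: bounded_iff)
  then show ?thesis using closed_region by (simp add: compact_eq_bounded_closed)
qed

lemma convex_region: "convex (region \<xi>)"
proof -
  have "region \<xi> = (\<lambda>p. p $ 1) -` {-1..1} \<inter> ((\<lambda>p. p $ 2) -` {-1..1} \<inter> (\<lambda>p. p $ 3) -` {- (1 / (\<xi> - 1))..1 / (\<xi> - 1)})"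
    by (auto simp: region_def abs_le_iff)
  also have "convex \<dots>"
    by (intro convex_Int convex_linear_vimage convex_real_interval bounded_linear.linear bounded_linear_vec_nth)
  finally show ?thesis .
qed

section \<open>Constants and the weighted maximum norm\<close>

locale params =
  fixes \<xi> :: real
  assumes xi: "1 < \<xi>" "\<xi> \<le> 1712/1000"
begin

abbreviation "reg \<equiv> region \<xi>"

text \<open>Quadratic in \<xi> - 1: passing from \<open>nrm\<close> to the Euclidean norm costs
  \<open>nrmC\<close>, of order 1/(\<xi> - 1), and the resulting error must still be small against
  the margin \<xi> - 1 of the z-direction.\<close>

definition "tol = (\<xi> - 1)\<^sup>2 / 1000000"
definition "wt = (\<xi> - 1) / 4"
text \<open>Dictated by z: solving backwards gives at most (M + \<open>wt\<close> M)/\<xi> = (1 +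
  (\<xi> - 1)/4) M/\<xi>, and \<open>rate\<close> = (1 + (\<xi> - 1)/2)/\<xi> leaves the other
  (\<xi> - 1)/4 for perturbations.\<close>

definition "rate = (1 + \<xi>) / (2 * \<xi>)"
definition "nrmC = 3 + 1 / wt"

text \<open>The weight 1/2 makes the step y = x contract; in the x-equation y then costs 0.6 M
  against a slope above 4.13. The weight \<open>wt\<close> makes the influence of x on z small
  compared with \<xi> - 1.\<close>

definition nrm :: "real ^ 3 \<Rightarrow> real" where
  "nrm v = max \<bar>v $ 1\<bar> (max (\<bar>v $ 2\<bar> / 2) (wt * \<bar>v $ 3\<bar>))"

lemma wt: "0 < wt" "wt < 2/10" using xi by (auto simp: wt_def)
lemma tol: "0 < tol" "tol \<le> 1/1000000" "tol \<le> (\<xi> - 1) / 1000000"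
proof -
  have "(\<xi> - 1)\<^sup>2 \<le> (\<xi> - 1) * 1" unfolding power2_eq_square using xi by (intro mult_left_mono) auto
  then show "0 < tol" "tol \<le> 1/1000000" "tol \<le> (\<xi> - 1) / 1000000" using xi by (auto simp: tol_def)
qed
lemma rate: "0 < rate" "rate < 1" "79/100 \<le> rate" using xi by (auto simp: rate_def field_simps)
lemma nrmC: "3 \<le> nrmC" "tol * nrmC \<le> 1/100000 * (\<xi> - 1)" "tol * nrmC \<le> 5/1000000"
proof -
  show "3 \<le> nrmC" using wt by (simp add: nrmC_def)
  have "tol * nrmC = (3 * (\<xi> - 1)\<^sup>2 + 4 * (\<xi> - 1)) / 1000000"
    unfolding nrmC_def tol_def wt_def using xi by (simp add: field_simps power2_eq_square)
  also have "\<dots> = (3 * (\<xi> - 1) + 4) * (\<xi> - 1) / 1000000" by (simp add: algebra_simps power2_eq_square)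
  finally have eq: "tol * nrmC = (3 * (\<xi> - 1) + 4) * (\<xi> - 1) / 1000000" .
  have "(3 * (\<xi> - 1) + 4) * (\<xi> - 1) \<le> 62/10 * (\<xi> - 1)" using xi by (intro mult_right_mono) auto
  then have a: "tol * nrmC \<le> 62/10000000 * (\<xi> - 1)" using eq by simp
  then show "tol * nrmC \<le> 1/100000 * (\<xi> - 1)" using xi by simp
  show "tol * nrmC \<le> 5/1000000" using a xi by simp
qed

lemma nrm_le_iff: "nrm v \<le> M \<longleftrightarrow> \<bar>v $ 1\<bar> \<le> M \<and> \<bar>v $ 2\<bar> \<le> 2 * M \<and> wt * \<bar>v $ 3\<bar> \<le> M"
  by (auto simp: nrm_def)

lemma nrm_nonneg: "0 \<le> nrm v" by (auto simp: nrm_def le_max_iff_disj)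

lemma sum3_le_nrm: "\<bar>v $ 1\<bar> + \<bar>v $ 2\<bar> + \<bar>v $ 3\<bar> \<le> nrmC * nrm v"
proof -
  have b: "\<bar>v $ 1\<bar> \<le> nrm v" "\<bar>v $ 2\<bar> \<le> 2 * nrm v" "wt * \<bar>v $ 3\<bar> \<le> nrm v"
    using nrm_le_iff[of v "nrm v"] by auto
  then have "\<bar>v $ 3\<bar> \<le> nrm v / wt" using wt by (simp add: field_simps)
  then show ?thesis using b by (simp add: nrmC_def algebra_simps)
qed

lemma norm_le_nrm: "norm v \<le> nrmC * nrm v"
  using norm_le_sum3[of v] sum3_le_nrm[of v] by linarith

lemma nrm_le_norm: "nrm v \<le> norm v"
proof -
  have "\<bar>v $ 1\<bar> \<le> norm v" "\<bar>v $ 2\<bar> \<le> norm v" "\<bar>v $ 3\<bar> \<le> norm v" by (rule component_le_norm_cart)+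
  moreover have "wt * \<bar>v $ 3\<bar> \<le> 1 * \<bar>v $ 3\<bar>" using wt by (intro mult_right_mono) auto
  ultimately show ?thesis unfolding nrm_le_iff using norm_ge_zero[of v] by linarith
qed

lemma nrm_eq_0: "nrm v \<le> 0 \<longleftrightarrow> v = 0"
proof
  assume "nrm v \<le> 0"
  then have "norm v \<le> 0" using norm_le_nrm[of v] nrmC nrm_nonneg[of v] by simp
  then show "v = 0" by simp
qed (simp add: nrm_def)

lemma nrm_triangle: "nrm (u + v) \<le> nrm u + nrm v"
proof -
  have u: "\<bar>u $ 1\<bar> \<le> nrm u" "\<bar>u $ 2\<bar> \<le> 2 * nrm u" "wt * \<bar>u $ 3\<bar> \<le> nrm u"
    and v: "\<bar>v $ 1\<bar> \<le> nrm v" "\<bar>v $ 2\<bar> \<le> 2 * nrm v" "wt * \<bar>v $ 3\<bar> \<le> nrm v"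
    using nrm_le_iff[of u "nrm u"] nrm_le_iff[of v "nrm v"] by auto
  have "wt * \<bar>u $ 3 + v $ 3\<bar> \<le> wt * (\<bar>u $ 3\<bar> + \<bar>v $ 3\<bar>)" using wt by (intro mult_left_mono) auto
  then show ?thesis unfolding nrm_le_iff using u v by (simp add: algebra_simps) linarith
qed

lemma nrm_minus_commute: "nrm (u - v) = nrm (v - u)"
  by (simp add: nrm_def abs_minus_commute)

lemma region_nrm_diff: "p \<in> reg \<Longrightarrow> q \<in> reg \<Longrightarrow> nrm (p - q) \<le> 2"
proof -
  assume pq: "p \<in> reg" "q \<in> reg"
  then have "\<bar>(p - q) $ 3\<bar> \<le> 2 / (\<xi> - 1)" by (auto simp: region_def)
  then have "wt * \<bar>(p - q) $ 3\<bar> \<le> wt * (2 / (\<xi> - 1))" using wt by (intro mult_left_mono) auto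
  also have "\<dots> \<le> 2" using xi by (simp add: wt_def field_simps)
  finally show "nrm (p - q) \<le> 2" unfolding nrm_le_iff using pq by (auto simp: region_def)
qed

text \<open>One estimate per coordinate, shared by the orbit equation and its linearisation: e
  collects deviations, and \<rho> allows for two different maps. For x the factor is about 1.6/4.13
  < 0.4; this sharp form is kept for the contraction of stable vectors.\<close>

lemma contract_x:
  assumes "0 \<le> M" "0 \<le> \<rho>" "413/100 \<le> \<bar>\<mu>\<bar>" "\<bar>x'\<bar> \<le> M" "\<bar>y\<bar> \<le> 2 * M"
    and "\<bar>e\<bar> \<le> tol * (nrmC * M) + \<rho>" "\<mu> * u = x' - (3/10) * y - e"
  shows "\<bar>u\<bar> \<le> 4/10 * M + \<rho>" "\<bar>u\<bar> \<le> rate * M + \<rho>"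
proof -
  have "tol * nrmC * M \<le> 5/1000000 * M" using nrmC assms(1) by (intro mult_right_mono) auto
  then have e: "\<bar>e\<bar> \<le> 5/1000000 * M + \<rho>" using assms by (simp add: mult.assoc)
  have "413/100 * \<bar>u\<bar> \<le> \<bar>\<mu> * u\<bar>" unfolding abs_mult using assms by (intro mult_right_mono) auto
  then have "413/100 * \<bar>u\<bar> \<le> 161/100 * M + \<rho>" using assms e by linarith
  then show a: "\<bar>u\<bar> \<le> 4/10 * M + \<rho>" using assms by simp
  have "4/10 * M \<le> rate * M" using rate assms by (intro mult_right_mono) auto
  then show "\<bar>u\<bar> \<le> rate * M + \<rho>" using a by simp
qed

lemma contract_y:
  assumes "0 \<le> M" "\<bar>x\<bar> \<le> M" "\<bar>e\<bar> \<le> tol * (nrmC * M) + \<rho>" "0 \<le> \<rho>"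
  shows "\<bar>x + e\<bar> \<le> 2 * (rate * M + \<rho>)"
proof -
  have "tol * nrmC * M \<le> 5/1000000 * M" using nrmC assms(1) by (intro mult_right_mono) auto
  then have "\<bar>e\<bar> \<le> 5/1000000 * M + \<rho>" using assms by (simp add: mult.assoc)
  moreover have "79/100 * M \<le> rate * M" using rate assms by (intro mult_right_mono) auto
  moreover have "\<bar>x + e\<bar> \<le> \<bar>x\<bar> + \<bar>e\<bar>" by (rule abs_triangle_ineq)
  ultimately show ?thesis unfolding distrib_left using assms(1,2,4) by linarith
qed

lemma contract_z:
  assumes "0 \<le> M" "0 \<le> \<rho>" "wt * \<bar>z\<bar> \<le> M" "\<bar>x\<bar> \<le> M" "\<bar>e\<bar> \<le> tol * (nrmC * M) + \<rho>"
    and "\<xi> * u = z - x - e"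
  shows "wt * \<bar>u\<bar> \<le> rate * M + \<rho>"
proof -
  have "tol * nrmC * M \<le> 5/1000000 * M" using nrmC assms(1) by (intro mult_right_mono) auto
  then have e: "\<bar>e\<bar> \<le> 5/1000000 * M + \<rho>" using assms by (simp add: mult.assoc)
  have "\<xi> * \<bar>u\<bar> = \<bar>z - x - e\<bar>" using xi by (simp add: abs_mult flip: assms(6))
  also have "\<dots> \<le> \<bar>z\<bar> + ((1000005/1000000) * M + \<rho>)" using assms(4) e by linarith
  finally have "wt * (\<xi> * \<bar>u\<bar>) \<le> wt * (\<bar>z\<bar> + ((1000005/1000000) * M + \<rho>))" using wt by (intro mult_left_mono) auto
  then have "\<xi> * (wt * \<bar>u\<bar>) \<le> M + wt * ((1000005/1000000) * M) + wt * \<rho>" using assms by (simp add: algebra_simps)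
  moreover have "wt * \<rho> \<le> \<xi> * \<rho>" using wt xi assms by (intro mult_right_mono) auto
  moreover have "wt * ((1000005/1000000) * M) \<le> (\<xi> - 1) / 2 * M" using wt xi assms by (simp add: wt_def mult_right_mono)
  moreover have "\<xi> * (rate * M + \<rho>) = M + (\<xi> - 1) / 2 * M + \<xi> * \<rho>" unfolding rate_def using xi by (simp add: field_simps)
  ultimately have "\<xi> * (wt * \<bar>u\<bar>) \<le> \<xi> * (rate * M + \<rho>)" by linarith
  then show ?thesis using xi by simp
qed

text \<open>Instead of a Banach space of bounded sequences, only pointwise limits of the iterates are used.\<close>

lemma seq_fixpoint:
  fixes T :: "(int \<Rightarrow> real ^ 3) \<Rightarrow> int \<Rightarrow> real ^ 3"
  assumes C: "closed C" "\<And>k::int. P0 k \<in> C"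
    and inv: "\<And>P k. (\<And>k::int. P k \<in> C) \<Longrightarrow> T P k \<in> C"
    and bnd: "\<And>u v. u \<in> C \<Longrightarrow> v \<in> C \<Longrightarrow> nrm (u - v) \<le> B"
    and contr: "\<And>P Q k M. (\<And>k. P k \<in> C) \<Longrightarrow> (\<And>k. Q k \<in> C) \<Longrightarrow> 0 \<le> M \<Longrightarrow>
      (\<And>j. j \<in> {k - 1, k, k + 1} \<Longrightarrow> nrm (P j - Q j) \<le> M) \<Longrightarrow> nrm (T P k - T Q k) \<le> rate * M"
  obtains P where "\<And>k. P k \<in> C" "T P = P"
proof -
  define I where "I m = (T ^^ m) P0" for m
  have IC: "I m k \<in> C" for m k
    unfolding I_def by (induction m arbitrary: k) (auto intro: C inv)
  have I_Suc: "I (Suc m) = T (I m)" for m by (simp add: I_def)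
  have B: "0 \<le> B" using bnd[OF C(2) C(2)] nrm_nonneg by (meson order.trans)
  have d: "nrm (I (Suc m) k - I m k) \<le> rate ^ m * B" for m k
  proof (induction m arbitrary: k)
    case 0 then show ?case using bnd[OF IC IC] by simp
  next
    case (Suc m)
    have "nrm (T (I (Suc m)) k - T (I m) k) \<le> rate * (rate ^ m * B)"
      using rate B by (intro contr IC Suc) auto
    then show ?case by (simp add: I_Suc)
  qed
  have conv: "convergent (\<lambda>m. I m k)" for k
  proof -
    have "summable (\<lambda>m. I (Suc m) k - I m k)"
    proof (rule summable_comparison_test')
      show "summable (\<lambda>m. nrmC * B * rate ^ m)" using rate by (intro summable_mult summable_geometric) auto
      show "norm (I (Suc m) k - I m k) \<le> nrmC * B * rate ^ m" for m
      proof -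
        have "nrmC * nrm (I (Suc m) k - I m k) \<le> nrmC * (rate ^ m * B)"
          using d[of m k] nrmC(1) by (intro mult_left_mono) auto
        then show ?thesis using norm_le_nrm[of "I (Suc m) k - I m k"] by (simp add: mult_ac)
      qed
    qed
    then have "convergent (\<lambda>n. \<Sum>m<n. I (Suc m) k - I m k)" by (simp add: summable_iff_convergent)
    then have "convergent (\<lambda>n. I n k - I 0 k)" using sum_lessThan_telescope[of "\<lambda>m. I m k"] by simp
    from convergent_add[OF this convergent_const[of "I 0 k"]] have "convergent (\<lambda>n. I n k)" by simp
    then show ?thesis .
  qed
  define L where "L k = lim (\<lambda>m. I m k)" for k
  have lim: "(\<lambda>m. I m k) \<longlonglongrightarrow> L k" for k
    using conv unfolding L_def by (simp add: convergent_LIMSEQ_iff)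
  have LC: "L k \<in> C" for k
    using closed_sequentially[OF C(1) _ lim[of k]] IC by blast
  have nl: "(\<lambda>m. nrm (L k - I m k)) \<longlonglongrightarrow> 0" for k
  proof (rule Lim_null_comparison)
    show "\<forall>\<^sub>F m in sequentially. norm (nrm (L k - I m k)) \<le> norm (I m k - L k)"
      using nrm_le_norm[of "L k - I m k" for m] nrm_nonneg by (auto simp: norm_minus_commute)
    show "(\<lambda>m. norm (I m k - L k)) \<longlonglongrightarrow> 0" using lim[of k] by (simp add: LIM_zero_iff tendsto_norm_zero)
  qed
  have "T L k = L k" for k
  proof -
    define M where "M m = nrm (L (k-1) - I m (k-1)) + nrm (L k - I m k) + nrm (L (k+1) - I m (k+1))" for m
    have M: "M \<longlonglongrightarrow> 0" unfolding M_def using tendsto_add[OF tendsto_add[OF nl[of "k-1"] nl[of k]] nl[of "k+1"]] by simp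
    have le: "nrm (T L k - L k) \<le> rate * M m + nrm (L k - I (Suc m) k)" for m
    proof -
      have "nrm (T L k - T (I m) k) \<le> rate * M m"
        by (intro contr LC IC) (auto simp: M_def nrm_nonneg intro!: add_nonneg_nonneg)
      moreover have "T L k - L k = (T L k - T (I m) k) + (I (Suc m) k - L k)" by (simp add: I_Suc)
      ultimately show ?thesis using nrm_triangle[of "T L k - T (I m) k" "I (Suc m) k - L k"]
        by (simp add: nrm_minus_commute)
    qed
    have "(\<lambda>m. rate * M m + nrm (L k - I (Suc m) k)) \<longlonglongrightarrow> rate * 0 + 0"
      by (intro tendsto_intros M LIMSEQ_Suc[OF nl])
    then have "nrm (T L k - L k) \<le> rate * 0 + 0" by (rule LIMSEQ_le_const) (use le in auto)
    then show ?thesis using nrm_eq_0[of "T L k - L k"] by simp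
  qed
  then show thesis using that LC by blast
qed

end

section \<open>Existence and comparison of orbits with prescribed itinerary\<close>

context params
begin

section \<open>The orbit equation solved by inverse branches\<close>

definition "err g p = g p - henon_skew \<xi> p"

text \<open>A C^1 bound in derivative-free form: existence and comparison of orbits then use only
  values of \<open>g\<close> on the box.\<close>

definition "near g \<longleftrightarrow> (\<forall>p\<in>reg. norm (err g p) \<le> tol) \<and>
  (\<forall>p\<in>reg. \<forall>q\<in>reg. norm (err g p - err g q) \<le> tol * norm (p - q))"

lemma g_nth:
  "g p $ 1 = 4 * (p $ 1)\<^sup>2 + 3/10 * p $ 2 - (2375/1000) + err g p $ 1"
  "g p $ 2 = p $ 1 + err g p $ 2"
  "g p $ 3 = \<xi> * p $ 3 + p $ 1 + err g p $ 3"
  by (simp_all add: err_def henon_skew_def)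

lemma err_le: "near g \<Longrightarrow> p \<in> reg \<Longrightarrow> \<bar>err g p $ i\<bar> \<le> tol"
  using component_le_norm_cart[of "err g p" i] by (fastforce simp: near_def)

text \<open>The point is moved under g first, then the map is changed at q. So two maps are compared
  using the Lipschitz bound for g alone and the distance of g and g' at q.\<close>

lemma err_diff:
  assumes "near g" "p \<in> reg" "q \<in> reg" and "norm (g q - g' q) \<le> \<rho>" "nrm (p - q) \<le> M"
  shows "\<bar>err g p $ i - err g' q $ i\<bar> \<le> tol * (nrmC * M) + \<rho>"
proof -
  have "norm (p - q) \<le> nrmC * M" using norm_le_nrm[of "p - q"] mult_left_mono[OF assms(5), of nrmC] nrmC(1) by linarith
  then have "tol * norm (p - q) \<le> tol * (nrmC * M)" using tol by (intro mult_left_mono) auto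
  moreover have "norm (err g p - err g q) \<le> tol * norm (p - q)" using assms by (auto simp: near_def)
  moreover have "err g p - err g' q = (err g p - err g q) + (g q - g' q)" by (simp add: err_def)
  then have "norm (err g p - err g' q) \<le> norm (err g p - err g q) + norm (g q - g' q)"
    using norm_triangle_ineq by metis
  moreover have "\<bar>(err g p - err g' q) $ i\<bar> \<le> norm (err g p - err g' q)" by (rule component_le_norm_cart)
  ultimately show ?thesis using assms(4) by simp
qed

text \<open>The radicand still contains p, through y and the error, so choosing the branch by the
  symbol yields an implicit equation, solved later as a fixed point.\<close>

definition "radicand g (pn :: real ^ 3) p = (pn $ 1 - (3/10) * p $ 2 + 2375/1000 - err g p $ 1) / 4"
definition "back_x g b pn p = (if b then 1 else -1) * sqrt (radicand g pn p)"
definition "back_z g (pn :: real ^ 3) p = (pn $ 3 - p $ 1 - err g p $ 3) / \<xi>"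

lemma radicand_bounds:
  assumes "near g" "p \<in> reg" "pn \<in> reg"
  shows "517/1000 \<le> sqrt (radicand g pn p)" "sqrt (radicand g pn p) \<le> 959/1000"
    "(sqrt (radicand g pn p))\<^sup>2 = radicand g pn p"
proof -
  have "\<bar>err g p $ 1\<bar> \<le> 1/1000000" using err_le[OF assms(1,2), of 1] tol(2) by linarith
  then have b: "268/1000 \<le> radicand g pn p" "radicand g pn p \<le> 919/1000"
    using assms unfolding radicand_def region_def by (auto simp: abs_le_iff)
  show "517/1000 \<le> sqrt (radicand g pn p)" by (rule real_le_rsqrt) (use b in \<open>simp add: power2_eq_square\<close>)
  show "sqrt (radicand g pn p) \<le> 959/1000" by (rule real_le_lsqrt) (use b in \<open>simp_all add: power2_eq_square\<close>)
  show "(sqrt (radicand g pn p))\<^sup>2 = radicand g pn p" using b by simp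
qed

lemma back_x_bounds:
  assumes "near g" "p \<in> reg" "pn \<in> reg"
  shows "517/1000 \<le> \<bar>back_x g b pn p\<bar>" "\<bar>back_x g b pn p\<bar> \<le> 959/1000" "b \<longleftrightarrow> 0 < back_x g b pn p"
proof -
  have "0 < sqrt (radicand g pn p)" using radicand_bounds(1)[OF assms] by linarith
  then show "517/1000 \<le> \<bar>back_x g b pn p\<bar>" "\<bar>back_x g b pn p\<bar> \<le> 959/1000" "b \<longleftrightarrow> 0 < back_x g b pn p"
    using radicand_bounds(1,2)[OF assms] unfolding back_x_def by (auto simp del: real_sqrt_gt_0_iff real_sqrt_lt_0_iff)
qed

lemma back_x_eq:
  assumes "near g" "p \<in> reg" "pn \<in> reg"
  shows "p $ 1 = back_x g b pn p \<longleftrightarrow> pn $ 1 = g p $ 1 \<and> (b \<longleftrightarrow> 0 < p $ 1)"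
proof
  assume a: "p $ 1 = back_x g b pn p"
  then have "(p $ 1)\<^sup>2 = radicand g pn p" using radicand_bounds(3)[OF assms] by (simp add: back_x_def power_mult_distrib)
  then have "pn $ 1 = g p $ 1" by (simp add: radicand_def g_nth[of g])
  then show "pn $ 1 = g p $ 1 \<and> (b \<longleftrightarrow> 0 < p $ 1)" using back_x_bounds(3)[OF assms, of b] a by simp
next
  assume a: "pn $ 1 = g p $ 1 \<and> (b \<longleftrightarrow> 0 < p $ 1)"
  then have "radicand g pn p = (p $ 1)\<^sup>2" by (simp add: radicand_def g_nth[of g])
  then have "sqrt (radicand g pn p) = \<bar>p $ 1\<bar>" by simp
  then show "p $ 1 = back_x g b pn p" using a radicand_bounds(1)[OF assms] by (auto simp: back_x_def)
qed

lemma x_bounds: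
  assumes "near g" "p \<in> reg" "g p \<in> reg"
  shows "517/1000 \<le> \<bar>p $ 1\<bar>" "\<bar>p $ 1\<bar> \<le> 959/1000"
  using back_x_bounds[OF assms, of "0 < p $ 1"] back_x_eq[OF assms, of "0 < p $ 1"] by auto

lemma back_z_eq: "p $ 3 = back_z g pn p \<longleftrightarrow> pn $ 3 = g p $ 3"
  using xi by (auto simp: back_z_def g_nth[of g] field_simps)

lemma back_z_bound:
  assumes "near g" "p \<in> core \<xi>" "pn \<in> core \<xi>"
  shows "\<bar>back_z g pn p\<bar> \<le> 1 / (\<xi> - 1)"
proof -
  have "\<bar>err g p $ 3\<bar> \<le> 1/1000000" using err_le[OF assms(1) core_region[OF assms(2)], of 3] tol(2) by linarith
  then have "\<bar>pn $ 3 - p $ 1 - err g p $ 3\<bar> \<le> 1 / (\<xi> - 1) + 1" using assms(2,3) unfolding core_def mem_Collect_eq by linarith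
  also have "\<dots> = \<xi> * (1 / (\<xi> - 1))" using xi by (simp add: field_simps)
  finally show ?thesis unfolding back_z_def using xi by (simp add: field_simps)
qed

lemma back_x_contract:
  assumes g: "near g" "near g'" "norm (g q - g' q) \<le> \<rho>"
    and p: "p \<in> reg" "pn \<in> reg" "q \<in> reg" "qn \<in> reg"
    and M: "0 \<le> M" "nrm (p - q) \<le> M" "nrm (pn - qn) \<le> M"
  shows "\<bar>back_x g b pn p - back_x g' b qn q\<bar> \<le> rate * M + \<rho>"
proof -
  define u v where "u = sqrt (radicand g pn p)" and "v = sqrt (radicand g' qn q)"
  note ub = radicand_bounds[OF g(1) p(1,2), folded u_def] and vb = radicand_bounds[OF g(2) p(3,4), folded v_def]
  have "\<bar>u - v\<bar> \<le> rate * M + \<rho>"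
  proof (rule contract_x(2))
    show "413/100 \<le> \<bar>4 * (u + v)\<bar>" using ub vb by simp
    \<comment> \<open>The difference of the roots is reached through the difference of their
      squares; the factor 4 * (u + v) is at least 4.136 and plays the role of the slope.\<close>
    show "4 * (u + v) * (u - v) = (pn $ 1 - qn $ 1) - (3/10) * (p $ 2 - q $ 2) - (err g p $ 1 - err g' q $ 1)"
    proof -
      have "4 * (u + v) * (u - v) = 4 * u\<^sup>2 - 4 * v\<^sup>2" by (simp add: power2_eq_square algebra_simps)
      also have "\<dots> = (pn $ 1 - qn $ 1) - (3/10) * (p $ 2 - q $ 2) - (err g p $ 1 - err g' q $ 1)"
        unfolding ub(3) vb(3) radicand_def by (simp add: field_simps)
      finally show ?thesis .
    qed
    show "\<bar>err g p $ 1 - err g' q $ 1\<bar> \<le> tol * (nrmC * M) + \<rho>"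
      by (rule err_diff) (fact g(1) p(1,3) g(3) M(2))+
    show "0 \<le> \<rho>" using g(3) norm_ge_zero order.trans by blast
  qed (use M nrm_le_iff[of "p - q" M] nrm_le_iff[of "pn - qn" M] in auto)
  then show ?thesis unfolding back_x_def u_def[symmetric] v_def[symmetric] by (auto simp: abs_minus_commute)
qed

lemma fwd_y_contract:
  assumes g: "near g" "norm (g q - g' q) \<le> \<rho>" and p: "p \<in> reg" "q \<in> reg" and M: "nrm (p - q) \<le> M"
  shows "\<bar>g p $ 2 - g' q $ 2\<bar> \<le> 2 * (rate * M + \<rho>)"
proof -
  have "\<bar>(p $ 1 - q $ 1) + (err g p $ 2 - err g' q $ 2)\<bar> \<le> 2 * (rate * M + \<rho>)"
  proof (rule contract_y)
    show "0 \<le> M" using M nrm_nonneg order.trans by blast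
    show "\<bar>err g p $ 2 - err g' q $ 2\<bar> \<le> tol * (nrmC * M) + \<rho>" by (rule err_diff) (fact g(1) p g(2) M)+
    show "0 \<le> \<rho>" using g(2) norm_ge_zero order.trans by blast
  qed (use M nrm_le_iff[of "p - q" M] in auto)
  then show ?thesis unfolding g_nth[of g] g_nth[of g'] by (simp add: algebra_simps)
qed

lemma back_z_contract:
  assumes g: "near g" "norm (g q - g' q) \<le> \<rho>" and p: "p \<in> reg" "q \<in> reg"
    and M: "nrm (p - q) \<le> M" "nrm (pn - qn) \<le> M"
  shows "wt * \<bar>back_z g pn p - back_z g' qn q\<bar> \<le> rate * M + \<rho>"
proof (rule contract_z)
  show "0 \<le> M" using M nrm_nonneg order.trans by blast
  show "\<bar>err g p $ 3 - err g' q $ 3\<bar> \<le> tol * (nrmC * M) + \<rho>" by (rule err_diff) (fact g(1) p g(2) M(1))+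
  show "0 \<le> \<rho>" using g(2) norm_ge_zero order.trans by blast
  show "\<xi> * (back_z g pn p - back_z g' qn q) = (pn $ 3 - qn $ 3) - (p $ 1 - q $ 1) - (err g p $ 3 - err g' q $ 3)"
    using xi by (simp add: back_z_def field_simps)
qed (use M nrm_le_iff[of "p - q" M] nrm_le_iff[of "pn - qn" M] in auto)

text \<open>\<open>\<beta> k = Some \<eta>\<close> cuts the orbit before time \<open>k\<close> and prescribes \<open>\<eta>\<close> as the second coordinate
  there, so that full orbits and points of stable leaves are obtained from the same fixed point problem.\<close>

lemma exists_broken_orbit:
  fixes \<beta> :: "int \<Rightarrow> real option"
  assumes g: "near g" and \<beta>: "\<And>k \<eta>. \<beta> k = Some \<eta> \<Longrightarrow> \<bar>\<eta>\<bar> \<le> 1"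
  obtains P where "\<And>k. P k \<in> reg" "\<And>k. s k \<longleftrightarrow> 0 < P k $ 1"
    "\<And>k. P (k + 1) $ 1 = g (P k) $ 1" "\<And>k. P (k + 1) $ 3 = g (P k) $ 3"
    "\<And>k. P k $ 2 = (case \<beta> k of None \<Rightarrow> g (P (k - 1)) $ 2 | Some \<eta> \<Rightarrow> \<eta>)"
proof -
  define T where "T P k = (vector [back_x g (s k) (P (k + 1)) (P k),
     (case \<beta> k of None \<Rightarrow> g (P (k - 1)) $ 2 | Some \<eta> \<Rightarrow> \<eta>), back_z g (P (k + 1)) (P k)] :: real ^ 3)" for P k
  have dist0: "norm (g q - g q) \<le> 0" for q by simp
  obtain P where P: "\<And>k. P k \<in> core \<xi>" "T P = P"
  proof (rule seq_fixpoint[of "core \<xi>" "\<lambda>_. 0" T 2])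
    show "closed (core \<xi>)" by (rule closed_core)
    show "0 \<in> core \<xi>" using xi by (simp add: core_def)
    show "T P k \<in> core \<xi>" if C: "\<And>k. P k \<in> core \<xi>" for P k
    proof -
      have R: "P k \<in> reg" for k using C by (rule core_region)
      have "\<bar>g (P (k - 1)) $ 2\<bar> \<le> 1"
        using C[of "k-1"] err_le[OF g R, of "k-1" 2] tol(2) unfolding g_nth[of g] core_def mem_Collect_eq by linarith
      then have "\<bar>T P k $ 2\<bar> \<le> 1" using \<beta>[of k] by (auto simp: T_def split: option.splits)
      moreover have "\<bar>T P k $ 1\<bar> \<le> 97/100" using back_x_bounds(2)[OF g R[of k] R[of "k+1"], of "s k"] unfolding T_def by simp
      moreover have "\<bar>T P k $ 3\<bar> \<le> 1 / (\<xi> - 1)" using back_z_bound[OF g C C] by (simp add: T_def)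
      ultimately show ?thesis by (simp add: core_def)
    qed
    show "nrm (u - v) \<le> 2" if "u \<in> core \<xi>" "v \<in> core \<xi>" for u v
      using that by (intro region_nrm_diff core_region)
    show "nrm (T P k - T Q k) \<le> rate * M" if PC: "\<And>k. P k \<in> core \<xi>" and QC: "\<And>k. Q k \<in> core \<xi>" and M: "0 \<le> M"
      "\<And>j. j \<in> {k - 1, k, k + 1} \<Longrightarrow> nrm (P j - Q j) \<le> M" for P Q k M
    proof -
      note R = core_region[OF PC] core_region[OF QC]
      have "\<bar>T P k $ 2 - T Q k $ 2\<bar> \<le> 2 * (rate * M)"
        using fwd_y_contract[where g = g and g' = g and p = "P (k-1)" and q = "Q (k-1)" and \<rho> = 0 and M = M, OF g dist0 R(1) R(2)] M rate by (simp add: T_def split: option.splits)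
      then show ?thesis unfolding nrm_le_iff
        using back_x_contract[where g = g and g' = g and p = "P k" and q = "Q k" and \<rho> = 0 and M = M and pn = "P (k+1)" and qn = "Q (k+1)" and b = "s k", OF g g dist0 R(1) R(1) R(2) R(2) M(1)]
          back_z_contract[where g = g and g' = g and p = "P k" and q = "Q k" and \<rho> = 0 and M = M and pn = "P (k+1)" and qn = "Q (k+1)", OF g dist0 R(1) R(2)] M(2)
        by (simp add: T_def)
    qed
  qed blast
  have R: "P k \<in> reg" for k using P(1) by (rule core_region)
  have eq: "P k $ 1 = back_x g (s k) (P (k+1)) (P k)" "P k $ 3 = back_z g (P (k + 1)) (P k)"
    "P k $ 2 = (case \<beta> k of None \<Rightarrow> g (P (k - 1)) $ 2 | Some \<eta> \<Rightarrow> \<eta>)" for k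
    using fun_cong[OF P(2), of k] unfolding T_def by (metis vector_3)+
  have "P (k + 1) $ 1 = g (P k) $ 1" "s k \<longleftrightarrow> 0 < P k $ 1" "P (k + 1) $ 3 = g (P k) $ 3" for k
    using eq(1)[of k] eq(2)[of k] back_x_eq[OF g R[of k] R[of "k+1"], of "s k"] back_z_eq[of "P k" g "P (k+1)"] by simp_all
  then show thesis using that[of P] R eq(3) by blast
qed

text \<open>The second coordinate alone is determined by the past. The disjunction covers a time
  with predecessors in the box and a starting time where y is prescribed up to 2 * \<rho>; the
  factor 2 matches the weight 1/2 in \<open>nrm\<close>.\<close>

lemma orbit_contract:
  assumes g: "near g" "near g'" "\<And>r. r \<in> reg \<Longrightarrow> norm (g r - g' r) \<le> \<rho>"
    and p: "p \<in> reg" "g p \<in> reg" "q \<in> reg" "g' q \<in> reg"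
    and s: "0 < p $ 1 \<longleftrightarrow> 0 < q $ 1"
    and M: "0 \<le> M" "nrm (p - q) \<le> M" "nrm (g p - g' q) \<le> M"
    and y: "\<bar>p $ 2 - q $ 2\<bar> \<le> 2 * \<rho> \<or> (\<exists>pm qm. pm \<in> reg \<and> qm \<in> reg \<and> p = g pm \<and> q = g' qm \<and> nrm (pm - qm) \<le> M)"
  shows "nrm (p - q) \<le> rate * M + \<rho>"
proof -
  have "p $ 1 = back_x g (0 < p $ 1) (g p) p" "q $ 1 = back_x g' (0 < p $ 1) (g' q) q"
    using back_x_eq[OF g(1) p(1,2), of "0 < p $ 1"] back_x_eq[OF g(2) p(3,4), of "0 < p $ 1"] s by auto
  then have 1: "\<bar>p $ 1 - q $ 1\<bar> \<le> rate * M + \<rho>"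
    using back_x_contract[OF g(1,2) g(3)[OF p(3)] p M] by metis
  have "p $ 3 = back_z g (g p) p" "q $ 3 = back_z g' (g' q) q" by (simp_all add: back_z_eq)
  then have 3: "wt * \<bar>p $ 3 - q $ 3\<bar> \<le> rate * M + \<rho>"
    using back_z_contract[where g = g and g' = g' and p = p and q = q and \<rho> = \<rho> and M = M and pn = "g p" and qn = "g' q", OF g(1) g(3)[OF p(3)] p(1,3) M(2,3)] by simp
  have "\<bar>p $ 2 - q $ 2\<bar> \<le> 2 * (rate * M + \<rho>)"
    using y
  proof
    assume "\<bar>p $ 2 - q $ 2\<bar> \<le> 2 * \<rho>"
    moreover have "0 \<le> rate * M" using rate M by simp
    ultimately show ?thesis by simp
  next
    assume "\<exists>pm qm. pm \<in> reg \<and> qm \<in> reg \<and> p = g pm \<and> q = g' qm \<and> nrm (pm - qm) \<le> M"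
    then obtain pm qm where "pm \<in> reg" "qm \<in> reg" "p = g pm" "q = g' qm" "nrm (pm - qm) \<le> M" by blast
    then show ?thesis
      using fwd_y_contract[where g = g and g' = g' and p = pm and q = qm and \<rho> = \<rho> and M = M, OF g(1) g(3)] by simp
  qed
  then show ?thesis unfolding nrm_le_iff using 1 3 by simp
qed


section \<open>Full orbits with prescribed itinerary\<close>

definition "coded g s P \<longleftrightarrow> (\<forall>k::int. P k \<in> reg \<and> P (k + 1) = g (P k) \<and> (s k \<longleftrightarrow> 0 < P k $ 1))"

lemma exists_coded:
  assumes "near g" obtains P where "coded g s P"
proof -
  obtain P where P: "\<And>k. P k \<in> reg" "\<And>k. s k \<longleftrightarrow> 0 < P k $ 1"
    "\<And>k. P (k + 1) $ 1 = g (P k) $ 1" "\<And>k. P (k + 1) $ 3 = g (P k) $ 3"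
    "\<And>k. P k $ 2 = g (P (k - 1)) $ 2"
    by (rule exists_broken_orbit[OF assms, of "\<lambda>_. None" s]) auto
  have "P (k + 1) = g (P k)" for k
    using P(3,4)[of k] P(5)[of "k+1"] by (intro vec3_eqI) auto
  then have "coded g s P" using P(1,2) by (simp add: coded_def)
  then show thesis by (rule that)
qed

text \<open>Three facts in one bound: uniqueness of the orbit and continuity in the itinerary for
  \<rho> = 0, and continuity in the map when s = s' and n tends to infinity.\<close>

lemma coded_compare:
  assumes g: "near g" "near g'" "\<And>r. r \<in> reg \<Longrightarrow> norm (g r - g' r) \<le> \<rho>" "0 \<le> \<rho>"
    and P: "coded g s P" and Q: "coded g' s' Q" and s: "\<And>k. \<bar>k - c\<bar> \<le> int n \<Longrightarrow> s k = s' k"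
  shows "nrm (P c - Q c) \<le> rate ^ (n + 1) * 2 + \<rho> / (1 - rate)"
proof (rule decay[where d = "\<lambda>k. nrm (P k - Q k)"])
  show "nrm (P k - Q k) \<le> 2" for k using P Q by (auto simp: coded_def intro!: region_nrm_diff)
  fix k M assume k: "\<bar>k - c\<bar> \<le> int n" and M: "0 \<le> M" "nrm (P (k - 1) - Q (k - 1)) \<le> M"
    "nrm (P k - Q k) \<le> M" "nrm (P (k + 1) - Q (k + 1)) \<le> M"
  have R: "P j \<in> reg" "Q j \<in> reg" "P (j + 1) = g (P j)" "Q (j + 1) = g' (Q j)" for j
    using P Q by (auto simp: coded_def)
  show "nrm (P k - Q k) \<le> rate * M + \<rho>"
  proof (rule orbit_contract[where g = g and g' = g' and \<rho> = \<rho>])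
    show "(0 < P k $ 1) = (0 < Q k $ 1)" using P Q s[OF k] by (auto simp: coded_def)
    have "P k = g (P (k - 1))" "Q k = g' (Q (k - 1))" using R(3,4)[of "k-1"] by auto
    then show "\<bar>P k $ 2 - Q k $ 2\<bar> \<le> 2 * \<rho> \<or> (\<exists>pm qm. pm \<in> reg \<and> qm \<in> reg \<and> P k = g pm \<and> Q k = g' qm \<and> nrm (pm - qm) \<le> M)"
      using R M by blast
  qed (use g R M R(1,2)[of "k+1"] in \<open>auto simp flip: R(3,4)\<close>)
qed (use rate g in auto)

lemma coded_unique:
  assumes "near g" "coded g s P" "coded g s Q" shows "P = Q"
proof
  fix k
  have "nrm (P k - Q k) \<le> 0"
  proof (rule geometric_bound_imp_le[of rate])
    show "nrm (P k - Q k) \<le> rate ^ n * (rate * 2) + 0" for n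
    proof -
      have "nrm (P k - Q k) \<le> rate ^ (n + 1) * 2 + 0 / (1 - rate)"
        by (rule coded_compare[where g = g and g' = g and P = P and Q = Q and s = s and s' = s]) (use assms in auto)
      then show ?thesis by (simp add: mult_ac)
    qed
  qed (use rate in auto)
  then show "P k = Q k" using nrm_eq_0[of "P k - Q k"] by simp
qed

section \<open>Forward itineraries\<close>

definition "fcoded (g :: real ^ 3 \<Rightarrow> real ^ 3) s q \<longleftrightarrow> (\<forall>k::nat. (g ^^ k) q \<in> reg \<and> (s k \<longleftrightarrow> 0 < (g ^^ k) q $ 1))"

lemma coded_imp_fcoded:
  assumes "coded g s P" shows "fcoded g (\<lambda>k. s (int k)) (P 0)"
proof -
  have "P (1 + int k) = g (P (int k))" for k
    using assms[unfolded coded_def, rule_format, of "int k"] by (simp only: add.commute)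
  then have "(g ^^ k) (P 0) = P (int k)" for k by (induction k) simp_all
  then show ?thesis using assms by (simp add: fcoded_def coded_def)
qed

lemma exists_fcoded:
  assumes g: "near g" and "\<bar>\<eta>\<bar> \<le> 1" obtains q where "fcoded g s q" "q $ 2 = \<eta>"
proof -
  obtain P where P: "\<And>k. P k \<in> reg" "\<And>k. s (nat k) \<longleftrightarrow> 0 < P k $ 1"
    "\<And>k. P (k + 1) $ 1 = g (P k) $ 1" "\<And>k. P (k + 1) $ 3 = g (P k) $ 3"
    "\<And>k. P k $ 2 = (case if k = 0 then Some \<eta> else None of None \<Rightarrow> g (P (k - 1)) $ 2 | Some \<eta> \<Rightarrow> \<eta>)"
    \<comment> \<open>The cut at time 0 frees y from the past. For negative k, \<open>nat k\<close>
      is 0, so the past repeats the symbol s 0; that half of the sequence is discarded.\<close>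
    by (rule exists_broken_orbit[OF g, of "\<lambda>k. if k = 0 then Some \<eta> else None" "\<lambda>k. s (nat k)"])
      (use assms(2) in \<open>auto split: if_splits\<close>)
  have St: "P (int k + 1) = g (P (int k))" for k
    using P(3,4)[of "int k"] P(5)[of "int k+1"] by (intro vec3_eqI) auto
  have "(g ^^ k) (P 0) = P (int k)" for k
    by (induction k) (simp_all add: add.commute flip: St)
  then have "fcoded g s (P 0)" using P(1,2)[of "int k" for k] by (auto simp: fcoded_def)
  then show thesis using that P(5)[of 0] by simp
qed

lemma fcoded_step:
  assumes g: "near g" and p: "fcoded g s p" and q: "fcoded g s' q" and s: "s k = s' k"
    and M: "0 \<le> M" "nrm ((g ^^ k) p - (g ^^ k) q) \<le> M" "nrm ((g ^^ Suc k) p - (g ^^ Suc k) q) \<le> M"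
    "k \<noteq> 0 \<Longrightarrow> nrm ((g ^^ (k - 1)) p - (g ^^ (k - 1)) q) \<le> M"
    and \<rho>: "k = 0 \<Longrightarrow> \<bar>p $ 2 - q $ 2\<bar> \<le> 2 * \<rho>" "0 \<le> \<rho>"
  shows "nrm ((g ^^ k) p - (g ^^ k) q) \<le> rate * M + \<rho>"
proof (rule orbit_contract[where g = g and g' = g])
  have R: "(g ^^ j) p \<in> reg" "(g ^^ j) q \<in> reg" for j using p q by (auto simp: fcoded_def)
  show "(g ^^ k) p \<in> reg" "g ((g ^^ k) p) \<in> reg" "(g ^^ k) q \<in> reg" "g ((g ^^ k) q) \<in> reg"
    using R[of k] R[of "Suc k"] by auto
  show "(0 < (g ^^ k) p $ 1) = (0 < (g ^^ k) q $ 1)" using p q s by (auto simp: fcoded_def)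
  show "\<bar>(g ^^ k) p $ 2 - (g ^^ k) q $ 2\<bar> \<le> 2 * \<rho> \<or>
    (\<exists>pm qm. pm \<in> reg \<and> qm \<in> reg \<and> (g ^^ k) p = g pm \<and> (g ^^ k) q = g qm \<and> nrm (pm - qm) \<le> M)"
  proof (cases k)
    case 0 then show ?thesis using \<rho> by simp
  next
    case (Suc j)
    then show ?thesis using R[of j] M(4) by auto
  qed
qed (use M g \<rho> in auto)

lemma fcoded_region_diff: "fcoded g s p \<Longrightarrow> fcoded g s' q \<Longrightarrow> nrm ((g ^^ k) p - (g ^^ k) q) \<le> 2"
  by (auto simp: fcoded_def intro: region_nrm_diff)

lemma decay_nat:
  fixes d :: "nat \<Rightarrow> real"
  assumes "0 \<le> \<rho>" "0 \<le> B" "\<And>k. d k \<le> B"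
    and step: "\<And>k M. k \<le> n \<Longrightarrow> 0 \<le> M \<Longrightarrow> (k \<noteq> 0 \<Longrightarrow> d (k - 1) \<le> M) \<Longrightarrow> d k \<le> M \<Longrightarrow> d (Suc k) \<le> M \<Longrightarrow> d k \<le> rate * M + \<rho>"
  shows "d 0 \<le> rate ^ (n + 1) * B + \<rho> / (1 - rate)"
proof -
  \<comment> \<open>Extension by 0 to negative times makes the two-sided estimate applicable and
    renders the missing predecessor of time 0 harmless.\<close>
  define e where "e k = (if 0 \<le> k then d (nat k) else 0)" for k :: int
  have "e 0 \<le> rate ^ (n + 1) * B + \<rho> / (1 - rate)"
  proof (rule decay[where d = e])
    fix k :: int and M assume k: "\<bar>k - 0\<bar> \<le> int n" and M: "0 \<le> M" "e (k - 1) \<le> M" "e k \<le> M" "e (k + 1) \<le> M"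
    show "e k \<le> rate * M + \<rho>"
    proof (cases "0 \<le> k")
      case True
      have "d (nat k) \<le> rate * M + \<rho>"
      proof (rule step)
        show "d (nat k - 1) \<le> M" if "nat k \<noteq> 0" using that M(2) by (simp add: e_def nat_diff_distrib)
        show "d (Suc (nat k)) \<le> M" using True M(4) by (simp add: e_def Suc_nat_eq_nat_zadd1 add.commute)
      qed (use k True M in \<open>auto simp: e_def\<close>)
      then show ?thesis using True by (simp add: e_def)
    qed (use rate M assms in \<open>simp add: e_def\<close>)
  qed (use rate assms in \<open>auto simp: e_def\<close>)
  then show ?thesis by (simp add: e_def)
qed

lemma fcoded_compare:
  assumes g: "near g" and p: "fcoded g s p" and q: "fcoded g s' q" and s: "\<And>k. k \<le> n \<Longrightarrow> s k = s' k"
  shows "nrm (p - q) \<le> rate ^ (n + 1) * 2 + \<bar>p $ 2 - q $ 2\<bar> / (1 - rate)"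
proof -
  have "nrm ((g ^^ 0) p - (g ^^ 0) q) \<le> rate ^ (n + 1) * 2 + \<bar>p $ 2 - q $ 2\<bar> / (1 - rate)"
  proof (rule decay_nat[where d = "\<lambda>k. nrm ((g ^^ k) p - (g ^^ k) q)"])
    fix k M assume "k \<le> n" "0 \<le> M" "k \<noteq> 0 \<Longrightarrow> nrm ((g ^^ (k - 1)) p - (g ^^ (k - 1)) q) \<le> M"
      "nrm ((g ^^ k) p - (g ^^ k) q) \<le> M" "nrm ((g ^^ Suc k) p - (g ^^ Suc k) q) \<le> M"
    then show "nrm ((g ^^ k) p - (g ^^ k) q) \<le> rate * M + \<bar>p $ 2 - q $ 2\<bar>"
      using s[of k] by (intro fcoded_step[OF g p q]) auto
  qed (use fcoded_region_diff[OF p q] in auto)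
  then show ?thesis by simp
qed

text \<open>At time 0 only the box bounds the y-difference, but from time 1 on y is inherited from
  the previous x and no source term remains. Each round therefore gains a factor \<open>rate\<close>
  and gives up one initial time.\<close>

lemma fcoded_converge:
  assumes g: "near g" and p: "fcoded g s p" and q: "fcoded g s q"
  shows "nrm ((g ^^ k) p - (g ^^ k) q) \<le> rate ^ k * 2"
proof -
  have "\<forall>k\<ge>m. nrm ((g ^^ k) p - (g ^^ k) q) \<le> rate ^ m * 2" for m
  proof (induction m)
    case 0
    then show ?case using fcoded_region_diff[OF p q] by simp
  next
    case (Suc m)
    show ?case
    proof (intro allI impI)
      fix k assume k: "Suc m \<le> k"
      have "nrm ((g ^^ k) p - (g ^^ k) q) \<le> rate * (rate ^ m * 2) + 0"
      proof (rule fcoded_step[OF g p q refl])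
        show "nrm ((g ^^ k) p - (g ^^ k) q) \<le> rate ^ m * 2" "nrm ((g ^^ Suc k) p - (g ^^ Suc k) q) \<le> rate ^ m * 2"
          "nrm ((g ^^ (k - 1)) p - (g ^^ (k - 1)) q) \<le> rate ^ m * 2"
          using Suc[rule_format, of k] Suc[rule_format, of "Suc k"] Suc[rule_format, of "k - 1"] k by auto
      qed (use rate k in auto)
      then show "nrm ((g ^^ k) p - (g ^^ k) q) \<le> rate ^ Suc m * 2" by (simp add: mult_ac)
    qed
  qed
  then show ?thesis by blast
qed

text \<open>Transfer to \<open>gap_pair\<close> with \<epsilon> = \<open>tol\<close> and B =
  1/(\<xi> - 1); the product is at most 10^-6 because \<open>tol\<close> is at most (\<xi> -
  1)/10^6.\<close>

lemma fcoded_gap: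
  assumes g: "near g" and p: "fcoded g s p" "p $ 2 = 0" and q: "fcoded g s' q" "q $ 2 = 0"
    and same: "\<And>k. k < n \<Longrightarrow> s k = s' k" and n: "s n" "\<not> s' n" and tail: "\<And>k. k > n \<Longrightarrow> \<not> s k \<and> s' k"
  shows "q $ 3 < p $ 3"
proof -
  have R: "(g ^^ k) p \<in> reg" "(g ^^ k) q \<in> reg" for k using p q by (auto simp: fcoded_def)
  have E: "\<bar>err g ((g ^^ k) p) $ i\<bar> \<le> tol" "\<bar>err g ((g ^^ k) q) $ i\<bar> \<le> tol" for k i
    using err_le[OF g R(1)] err_le[OF g R(2)] by auto
  have nz: "517/1000 \<le> \<bar>(g ^^ k) p $ 1\<bar>" "517/1000 \<le> \<bar>(g ^^ k) q $ 1\<bar>" for k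
    using x_bounds(1)[OF g R(1)[of k]] x_bounds(1)[OF g R(2)[of k]] R[of "Suc k"] by auto
  define xp yp zp xq yq zq where d: "xp = (\<lambda>k. (g ^^ k) p $ 1)" "yp = (\<lambda>k. (g ^^ k) p $ 2)" "zp = (\<lambda>k. (g ^^ k) p $ 3)"
    "xq = (\<lambda>k. (g ^^ k) q $ 1)" "yq = (\<lambda>k. (g ^^ k) q $ 2)" "zq = (\<lambda>k. (g ^^ k) q $ 3)"
  have L: "\<bar>err g ((g ^^ k) p) $ i - err g ((g ^^ k) q) $ i\<bar>
    \<le> tol * (\<bar>xp k - xq k\<bar> + \<bar>yp k - yq k\<bar> + \<bar>zp k - zq k\<bar>)" for k i
  proof -
    have "\<bar>(err g ((g ^^ k) p) - err g ((g ^^ k) q)) $ i\<bar> \<le> norm (err g ((g ^^ k) p) - err g ((g ^^ k) q))"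
      by (rule component_le_norm_cart)
    also have "\<dots> \<le> tol * norm ((g ^^ k) p - (g ^^ k) q)" using g R by (auto simp: near_def)
    also have "\<dots> \<le> tol * (\<bar>((g ^^ k) p - (g ^^ k) q) $ 1\<bar> + \<bar>((g ^^ k) p - (g ^^ k) q) $ 2\<bar> + \<bar>((g ^^ k) p - (g ^^ k) q) $ 3\<bar>)"
      using tol by (intro mult_left_mono norm_le_sum3) auto
    finally show ?thesis by (simp add: d)
  qed
  have sg: "s k \<longleftrightarrow> 0 < xp k" "s' k \<longleftrightarrow> 0 < xq k" for k using p q by (auto simp: fcoded_def d)
  have 1: "xp (Suc k) = 4 * (xp k)\<^sup>2 + 3/10 * yp k - (2375/1000) + err g ((g ^^ k) p) $ 1"
    "xq (Suc k) = 4 * (xq k)\<^sup>2 + 3/10 * yq k - (2375/1000) + err g ((g ^^ k) q) $ 1"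
    "yp (Suc k) = xp k + err g ((g ^^ k) p) $ 2" "yq (Suc k) = xq k + err g ((g ^^ k) q) $ 2"
    "zp (Suc k) = \<xi> * zp k + xp k + err g ((g ^^ k) p) $ 3"
    "zq (Suc k) = \<xi> * zq k + xq k + err g ((g ^^ k) q) $ 3" for k
    using g_nth[of g "(g ^^ k) p"] g_nth[of g "(g ^^ k) q"] by (simp_all add: d)
  have bd: "\<bar>xp k\<bar> \<le> 1" "\<bar>xq k\<bar> \<le> 1" "\<bar>yp k\<bar> \<le> 1" "\<bar>yq k\<bar> \<le> 1"
    "\<bar>zp k\<bar> \<le> 1 / (\<xi> - 1)" "\<bar>zq k\<bar> \<le> 1 / (\<xi> - 1)" for k
    using R[of k] by (auto simp: d region_def)
  have st: "\<bar>xp (Suc k) - (4 * (xp k)\<^sup>2 + 3/10 * yp k - (2375/1000))\<bar> \<le> tol"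
    "\<bar>xq (Suc k) - (4 * (xq k)\<^sup>2 + 3/10 * yq k - (2375/1000))\<bar> \<le> tol"
    "\<bar>yp (Suc k) - xp k\<bar> \<le> tol" "\<bar>yq (Suc k) - xq k\<bar> \<le> tol"
    "\<bar>zp (Suc k) - (\<xi> * zp k + xp k)\<bar> \<le> tol" "\<bar>zq (Suc k) - (\<xi> * zq k + xq k)\<bar> \<le> tol" for k
    unfolding 1 using E(1)[of k 1] E(2)[of k 1] E(1)[of k 2] E(2)[of k 2] E(1)[of k 3] E(2)[of k 3]
    by (simp_all only: add_diff_cancel_left')
  have df: "xp (Suc k) - xq (Suc k) - (4 * (xp k + xq k) * (xp k - xq k) + 3/10 * (yp k - yq k))
      = err g ((g ^^ k) p) $ 1 - err g ((g ^^ k) q) $ 1"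
    "yp (Suc k) - yq (Suc k) - (xp k - xq k) = err g ((g ^^ k) p) $ 2 - err g ((g ^^ k) q) $ 2"
    "zp (Suc k) - zq (Suc k) - (\<xi> * (zp k - zq k) + (xp k - xq k)) = err g ((g ^^ k) p) $ 3 - err g ((g ^^ k) q) $ 3" for k
    unfolding 1 by (simp_all add: power2_eq_square field_simps)
  have ex: "2 * tol \<le> \<xi> - 1" "tol * (1 / (\<xi> - 1)) \<le> 1/1000000" "0 \<le> tol" "tol \<le> 1 / 1000000"
    using tol xi by (simp_all add: field_simps)
  have ini: "\<bar>yp 0\<bar> \<le> 96/100" "yp 0 = yq 0" using p q by (simp_all add: d)
  have sgn: "k < n \<Longrightarrow> 0 < xp k \<longleftrightarrow> 0 < xq k" "0 < xp n" "xq n < 0" "k > n \<Longrightarrow> xp k < 0" "k > n \<Longrightarrow> 0 < xq k" for k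
    using same[of k] n tail[of k] sg[of k] sg[of n] nz[of k] nz[of n] by (auto simp: d)
  interpret gap_pair tol xp yp xq yq zp zq \<xi> "1 / (\<xi> - 1)" n
    by unfold_locales (((rule ex bd st xi ini sgn L; assumption?) | unfold df)+)
  show ?thesis using gap unfolding dz_def by (simp add: d)
qed

end

section \<open>Stable leaves and the segment\<close>

context params
begin

lemma fcoded_diff_le:
  assumes "near g" "fcoded g s p" "fcoded g s q"
  shows "nrm (p - q) \<le> \<bar>p $ 2 - q $ 2\<bar> / (1 - rate)"
proof (rule geometric_bound_imp_le[of rate])
  show "nrm (p - q) \<le> rate ^ n * (rate * 2) + \<bar>p $ 2 - q $ 2\<bar> / (1 - rate)" for n
    using fcoded_compare[OF assms(1) assms(2,3), of n] by (simp add: mult_ac)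
qed (use rate in auto)

definition "leaf g s \<eta> = (SOME q. fcoded g s q \<and> q $ 2 = \<eta>)"

lemma leaf:
  assumes "near g" "\<bar>\<eta>\<bar> \<le> 1"
  shows "fcoded g s (leaf g s \<eta>)" "leaf g s \<eta> $ 2 = \<eta>"
proof -
  have "\<exists>q. fcoded g s q \<and> q $ 2 = \<eta>" using exists_fcoded[OF assms] by metis
  then have "fcoded g s (leaf g s \<eta>) \<and> leaf g s \<eta> $ 2 = \<eta>" unfolding leaf_def by (rule someI_ex)
  then show "fcoded g s (leaf g s \<eta>)" "leaf g s \<eta> $ 2 = \<eta>" by auto
qed

lemma leaf_eq:
  assumes "near g" "fcoded g s q" shows "leaf g s (q $ 2) = q"
proof -
  have "q \<in> reg" using assms(2) unfolding fcoded_def by (metis funpow_0)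
  then have "\<bar>q $ 2\<bar> \<le> 1" by (simp add: region_def)
  note l = leaf[OF assms(1) this, of s]
  show ?thesis using fcoded_diff_le[OF assms(1) l(1) assms(2)] nrm_eq_0[of "leaf g s (q $ 2) - q"] by (simp add: l(2))
qed

lemma continuous_on_leaf:
  assumes g: "near g" shows "continuous_on {-1..1} (leaf g s)"
proof -
  have "dist (leaf g s \<eta>) (leaf g s \<theta>) \<le> nrmC / (1 - rate) * dist \<eta> \<theta>" if "\<eta> \<in> {-1..1}" "\<theta> \<in> {-1..1}" for \<eta> \<theta>
  proof -
    have h: "\<bar>\<eta>\<bar> \<le> 1" "\<bar>\<theta>\<bar> \<le> 1" using that by auto
    note l = leaf[OF g h(1), of s] leaf[OF g h(2), of s]
    have "nrm (leaf g s \<eta> - leaf g s \<theta>) \<le> \<bar>\<eta> - \<theta>\<bar> / (1 - rate)"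
      using fcoded_diff_le[OF g l(1,3)] by (simp add: l(2,4))
    then have "nrmC * nrm (leaf g s \<eta> - leaf g s \<theta>) \<le> nrmC * (\<bar>\<eta> - \<theta>\<bar> / (1 - rate))"
      using nrmC by (intro mult_left_mono) auto
    then show ?thesis using norm_le_nrm[of "leaf g s \<eta> - leaf g s \<theta>"] by (simp add: dist_norm)
  qed
  moreover have "0 \<le> nrmC / (1 - rate)" using nrmC rate by simp
  ultimately have "(nrmC / (1 - rate))-lipschitz_on {-1..1} (leaf g s)" by (rule lipschitz_onI)
  then show ?thesis by (rule lipschitz_on_continuous_on)
qed

text \<open>The points with forward itinerary s form exactly the curve \<open>leaf g s\<close> over
  y in [-1, 1]. It is connected as a continuous image, lies in the box, and its points have
  asymptotic futures, so it joins p to q inside the stable manifold.\<close>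

lemma fcoded_in_local_stable:
  assumes g: "near g" and p: "fcoded g s p" and q: "fcoded g s q"
  shows "q \<in> local_stable_manifold (reg) g p"
proof -
  define L where "L = leaf g s ` {-1..1}"
  have fc: "fcoded g s r" if "r \<in> L" for r using that leaf[OF g] by (auto simp: L_def)
  have R: "r \<in> reg" if "fcoded g s r" for r using that unfolding fcoded_def by (metis funpow_0)
  have inL: "r \<in> L" if r: "fcoded g s r" for r
  proof -
    have "r $ 2 \<in> {-1..1}" using R[OF r] by (auto simp: region_def abs_le_iff)
    then show ?thesis using leaf_eq[OF g r] unfolding L_def by (metis imageI)
  qed
  have st: "r \<in> stable_manifold g p" if r: "fcoded g s r" for r
  proof -
    have le: "norm (dist ((g ^^ k) p) ((g ^^ k) r)) \<le> nrmC * 2 * rate ^ k" for k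
    proof -
      have "nrmC * nrm ((g ^^ k) p - (g ^^ k) r) \<le> nrmC * (rate ^ k * 2)"
        using fcoded_converge[OF g p r, of k] nrmC(1) by (intro mult_left_mono) auto
      then show ?thesis using norm_le_nrm[of "(g ^^ k) p - (g ^^ k) r"] by (simp add: dist_norm mult_ac)
    qed
    have "(\<lambda>k. nrmC * 2 * rate ^ k) \<longlonglongrightarrow> nrmC * 2 * 0"
      using rate by (intro tendsto_intros LIMSEQ_realpow_zero) auto
    then have lim: "(\<lambda>k. nrmC * 2 * rate ^ k) \<longlonglongrightarrow> 0" by simp
    have "(\<lambda>k. dist ((g ^^ k) p) ((g ^^ k) r)) \<longlonglongrightarrow> 0"
      by (rule Lim_null_comparison[OF always_eventually lim]) (use le in blast)
    then show ?thesis by (simp add: stable_manifold_def)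
  qed
  have "connected L" unfolding L_def by (intro connected_continuous_image continuous_on_leaf g) simp
  moreover have "L \<subseteq> stable_manifold g p \<inter> reg" using fc R st by blast
  ultimately show ?thesis unfolding local_stable_manifold_def connected_component_def mem_Collect_eq
    using inL[OF p] inL[OF q] by blast
qed

section \<open>Bisection for a zero of the height\<close>

definition "extend s n b = (\<lambda>k::nat. if k < n then s k else (b::bool))"
definition "height g s = leaf g s 0 $ 3"

lemma leaf0: "near g \<Longrightarrow> fcoded g s (leaf g s 0)" "near g \<Longrightarrow> leaf g s 0 $ 2 = 0"
  using leaf[of g 0 s] by auto

text \<open>Up to errors, a bounded z equals minus the sum of x_k / \<xi>^(k + 1), so a constant
  sign of x forces the opposite sign of z. The factor \<sigma> treats both symbols at once; 0.5 is
  0.517 with room for the error.\<close>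

lemma third_coordinate_sign:
  assumes g: "near g" and q: "fcoded g (\<lambda>_. b) q"
  shows "if b then q $ 3 < 0 else 0 < q $ 3"
proof -
  define \<sigma> where "\<sigma> = (if b then -1 else 1 :: real)"
  have R: "(g ^^ k) q \<in> reg" "b \<longleftrightarrow> 0 < (g ^^ k) q $ 1" for k using q by (auto simp: fcoded_def)
  have "(5/10) / (\<xi> - 1) \<le> \<sigma> * (g ^^ 0) q $ 3"
  proof (rule bounded_recursion_lower[OF xi(1), where a = "\<lambda>k. \<sigma> * (g ^^ k) q $ 3" and B = "1 / (\<xi> - 1)"])
    show "\<bar>\<sigma> * (g ^^ k) q $ 3\<bar> \<le> 1 / (\<xi> - 1)" for k
      using R(1)[of k] by (auto simp: \<sigma>_def region_def)
    show "\<sigma> * (g ^^ Suc k) q $ 3 + 5/10 \<le> \<xi> * (\<sigma> * (g ^^ k) q $ 3)" for k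
    proof -
      have "517/1000 \<le> \<bar>(g ^^ k) q $ 1\<bar>" using x_bounds(1)[OF g R(1)[of k]] R(1)[of "Suc k"] by simp
      then have x: "\<sigma> * (g ^^ k) q $ 1 \<le> - (517/1000)" using R(2)[of k] by (auto simp: \<sigma>_def)
      have e: "\<bar>err g ((g ^^ k) q) $ 3\<bar> \<le> 1/1000000" using err_le[OF g R(1)[of k], of 3] tol(2) by linarith
      have "(g ^^ Suc k) q $ 3 = \<xi> * (g ^^ k) q $ 3 + (g ^^ k) q $ 1 + err g ((g ^^ k) q) $ 3"
        using g_nth(3)[of g "(g ^^ k) q"] by simp
      then show ?thesis using x e unfolding \<sigma>_def by (auto simp: abs_le_iff)
    qed
  qed
  moreover have "0 < (5/10) / (\<xi> - 1)" using xi by simp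
  ultimately have "0 < \<sigma> * (g ^^ 0) q $ 3" by (rule order.strict_trans2[rotated])
  then have "0 < \<sigma> * q $ 3" by simp
  then show ?thesis by (auto simp: \<sigma>_def split: if_splits)
qed

text \<open>Appending b and then repeating b changes nothing, so one end of each half is inherited:
  True gives the half from w+++... to w+---..., False the half from w-+++... to w---.... By the gap
  inequality w-+++... lies below w+---..., so the halves overlap and 0 belongs to one of
  them.\<close>

lemma height_refine:
  assumes g: "near g" and "height g (extend s n True) \<le> 0" "0 \<le> height g (extend s n False)"
  shows "\<exists>b. height g (extend (s(n := b)) (Suc n) True) \<le> 0 \<and> 0 \<le> height g (extend (s(n := b)) (Suc n) False)"
proof -
  have eq: "extend (s(n := b)) (Suc n) b = extend s n b" for b by (auto simp: extend_def fun_eq_iff)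
  have "height g (extend (s(n := False)) (Suc n) True) < height g (extend (s(n := True)) (Suc n) False)"
    unfolding height_def
    by (rule fcoded_gap[OF g leaf0(1,2)[OF g] leaf0(1,2)[OF g], where n = n]) (auto simp: extend_def)
  then show ?thesis
    using assms eq[of True] eq[of False]
    by (cases "0 \<le> height g (extend (s(n := True)) (Suc n) False)") (metis, metis linear order.strict_trans1 order.strict_implies_order not_le)
qed

lemma height_continuous:
  assumes g: "near g"
  shows "wt * \<bar>height g (extend s n b) - height g s\<bar> \<le> rate ^ n * 2"
proof (cases n)
  case 0
  have "nrm (leaf g (extend s n b) 0 - leaf g s 0) \<le> 2"
    using fcoded_region_diff[OF leaf0(1)[OF g] leaf0(1)[OF g], of 0 "extend s n b" s] by simp
  then show ?thesis using 0 by (simp add: nrm_le_iff height_def)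
next
  case (Suc m)
  have "nrm (leaf g (extend s n b) 0 - leaf g s 0) \<le> rate ^ (m + 1) * 2 + \<bar>leaf g (extend s n b) 0 $ 2 - leaf g s 0 $ 2\<bar> / (1 - rate)"
    by (rule fcoded_compare[OF g leaf0(1)[OF g] leaf0(1)[OF g]]) (auto simp: extend_def Suc)
  then show ?thesis using Suc by (simp add: nrm_le_iff height_def leaf0(2)[OF g])
qed

lemma exists_height_0:
  assumes g: "near g" obtains s where "height g s = 0"
proof -
  define A where "A n s \<longleftrightarrow> height g (extend s n True) \<le> 0 \<and> 0 \<le> height g (extend s n False)" for n s
  have "\<exists>F. \<forall>n. A n (F n) \<and> (\<exists>b. F (Suc n) = (F n)(n := b))"
  proof (rule dependent_nat_choice)
    have "extend s 0 b = (\<lambda>_. b)" for s b by (auto simp: extend_def)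
    then have "A 0 (\<lambda>_. True)"
      using third_coordinate_sign[OF g leaf0(1)[OF g], of True] third_coordinate_sign[OF g leaf0(1)[OF g], of False]
      by (simp add: A_def height_def)
    then show "\<exists>s. A 0 s" by (rule exI[where x = "\<lambda>_. True"])
    show "\<exists>t. A (Suc n) t \<and> (\<exists>b. t = s(n := b))" if "A n s" for s n
      using height_refine[OF g, of s n] that by (auto simp: A_def)
  qed
  then obtain F where F: "\<And>n. A n (F n)" "\<And>n. \<exists>b. F (Suc n) = (F n)(n := b)" by blast
  \<comment> \<open>Symbol k is final from stage k + 1 on, since passing from stage n to n + 1
    changes only entry n.\<close>
  define s where "s k = F (Suc k) k" for k
  have F_eq: "F n k = s k" if "k < n" for n k
    using that
  proof (induction n)
    case (Suc n)
    obtain b where "F (Suc n) = (F n)(n := b)" using F(2) by blast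
    then show ?case using Suc by (cases "k = n") (auto simp: s_def)
  qed simp
  then have c: "extend (F n) n b = extend s n b" for n b by (auto simp: extend_def)
  have lim: "(\<lambda>n. height g (extend s n b)) \<longlonglongrightarrow> height g s" for b
  proof -
    have "(\<lambda>n. rate ^ n * 2 / wt) \<longlonglongrightarrow> 0 * 2 / wt"
      using rate wt by (intro tendsto_intros LIMSEQ_realpow_zero) auto
    then have lim0: "(\<lambda>n. rate ^ n * 2 / wt) \<longlonglongrightarrow> 0" by simp
    have "norm (height g (extend s n b) - height g s) \<le> rate ^ n * 2 / wt" for n
      using height_continuous[OF g, of s n b] wt by (simp add: field_simps)
    then have "(\<lambda>n. height g (extend s n b) - height g s) \<longlonglongrightarrow> 0"
      by (intro Lim_null_comparison[OF always_eventually lim0] allI)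
    then show ?thesis by (simp add: LIM_zero_iff)
  qed
  have "height g s \<le> 0" using F(1) by (intro LIMSEQ_le_const2[OF lim[of True]]) (auto simp: A_def c)
  moreover have "0 \<le> height g s" using F(1) by (intro LIMSEQ_le_const[OF lim[of False]]) (auto simp: A_def c)
  ultimately show thesis using that by force
qed

end

section \<open>The linearised problem\<close>

context params
begin

definition lin :: "real \<Rightarrow> real ^ 3 \<Rightarrow> real ^ 3" where
  "lin a v = vector [8 * a * v $ 1 + 3/10 * v $ 2, v $ 1, \<xi> * v $ 3 + v $ 1]"

text \<open>The derivative at a point of the box whose image is again in the box, up to
  \<open>tol\<close>; there |8 a| >= 4.136. Quantifying a existentially allows sequences of such
  maps without base points.\<close>

definition "hyp_lin A \<longleftrightarrow> linear A \<and> (\<exists>a. (517/1000) \<le> \<bar>a\<bar> \<and> (\<forall>v. norm (A v - lin a v) \<le> tol * norm v))"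

lemma hyp_linE:
  assumes "hyp_lin A"
  obtains a where "linear A" "517/1000 \<le> \<bar>a\<bar>" "\<And>v i. \<bar>(A v - lin a v) $ i\<bar> \<le> tol * norm v"
proof -
  obtain a where a: "linear A" "517/1000 \<le> \<bar>a\<bar>" "\<And>v. norm (A v - lin a v) \<le> tol * norm v"
    using assms unfolding hyp_lin_def by blast
  have "\<bar>(A v - lin a v) $ i\<bar> \<le> tol * norm v" for v i
    using component_le_norm_cart[of "A v - lin a v" i] a(3)[of v] by linarith
  then show thesis using that a by blast
qed

lemma norm_le_nrmC: "nrm u \<le> M \<Longrightarrow> norm u \<le> nrmC * M"
  using norm_le_nrm[of u] mult_left_mono[of "nrm u" M nrmC] nrmC(1) by linarith

lemma tol_norm_le: "nrm u \<le> M \<Longrightarrow> tol * norm u \<le> tol * (nrmC * M)"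
  using norm_le_nrmC tol by (intro mult_left_mono) auto

lemma nrm_diff_le: "nrm (u - v) \<le> nrm u + nrm v"
proof -
  have "nrm (- v) = nrm v" by (simp add: nrm_def)
  then show ?thesis using nrm_triangle[of u "- v"] by simp
qed

lemma lin_step_x:
  assumes "hyp_lin A" "0 \<le> M" "0 \<le> \<rho>" "nrm u \<le> M" "nrm u' \<le> M" "\<bar>u' $ 1 - A u $ 1\<bar> \<le> \<rho>"
  shows "\<bar>u $ 1\<bar> \<le> 4/10 * M + \<rho>" "\<bar>u $ 1\<bar> \<le> rate * M + \<rho>"
proof -
  obtain a where a: "517/1000 \<le> \<bar>a\<bar>" "\<And>v i. \<bar>(A v - lin a v) $ i\<bar> \<le> tol * norm v"
    using hyp_linE[OF assms(1)] by metis
  have e: "\<bar>(A u - lin a u) $ 1 + (u' $ 1 - A u $ 1)\<bar> \<le> tol * (nrmC * M) + \<rho>"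
    using a(2)[of u 1] tol_norm_le[OF assms(4)] assms(6) by linarith
  have c: "8 * a * u $ 1 = u' $ 1 - (3/10) * u $ 2 - ((A u - lin a u) $ 1 + (u' $ 1 - A u $ 1))"
    by (simp add: lin_def)
  have m: "413/100 \<le> \<bar>8 * a\<bar>" using a(1) by simp
  have b: "\<bar>u' $ 1\<bar> \<le> M" "\<bar>u $ 2\<bar> \<le> 2 * M" using assms(4,5) by (auto simp: nrm_le_iff)
  show "\<bar>u $ 1\<bar> \<le> 4/10 * M + \<rho>" by (rule contract_x(1)[OF assms(2,3) m b e c])
  show "\<bar>u $ 1\<bar> \<le> rate * M + \<rho>" by (rule contract_x(2)[OF assms(2,3) m b e c])
qed

lemma lin_step_y:
  assumes "hyp_lin A" "0 \<le> M" "0 \<le> \<rho>" "nrm u \<le> M" "\<bar>y - A u $ 2\<bar> \<le> \<rho>"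
  shows "\<bar>y\<bar> \<le> 2 * (rate * M + \<rho>)"
proof -
  obtain a where a: "\<And>v i. \<bar>(A v - lin a v) $ i\<bar> \<le> tol * norm v"
    using hyp_linE[OF assms(1)] by metis
  have "\<bar>u $ 1 + ((A u - lin a u) $ 2 + (y - A u $ 2))\<bar> \<le> 2 * (rate * M + \<rho>)"
  proof (rule contract_y)
    show "\<bar>(A u - lin a u) $ 2 + (y - A u $ 2)\<bar> \<le> tol * (nrmC * M) + \<rho>"
      using a[of u 2] tol_norm_le[OF assms(4)] assms(5) by linarith
  qed (use assms in \<open>auto simp: nrm_le_iff\<close>)
  then show ?thesis by (simp add: lin_def)
qed

lemma lin_step_z:
  assumes "hyp_lin A" "0 \<le> M" "0 \<le> \<rho>" "nrm u \<le> M" "nrm u' \<le> M" "\<bar>u' $ 3 - A u $ 3\<bar> \<le> \<rho>"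
  shows "wt * \<bar>u $ 3\<bar> \<le> rate * M + \<rho>"
proof -
  obtain a where a: "\<And>v i. \<bar>(A v - lin a v) $ i\<bar> \<le> tol * norm v"
    using hyp_linE[OF assms(1)] by metis
  show ?thesis
  proof (rule contract_z)
    show "\<bar>(A u - lin a u) $ 3 + (u' $ 3 - A u $ 3)\<bar> \<le> tol * (nrmC * M) + \<rho>"
      using a[of u 3] tol_norm_le[OF assms(4)] assms(6) by linarith
    show "\<xi> * u $ 3 = u' $ 3 - u $ 1 - ((A u - lin a u) $ 3 + (u' $ 3 - A u $ 3))"
      by (simp add: lin_def)
  qed (use assms in \<open>auto simp: nrm_le_iff\<close>)
qed

text \<open>The linear counterpart of the broken orbit: a value in px, py or pz replaces the
  equation of that coordinate at that time. As x and z are solved from the next time and y from the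
  previous one, prescribing y at 0 yields forward solutions, prescribing x and z at 0 backward
  ones.\<close>

lemma exists_linear_solution:
  fixes A :: "int \<Rightarrow> real ^ 3 \<Rightarrow> real ^ 3" and px py pz :: "int \<Rightarrow> real option"
  assumes A: "\<And>k. hyp_lin (A k)" and M: "0 \<le> M"
    and px: "\<And>k c. px k = Some c \<Longrightarrow> \<bar>c\<bar> \<le> M" and py: "\<And>k c. py k = Some c \<Longrightarrow> \<bar>c\<bar> \<le> 2 * M"
    and pz: "\<And>k c. pz k = Some c \<Longrightarrow> wt * \<bar>c\<bar> \<le> M"
  obtains V where "\<And>k. nrm (V k) \<le> M"
    "\<And>k. case px k of None \<Rightarrow> V (k + 1) $ 1 = A k (V k) $ 1 | Some c \<Rightarrow> V k $ 1 = c"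
    "\<And>k. case py k of None \<Rightarrow> V k $ 2 = A (k - 1) (V (k - 1)) $ 2 | Some c \<Rightarrow> V k $ 2 = c"
    "\<And>k. case pz k of None \<Rightarrow> V (k + 1) $ 3 = A k (V k) $ 3 | Some c \<Rightarrow> V k $ 3 = c"
proof -
  obtain a where lA: "\<And>k. linear (A k)" and a: "\<And>k. (517/1000) \<le> \<bar>a k\<bar>" and "\<And>k v. norm (A k v - lin (a k) v) \<le> tol * norm v"
    using A unfolding hyp_lin_def by metis
  define E where "E k v = A k v - lin (a k) v" for k v
  have E: "\<bar>E k v $ i\<bar> \<le> tol * norm v" for k v i
    using \<open>norm (A k v - lin (a k) v) \<le> tol * norm v\<close> component_le_norm_cart[of "E k v" i] unfolding E_def by linarith
  have lin_lin: "lin c (u - v) = lin c u - lin c v" for c u v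
    by (rule vec3_eqI) (simp_all add: lin_def algebra_simps)
  have E_diff: "E k (u - v) = E k u - E k v" for k u v
    unfolding E_def by (simp add: linear_diff[OF lA] lin_lin)
  have E0: "E k 0 = 0" for k using E_diff[of k 0 0] by simp
  define T where "T V k = (vector [
      (case px k of None \<Rightarrow> (V (k + 1) $ 1 - (3/10) * V k $ 2 - E k (V k) $ 1) / (8 * a k) | Some c \<Rightarrow> c),
      (case py k of None \<Rightarrow> A (k - 1) (V (k - 1)) $ 2 | Some c \<Rightarrow> c),
      (case pz k of None \<Rightarrow> (V (k + 1) $ 3 - V k $ 1 - E k (V k) $ 3) / \<xi> | Some c \<Rightarrow> c)] :: real ^ 3)" for V k
  have contr: "nrm (T V k - T W k) \<le> rate * m"
    if m: "0 \<le> m" "\<And>j. j \<in> {k - 1, k, k + 1} \<Longrightarrow> nrm (V j - W j) \<le> m" for V W k m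
  proof -
    have b: "nrm (V (k-1) - W (k-1)) \<le> m" "nrm (V k - W k) \<le> m" "nrm (V (k+1) - W (k+1)) \<le> m" using m(2) by auto
    note bb = b[unfolded nrm_le_iff vector_minus_component]
    have e: "\<bar>E k (V k - W k) $ i\<bar> \<le> tol * (nrmC * m) + 0" for i
      using E[of k "V k - W k" i] tol_norm_le[OF b(2)] by simp
    have "\<bar>T V k $ 1 - T W k $ 1\<bar> \<le> rate * m"
    proof (cases "px k")
      case None
      have "\<bar>T V k $ 1 - T W k $ 1\<bar> \<le> rate * m + 0"
      proof (rule contract_x(2)[where \<mu> = "8 * a k" and e = "E k (V k - W k) $ 1"])
        show "8 * a k * (T V k $ 1 - T W k $ 1) = (V (k+1) $ 1 - W (k+1) $ 1) - (3/10) * (V k $ 2 - W k $ 2) - E k (V k - W k) $ 1"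
          using a[of k] None by (auto simp: T_def E_diff field_simps)
      qed (use a[of k] bb m e[of 1] in auto)
      then show ?thesis by simp
    qed (use rate m in \<open>simp add: T_def\<close>)
    moreover have "\<bar>T V k $ 2 - T W k $ 2\<bar> \<le> 2 * (rate * m)"
    proof (cases "py k")
      case None
      have "\<bar>T V k $ 2 - T W k $ 2\<bar> \<le> 2 * (rate * m + 0)"
        by (rule lin_step_y[OF A[of "k-1"] m(1) _ b(1)]) (simp_all add: T_def None linear_diff[OF lA])
      then show ?thesis by simp
    qed (use rate m in \<open>simp add: T_def\<close>)
    moreover have "wt * \<bar>T V k $ 3 - T W k $ 3\<bar> \<le> rate * m"
    proof (cases "pz k")
      case None
      have "wt * \<bar>T V k $ 3 - T W k $ 3\<bar> \<le> rate * m + 0"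
      proof (rule contract_z[where e = "E k (V k - W k) $ 3"])
        show "\<xi> * (T V k $ 3 - T W k $ 3) = (V (k+1) $ 3 - W (k+1) $ 3) - (V k $ 1 - W k $ 1) - E k (V k - W k) $ 3"
          using xi None by (simp add: T_def E_diff field_simps)
      qed (use bb m e[of 3] in auto)
      then show ?thesis by simp
    qed (use rate m in \<open>simp add: T_def\<close>)
    ultimately show ?thesis by (simp add: nrm_le_iff)
  qed
  define C where "C = {v. nrm v \<le> M}"
  obtain V where V: "\<And>k. V k \<in> C" "T V = V"
  proof (rule seq_fixpoint[of C "\<lambda>_. 0" T "2 * M"])
    have "C = {v. \<bar>v $ 1\<bar> \<le> M} \<inter> {v. \<bar>v $ 2\<bar> \<le> 2 * M} \<inter> {v. wt * \<bar>v $ 3\<bar> \<le> M}" by (auto simp: C_def nrm_le_iff)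
    then show "closed C" by (auto intro!: closed_Int closed_Collect_le continuous_intros)
    show "0 \<in> C" using M by (simp add: C_def nrm_le_iff)
    show "T V k \<in> C" if "\<And>k. V k \<in> C" for V k
    proof -
      \<comment> \<open>The ball is preserved coordinatewise: a coordinate with an equation is 0 for
        the zero sequence, so this bound controls it, and a prescribed one is bounded by
        hypothesis.\<close>
      have "nrm (T V k - T (\<lambda>_. 0) k) \<le> rate * M" using M that by (intro contr) (auto simp: C_def)
      moreover have "rate * M \<le> M" using rate M by (simp add: mult_left_le_one_le)
      ultimately have "nrm (T V k - T (\<lambda>_. 0) k) \<le> M" by simp
      then show ?thesis
        using px[of k] py[of k] pz[of k] lA
        by (auto simp: T_def C_def nrm_le_iff E0 linear_0 split: option.splits)
    qed
    show "nrm (u - v) \<le> 2 * M" if "u \<in> C" "v \<in> C" for u v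
      using that nrm_diff_le[of u v] by (simp add: C_def)
  qed (use contr in auto)
  have eq: "V k $ 1 = (case px k of None \<Rightarrow> (V (k + 1) $ 1 - (3/10) * V k $ 2 - E k (V k) $ 1) / (8 * a k) | Some c \<Rightarrow> c)"
    "V k $ 2 = (case py k of None \<Rightarrow> A (k - 1) (V (k - 1)) $ 2 | Some c \<Rightarrow> c)"
    "V k $ 3 = (case pz k of None \<Rightarrow> (V (k + 1) $ 3 - V k $ 1 - E k (V k) $ 3) / \<xi> | Some c \<Rightarrow> c)" for k
    using fun_cong[OF V(2), of k] unfolding T_def by (metis vector_3)+
  show thesis
  proof (rule that[of V])
    fix k
    show "nrm (V k) \<le> M" using V(1) by (simp add: C_def)
    show "case px k of None \<Rightarrow> V (k + 1) $ 1 = A k (V k) $ 1 | Some c \<Rightarrow> V k $ 1 = c"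
      using eq(1)[of k] a[of k] by (auto simp: E_def lin_def field_simps split: option.splits)
    show "case py k of None \<Rightarrow> V k $ 2 = A (k - 1) (V (k - 1)) $ 2 | Some c \<Rightarrow> V k $ 2 = c"
      using eq(2)[of k] by (auto split: option.splits)
    show "case pz k of None \<Rightarrow> V (k + 1) $ 3 = A k (V k) $ 3 | Some c \<Rightarrow> V k $ 3 = c"
      using eq(3)[of k] xi by (auto simp: E_def lin_def field_simps split: option.splits)
  qed
qed


section \<open>Bounded forward and backward solutions\<close>

definition "fwd A V \<longleftrightarrow> (\<forall>k::nat. V (Suc k) = A k (V k)) \<and> (\<exists>B. \<forall>k. nrm (V k) \<le> B)"
text \<open>Time is reversed: V k is the vector at time -k and A k the derivative at time -k -
  1.\<close>

definition "bwd A V \<longleftrightarrow> (\<forall>k::nat. V k = A k (V (Suc k))) \<and> (\<exists>B. \<forall>k. nrm (V k) \<le> B)"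

lemma exists_fwd:
  fixes A :: "nat \<Rightarrow> real ^ 3 \<Rightarrow> real ^ 3"
  assumes A: "\<And>k. hyp_lin (A k)" obtains V where "fwd A V" "V 0 $ 2 = \<eta>"
\<comment> \<open>Negative times reuse A 0 through \<open>nat\<close>; only the nonnegative half of
  the solution is kept.\<close>
proof (rule exists_linear_solution[of "\<lambda>k. A (nat k)" "\<bar>\<eta>\<bar>" "\<lambda>_. None" "\<lambda>k. if k = 0 then Some \<eta> else None" "\<lambda>_. None"])
  fix V assume V: "\<And>k. nrm (V k) \<le> \<bar>\<eta>\<bar>"
    "\<And>k. case None :: real option of None \<Rightarrow> V (k + 1) $ 1 = A (nat k) (V k) $ 1 | Some c \<Rightarrow> V k $ 1 = c"
    "\<And>k. case if k = 0 then Some \<eta> else None of None \<Rightarrow> V k $ 2 = A (nat (k - 1)) (V (k - 1)) $ 2 | Some c \<Rightarrow> V k $ 2 = c"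
    "\<And>k. case None :: real option of None \<Rightarrow> V (k + 1) $ 3 = A (nat k) (V k) $ 3 | Some c \<Rightarrow> V k $ 3 = c"
  have "V (int k + 1) = A k (V (int k))" for k
    using V(2)[of "int k"] V(4)[of "int k"] V(3)[of "int k + 1"] by (intro vec3_eqI) auto
  then have "fwd A (\<lambda>k. V (int k))" using V(1) by (auto simp: fwd_def add.commute)
  then show thesis using that V(3)[of 0] by auto
qed (auto simp: A split: if_splits)

lemma exists_bwd:
  fixes A :: "nat \<Rightarrow> real ^ 3 \<Rightarrow> real ^ 3"
  assumes A: "\<And>k. hyp_lin (A k)" obtains V where "bwd A V" "V 0 $ 1 = \<alpha>" "V 0 $ 3 = \<beta>"
proof -
  have wb: "wt * \<bar>\<beta>\<bar> \<le> \<bar>\<alpha>\<bar> + \<bar>\<beta>\<bar>"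
    using wt mult_right_mono[of wt 1 "\<bar>\<beta>\<bar>"] by auto
  show thesis
  proof (rule exists_linear_solution[of "\<lambda>k. A (nat (- k - 1))" "\<bar>\<alpha>\<bar> + \<bar>\<beta>\<bar>" "\<lambda>k. if k = 0 then Some \<alpha> else None" "\<lambda>_. None"
          "\<lambda>k. if k = 0 then Some \<beta> else None"])
    fix V assume V: "\<And>k. nrm (V k) \<le> \<bar>\<alpha>\<bar> + \<bar>\<beta>\<bar>"
      "\<And>k. case if k = 0 then Some \<alpha> else None of None \<Rightarrow> V (k + 1) $ 1 = A (nat (- k - 1)) (V k) $ 1 | Some c \<Rightarrow> V k $ 1 = c"
      "\<And>k. case None :: real option of None \<Rightarrow> V k $ 2 = A (nat (- (k - 1) - 1)) (V (k - 1)) $ 2 | Some c \<Rightarrow> V k $ 2 = c"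
      "\<And>k. case if k = 0 then Some \<beta> else None of None \<Rightarrow> V (k + 1) $ 3 = A (nat (- k - 1)) (V k) $ 3 | Some c \<Rightarrow> V k $ 3 = c"
    have "V (- int k) = A k (V (- int k - 1))" for k
      using V(2)[of "- int k - 1"] V(4)[of "- int k - 1"] V(3)[of "- int k"] by (intro vec3_eqI) auto
    moreover have "- int k - 1 = - int (Suc k)" for k by simp
    ultimately have "bwd A (\<lambda>k. V (- int k))" using V(1) unfolding bwd_def by metis
    then show thesis using that V(2)[of 0] V(4)[of 0] by auto
  qed (use A wb in \<open>auto split: if_splits\<close>)
qed

text \<open>Every equation of a bounded forward solution contracts, except that y at time 0 has
  none; this number controls the whole solution, so the stable space is at most a line.\<close>

lemma fwd_bound:
  assumes A: "\<And>k. hyp_lin (A k)" and V: "fwd A V"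
  shows "nrm (V k) \<le> \<bar>V 0 $ 2\<bar> / 2"
proof -
  obtain B where B: "\<And>k. nrm (V k) \<le> B" and eq: "\<And>k. V (Suc k) = A k (V k)" using V by (auto simp: fwd_def)
  show ?thesis
  proof (rule sup_contraction_le[where d = "\<lambda>k. nrm (V k)" and \<kappa> = rate, OF _ _ _ B])
    fix k M assume M: "0 \<le> M" "\<And>j. nrm (V j) \<le> M"
    have x: "\<bar>V k $ 1\<bar> \<le> rate * M + 0" by (rule lin_step_x(2)[where A = "A k" and u = "V k" and u' = "V (Suc k)", OF A M(1) _ M(2) M(2)]) (auto simp: eq)
    have z: "wt * \<bar>V k $ 3\<bar> \<le> rate * M + 0" by (rule lin_step_z[where A = "A k" and u = "V k" and u' = "V (Suc k)", OF A M(1) _ M(2) M(2)]) (auto simp: eq)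
    have y: "\<bar>V k $ 2\<bar> \<le> 2 * max (\<bar>V 0 $ 2\<bar> / 2) (rate * M)"
    proof (cases k)
      case (Suc j)
      have "\<bar>V k $ 2\<bar> \<le> 2 * (rate * M + 0)" by (rule lin_step_y[where A = "A j" and u = "V j", OF A M(1) _ M(2)]) (auto simp: eq Suc)
      then show ?thesis by auto
    qed auto
    show "nrm (V k) \<le> max (\<bar>V 0 $ 2\<bar> / 2) (rate * M)"
      unfolding nrm_le_iff using x y z by (auto simp: le_max_iff_disj)
  qed (use rate in auto)
qed

text \<open>Dually the free data are x and z at time 0, so the unstable space is at most a
  plane.\<close>

lemma bwd_bound:
  assumes A: "\<And>k. hyp_lin (A k)" and V: "bwd A V"
  shows "nrm (V k) \<le> max \<bar>V 0 $ 1\<bar> (wt * \<bar>V 0 $ 3\<bar>)"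
proof -
  obtain B where B: "\<And>k. nrm (V k) \<le> B" and eq: "\<And>k. V k = A k (V (Suc k))" using V unfolding bwd_def by metis
  let ?c = "max \<bar>V 0 $ 1\<bar> (wt * \<bar>V 0 $ 3\<bar>)"
  show ?thesis
  proof (rule sup_contraction_le[where d = "\<lambda>k. nrm (V k)" and \<kappa> = rate, OF _ _ _ B])
    fix k M assume M: "0 \<le> M" "\<And>j. nrm (V j) \<le> M"
    have y: "\<bar>V k $ 2\<bar> \<le> 2 * (rate * M + 0)"
      by (rule lin_step_y[where A = "A k", OF A M(1) _ M(2)[of "Suc k"]]) (simp_all flip: eq)
    have x: "\<bar>V k $ 1\<bar> \<le> max ?c (rate * M)"
    proof (cases k)
      case (Suc j)
      have "\<bar>V k $ 1\<bar> \<le> rate * M + 0"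
        by (rule lin_step_x(2)[where A = "A j" and u = "V k" and u' = "V j", OF A M(1) _ M(2) M(2)]) (simp_all add: Suc flip: eq)
      then show ?thesis by auto
    qed auto
    have z: "wt * \<bar>V k $ 3\<bar> \<le> max ?c (rate * M)"
    proof (cases k)
      case (Suc j)
      have "wt * \<bar>V k $ 3\<bar> \<le> rate * M + 0"
        by (rule lin_step_z[where A = "A j" and u = "V k" and u' = "V j", OF A M(1) _ M(2) M(2)]) (simp_all add: Suc flip: eq)
      then show ?thesis by auto
    qed auto
    show "nrm (V k) \<le> max ?c (rate * M)"
      unfolding nrm_le_iff using x y z by (auto simp: le_max_iff_disj)
  qed (use rate in \<open>auto simp: le_max_iff_disj\<close>)
qed

lemma linear_perturbation:
  assumes "linear A" "\<And>v. norm (A v - A' v) \<le> \<tau> * norm v" "0 \<le> \<tau>" "nrm w \<le> B"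
  shows "\<bar>(A v - A' w) $ i - A (v - w) $ i\<bar> \<le> \<tau> * (nrmC * B)"
proof -
  have "(A v - A' w) $ i - A (v - w) $ i = (A w - A' w) $ i" by (simp add: linear_diff[OF assms(1)])
  also have "\<bar>\<dots>\<bar> \<le> norm (A w - A' w)" by (rule component_le_norm_cart)
  also have "\<dots> \<le> \<tau> * norm w" by (rule assms(2))
  also have "\<dots> \<le> \<tau> * (nrmC * B)" using norm_le_nrmC[OF assms(4)] assms(3) by (intro mult_left_mono) auto
  finally show ?thesis .
qed

text \<open>Continuity of the stable direction in the cocycle: exchanging A' for A creates a source
  term proportional to \<tau>, and what happens after time n is damped by \<open>rate\<close>^(n +
  1).\<close>

lemma fwd_compare:
  assumes A: "\<And>k. hyp_lin (A k)" and V: "fwd A V" "\<And>k. nrm (V k) \<le> B" and W: "fwd A' W" "\<And>k. nrm (W k) \<le> B"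
    and init: "V 0 $ 2 = W 0 $ 2" and \<tau>: "0 \<le> \<tau>" "\<And>k v. k \<le> n \<Longrightarrow> norm (A k v - A' k v) \<le> \<tau> * norm v"
  shows "nrm (V 0 - W 0) \<le> rate ^ (n + 1) * (2 * B) + \<tau> * (nrmC * B) / (1 - rate)"
proof -
  have B: "0 \<le> B" using V(2) nrm_nonneg order.trans by blast
  have r: "0 \<le> \<tau> * (nrmC * B)" using \<tau> B nrmC by simp
  have diff: "\<bar>(V (Suc k) - W (Suc k)) $ i - A k (V k - W k) $ i\<bar> \<le> \<tau> * (nrmC * B)" if "k \<le> n" for k i
    using linear_perturbation[of "A k" "A' k" \<tau> "W k" B "V k" i] A[of k] \<tau> that V(1) W by (simp add: fwd_def hyp_lin_def)
  show ?thesis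
  proof (rule decay_nat[where d = "\<lambda>k. nrm (V k - W k)", OF r])
    show "nrm (V k - W k) \<le> 2 * B" for k using nrm_diff_le[of "V k" "W k"] V(2)[of k] W(2)[of k] by simp
    fix k M assume k: "k \<le> n" and M: "0 \<le> M" "k \<noteq> 0 \<Longrightarrow> nrm (V (k - 1) - W (k - 1)) \<le> M"
      "nrm (V k - W k) \<le> M" "nrm (V (Suc k) - W (Suc k)) \<le> M"
    have "\<bar>(V k - W k) $ 2\<bar> \<le> 2 * (rate * M + \<tau> * (nrmC * B))"
    proof (cases k)
      case 0
      then show ?thesis using init rate M r by simp
    next
      case (Suc j)
      then show ?thesis using lin_step_y[OF A M(1) r, of "V j - W j" "(V k - W k) $ 2" j] diff[of j 2] M(2) k by auto
    qed
    then show "nrm (V k - W k) \<le> rate * M + \<tau> * (nrmC * B)"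
      unfolding nrm_le_iff using lin_step_x(2)[OF A M(1) r M(3,4) diff[OF k]] lin_step_z[OF A M(1) r M(3,4) diff[OF k]] by simp
  qed (use B in auto)
qed

lemma bwd_compare:
  assumes A: "\<And>k. hyp_lin (A k)" and V: "bwd A V" "\<And>k. nrm (V k) \<le> B" and W: "bwd A' W" "\<And>k. nrm (W k) \<le> B"
    and init: "V 0 $ 1 = W 0 $ 1" "V 0 $ 3 = W 0 $ 3"
    and \<tau>: "0 \<le> \<tau>" "\<And>k v. k \<le> n \<Longrightarrow> norm (A k v - A' k v) \<le> \<tau> * norm v"
  shows "nrm (V 0 - W 0) \<le> rate ^ (n + 1) * (2 * B) + \<tau> * (nrmC * B) / (1 - rate)"
proof -
  have B: "0 \<le> B" using V(2) nrm_nonneg order.trans by blast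
  have r: "0 \<le> \<tau> * (nrmC * B)" using \<tau> B nrmC by simp
  have diff: "\<bar>(V k - W k) $ i - A k (V (Suc k) - W (Suc k)) $ i\<bar> \<le> \<tau> * (nrmC * B)" if "k \<le> n" for k i
  proof -
    have "V k = A k (V (Suc k))" "W k = A' k (W (Suc k))" using V(1) W(1) unfolding bwd_def by blast+
    then show ?thesis
      using linear_perturbation[of "A k" "A' k" \<tau> "W (Suc k)" B "V (Suc k)" i] A[of k] \<tau> that W(2) by (simp add: hyp_lin_def)
  qed
  show ?thesis
  proof (rule decay_nat[where d = "\<lambda>k. nrm (V k - W k)", OF r])
    show "nrm (V k - W k) \<le> 2 * B" for k using nrm_diff_le[of "V k" "W k"] V(2)[of k] W(2)[of k] by simp
    fix k M assume k: "k \<le> n" and M: "0 \<le> M" "k \<noteq> 0 \<Longrightarrow> nrm (V (k - 1) - W (k - 1)) \<le> M"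
      "nrm (V k - W k) \<le> M" "nrm (V (Suc k) - W (Suc k)) \<le> M"
    have y: "\<bar>(V k - W k) $ 2\<bar> \<le> 2 * (rate * M + \<tau> * (nrmC * B))"
      by (rule lin_step_y[OF A M(1) r M(4) diff[OF k]])
    show "nrm (V k - W k) \<le> rate * M + \<tau> * (nrmC * B)"
    proof (cases k)
      case 0
      then show ?thesis unfolding nrm_le_iff using init rate M r y by simp
    next
      case (Suc j)
      then have j: "j \<le> n" and Mj: "nrm (V (Suc j) - W (Suc j)) \<le> M" "nrm (V j - W j) \<le> M" using k M by auto
      show ?thesis
        unfolding nrm_le_iff using y lin_step_x(2)[OF A M(1) r Mj diff[OF j]] lin_step_z[OF A M(1) r Mj diff[OF j]]
        by (simp add: Suc)
    qed
  qed (use B in auto)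
qed

text \<open>The squared norm of \<open>weighted_metric\<close>: hyperbolicity asks for a Riemannian
  metric, which the maximum norm \<open>nrm\<close> does not come from.\<close>

definition "quad v = (v $ 1)\<^sup>2 + (v $ 2)\<^sup>2 + (wt * v $ 3)\<^sup>2" for v :: "real ^ 3"

text \<open>A stable vector is dominated by y, which the map replaces by the much smaller x. With c
  = |y|/2 the next y is at most 0.41 c and the other weighted coordinates at most half of that, so
  \<open>quad\<close> drops below \<open>0.26 * c\<^sup>2\<close> from at least
  \<open>4 * c\<^sup>2\<close>.\<close>

lemma fwd_rate:
  assumes A: "\<And>k. hyp_lin (A k)" and V: "fwd A V"
  shows "quad (V 1) \<le> 1/10 * quad (V 0)"
proof -
  define c where "c = \<bar>V 0 $ 2\<bar> / 2"
  have c0: "0 \<le> c" by (simp add: c_def)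
  have eq: "V (Suc k) = A k (V k)" for k using V by (simp add: fwd_def)
  have b: "nrm (V k) \<le> c" for k unfolding c_def by (rule fwd_bound[OF A V])
  have x: "\<bar>V 0 $ 1\<bar> \<le> 4/10 * c + 0"
    by (rule lin_step_x(1)[where A = "A 0" and u = "V 0" and u' = "V 1", OF A c0 _ b b]) (auto simp: eq[of 0])
  obtain a where a: "\<And>v i. \<bar>(A 0 v - lin a v) $ i\<bar> \<le> tol * norm v" using hyp_linE[OF A[of 0]] by metis
  have "tol * nrmC * c \<le> 5/1000000 * c" using nrmC c0 by (intro mult_right_mono) auto
  then have "\<bar>V 1 $ 2 - V 0 $ 1\<bar> \<le> 5/1000000 * c"
    using a[of "V 0" 2] tol_norm_le[OF b[of 0]] eq[of 0] by (simp add: lin_def mult.assoc)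
  then have y1: "\<bar>V 1 $ 2\<bar> \<le> 41/100 * c" using x by linarith
  have "fwd (\<lambda>k. A (Suc k)) (\<lambda>k. V (Suc k))" using V unfolding fwd_def by blast
  from fwd_bound[OF A this, of 0] have "nrm (V 1) \<le> 205/1000 * c" using y1 by simp
  then have "\<bar>V 1 $ 1\<bar> \<le> 205/1000 * c" "\<bar>wt * V 1 $ 3\<bar> \<le> 205/1000 * c"
    unfolding nrm_le_iff using wt by (simp_all add: abs_mult)
  then have "(V 1 $ 1)\<^sup>2 \<le> ((205/1000) * c)\<^sup>2" "(V 1 $ 2)\<^sup>2 \<le> ((41/100) * c)\<^sup>2" "(wt * V 1 $ 3)\<^sup>2 \<le> ((205/1000) * c)\<^sup>2"
    using y1 c0 by (auto intro!: abs_le_square_iff[THEN iffD1] simp: abs_mult)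
  then have "quad (V 1) \<le> 25215/100000 * c\<^sup>2" unfolding quad_def power_mult_distrib by (simp add: power2_eq_square)
  also have "\<dots> \<le> 4/10 * c\<^sup>2" by (rule mult_right_mono) auto
  also have "\<dots> = 1/10 * (V 0 $ 2)\<^sup>2" by (simp add: c_def power_divide)
  also have "\<dots> \<le> 1/10 * quad (V 0)" by (simp add: quad_def)
  finally show ?thesis .
qed

text \<open>The slack in \<open>cone_step\<close> starts at the a priori bound 2 B and is halved by
  each of m steps of the past; letting m grow leaves the cone without slack.\<close>

lemma bwd_cone:
  assumes A: "\<And>k. hyp_lin (A k)" and V: "bwd A V"
  shows "\<bar>V k $ 2\<bar> \<le> 3/10 * \<bar>V k $ 1\<bar> + 2 * tol * \<bar>V k $ 3\<bar>"
proof -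
  obtain B where B: "\<And>k. nrm (V k) \<le> B" and eq: "\<And>k. V k = A k (V (Suc k))" using V unfolding bwd_def by metis
  have B0: "0 \<le> B" using B nrm_nonneg order.trans by blast
  have "\<forall>k. \<bar>V k $ 2\<bar> \<le> 3/10 * \<bar>V k $ 1\<bar> + 2 * tol * \<bar>V k $ 3\<bar> + (1 / 2) ^ m * (2 * B)" for m
  proof (induction m)
    case 0
    show ?case
    proof
      fix k
      have "0 \<le> tol * \<bar>V k $ 3\<bar>" using tol by simp
      moreover have "\<bar>V k $ 2\<bar> \<le> 2 * B" using B[of k] by (simp add: nrm_le_iff)
      ultimately show "\<bar>V k $ 2\<bar> \<le> 3/10 * \<bar>V k $ 1\<bar> + 2 * tol * \<bar>V k $ 3\<bar> + (1 / 2) ^ 0 * (2 * B)"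
        unfolding power_0 mult_1_left mult.assoc[of 2 tol] by linarith
    qed
  next
    case (Suc m)
    show ?case
    proof
      fix k
      obtain a where a: "517/1000 \<le> \<bar>a\<bar>" "\<And>v i. \<bar>(A k v - lin a v) $ i\<bar> \<le> tol * norm v" using hyp_linE[OF A[of k]] by metis
      define u where "u = V (Suc k)"
      have e: "\<bar>(V k - lin a u) $ i\<bar> \<le> tol * (\<bar>u $ 1\<bar> + \<bar>u $ 2\<bar> + \<bar>u $ 3\<bar>)" for i
      proof -
        have "tol * norm u \<le> tol * (\<bar>u $ 1\<bar> + \<bar>u $ 2\<bar> + \<bar>u $ 3\<bar>)" using tol by (intro mult_left_mono norm_le_sum3) auto
        moreover have "\<bar>(V k - lin a u) $ i\<bar> \<le> tol * norm u" using a(2)[of u i] unfolding u_def eq[of k, symmetric] .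
        ultimately show ?thesis by linarith
      qed
      have "\<bar>V k $ 2\<bar> \<le> 3/10 * \<bar>V k $ 1\<bar> + 2 * tol * \<bar>V k $ 3\<bar> + ((1 / 2) ^ m * (2 * B)) / 2"
      proof (rule cone_step[where \<mu> = "8 * a" and \<xi> = \<xi> and x = "u $ 1" and y = "u $ 2" and z = "u $ 3"])
        show "V k $ 1 = 8 * a * u $ 1 + 3/10 * u $ 2 + (V k - lin a u) $ 1" "V k $ 2 = u $ 1 + (V k - lin a u) $ 2"
          "V k $ 3 = \<xi> * u $ 3 + u $ 1 + (V k - lin a u) $ 3" by (simp_all add: lin_def)
        show "\<bar>u $ 2\<bar> \<le> 3/10 * \<bar>u $ 1\<bar> + 2 * tol * \<bar>u $ 3\<bar> + (1 / 2) ^ m * (2 * B)" unfolding u_def using Suc by blast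
      qed (use tol xi a e B0 in auto)
      then show "\<bar>V k $ 2\<bar> \<le> 3/10 * \<bar>V k $ 1\<bar> + 2 * tol * \<bar>V k $ 3\<bar> + (1 / 2) ^ Suc m * (2 * B)" by simp
    qed
  qed
  then have "\<bar>V k $ 2\<bar> \<le> (1 / 2) ^ m * (2 * B) + ((3/10) * \<bar>V k $ 1\<bar> + 2 * tol * \<bar>V k $ 3\<bar>)" for m
    by (simp only: add.commute[of "(1 / 2) ^ m * (2 * B)"])
  note G = this
  show ?thesis by (rule geometric_bound_imp_le[OF _ _ G]) auto
qed

text \<open>h stands for \<xi> - 1, Z for the weighted z, p and q bound the new x and weighted z.
  The x-part gains a factor near 16, which pays for the cross terms; the Z-part gains about 1 + 1.8
  h, of which 0.8 h is surplus.\<close>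

lemma quad_expansion:
  fixes h x y Z p q \<tau> :: real
  assumes h: "0 < h" "h \<le> 712/1000" and nn: "0 \<le> x" "0 \<le> y" "0 \<le> Z" and \<tau>: "0 \<le> \<tau>" "\<tau> \<le> 4 * h / 1000000"
    and y: "y \<le> 3/10 * x + 2 * \<tau> * Z" and p: "4 * x - 2 * \<tau> * Z \<le> p" and q: "(1 + 999/1000 * h) * Z - (3/10) * h * x \<le> q"
  shows "(1 + h) * (x\<^sup>2 + y\<^sup>2 + Z\<^sup>2) \<le> p\<^sup>2 + q\<^sup>2"
proof -
  have p2: "16 * x\<^sup>2 - 16 * (\<tau> * (x * Z)) \<le> p\<^sup>2"
  proof -
    \<comment> \<open>The tangent inequality avoids squaring the lower bound for p, which may be
      negative.\<close>
    have "0 \<le> (p - 4 * x)\<^sup>2" by simp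
    then have "8 * x * p - 16 * x\<^sup>2 \<le> p\<^sup>2" by (simp add: power2_eq_square algebra_simps)
    moreover have "8 * x * (4 * x - 2 * \<tau> * Z) \<le> 8 * x * p" using p nn by (intro mult_left_mono) auto
    ultimately show ?thesis by (simp add: power2_eq_square algebra_simps)
  qed
  define t where "t = (1 + 9/10 * h) * Z"
  have "(1 + 9/10 * h) * Z \<le> 165/100 * Z" by (rule mult_right_mono) (use h nn in auto)
  then have t: "0 \<le> t" "t \<le> 165/100 * Z" using h nn by (simp_all add: t_def)
  have hx: "0 \<le> h * x" using h nn by simp
  have q2: "(1 + 18/10 * h) * Z\<^sup>2 - (99/100) * (h * (x * Z)) \<le> q\<^sup>2"
  proof -
    have "0 \<le> (q - t)\<^sup>2" by simp
    then have a: "2 * t * q - t\<^sup>2 \<le> q\<^sup>2" by (simp add: power2_eq_square algebra_simps)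
    have "(1 + 9/10 * h) * Z \<le> (1 + 999/1000 * h) * Z" using h nn by (intro mult_right_mono) auto
    then have "t - (3/10) * h * x \<le> q" using q unfolding t_def by linarith
    then have "2 * t * (t - (3/10) * h * x) \<le> 2 * t * q" using t by (intro mult_left_mono) auto
    then have "t\<^sup>2 - (6/10) * (t * (h * x)) \<le> q\<^sup>2" using a by (simp add: power2_eq_square algebra_simps)
    moreover have "t * (h * x) \<le> 165/100 * Z * (h * x)" using t hx by (intro mult_right_mono) auto
    moreover have "(1 + 18/10 * h) * Z\<^sup>2 \<le> t\<^sup>2"
      unfolding t_def power_mult_distrib by (intro mult_right_mono) (auto simp: power2_eq_square algebra_simps)
    ultimately show ?thesis by (simp add: mult_ac)
  qed
  have xZ: "x * Z \<le> x\<^sup>2 + Z\<^sup>2 / 4" "0 \<le> x * Z"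
    using zero_le_power2[of "x - Z / 2"] nn by (auto simp: power2_eq_square algebra_simps)
  have y2: "y\<^sup>2 \<le> 18/100 * x\<^sup>2 + 8/1000000 * (h * Z\<^sup>2)"
  proof -
    have "y\<^sup>2 \<le> ((3/10) * x + 2 * \<tau> * Z)\<^sup>2" using y nn by (intro power_mono) auto
    also have "\<dots> \<le> 2 * ((3/10) * x)\<^sup>2 + 2 * (2 * \<tau> * Z)\<^sup>2"
      using zero_le_power2[of "3/10 * x - 2 * \<tau> * Z"] by (simp add: power2_eq_square algebra_simps)
    also have "\<dots> = 18/100 * x\<^sup>2 + 8 * (\<tau>\<^sup>2 * Z\<^sup>2)" by (simp add: power_mult_distrib power2_eq_square)
    also have "\<tau>\<^sup>2 * Z\<^sup>2 \<le> ((1/1000000) * h) * Z\<^sup>2"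
    proof (rule mult_right_mono)
      have "\<tau> * \<tau> \<le> 1/1000000 * h" by (rule mult_mono[THEN order.trans, of \<tau> "1/100000" \<tau> "1/10 * h"]) (use \<tau> h in auto)
      then show "\<tau>\<^sup>2 \<le> 1/1000000 * h" by (simp add: power2_eq_square)
    qed simp
    finally show ?thesis by (simp add: mult_ac)
  qed
  have "h * (x * Z) \<le> h * (x\<^sup>2 + Z\<^sup>2 / 4)" using h xZ by (intro mult_left_mono) auto
  also have "\<dots> = h * x\<^sup>2 + h * Z\<^sup>2 / 4" by (simp add: algebra_simps)
  finally have 1: "h * (x * Z) \<le> h * x\<^sup>2 + h * Z\<^sup>2 / 4" .
  have 2: "h * x\<^sup>2 \<le> 712/1000 * x\<^sup>2" "h * y\<^sup>2 \<le> 712/1000 * y\<^sup>2"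
    using mult_right_mono[OF h(2), of "x\<^sup>2"] mult_right_mono[OF h(2), of "y\<^sup>2"] by simp_all
  have "\<tau> * (x * Z) \<le> 4 * h / 1000000 * (x * Z)" using \<tau> xZ by (intro mult_right_mono) auto
  then have 3: "\<tau> * (x * Z) \<le> 4/1000000 * (h * (x * Z))" by simp
  have 4: "0 \<le> x\<^sup>2" "0 \<le> h * Z\<^sup>2" "0 \<le> h * (x * Z)" using h xZ by auto
  have "(1 + 18/10 * h) * Z\<^sup>2 = Z\<^sup>2 + 18/10 * (h * Z\<^sup>2)" by (simp add: algebra_simps)
  moreover have "(1 + h) * (x\<^sup>2 + y\<^sup>2 + Z\<^sup>2) = x\<^sup>2 + y\<^sup>2 + Z\<^sup>2 + h * x\<^sup>2 + h * y\<^sup>2 + h * Z\<^sup>2"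
    by (simp add: algebra_simps)
  ultimately show ?thesis using p2 q2 y2 1 2 3 4 by linarith
qed

text \<open>With \<open>wt\<close> = (\<xi> - 1)/4 the influence of x on the weighted z costs at
  most 0.3 (\<xi> - 1) |x|, which the strong growth of x outweighs. So the squared norm grows by the
  full factor \<xi>, the norm by sqrt \<xi>.\<close>

lemma bwd_rate:
  assumes A: "\<And>k. hyp_lin (A k)" and V: "bwd A V"
  shows "\<xi> * quad (V 1) \<le> quad (V 0)"
proof -
  define x y z where "x = \<bar>V 1 $ 1\<bar>" and "y = \<bar>V 1 $ 2\<bar>" and "z = \<bar>V 1 $ 3\<bar>"
  define \<tau> where "\<tau> = tol / wt"
  have nn: "0 \<le> x" "0 \<le> y" "0 \<le> z" by (auto simp: x_def y_def z_def)
  have \<tau>: "\<tau> = 4 * (\<xi> - 1) / 1000000" using xi by (simp add: \<tau>_def tol_def wt_def power2_eq_square field_simps)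
  have tz: "tol * z = \<tau> * (wt * z)" using wt by (simp add: \<tau>_def)
  have cone: "y \<le> 3/10 * x + 2 * \<tau> * (wt * z)"
    using bwd_cone[OF A V, of 1] tz unfolding x_def y_def z_def mult.assoc[of 2] by linarith
  obtain a where a: "517/1000 \<le> \<bar>a\<bar>" "\<And>v i. \<bar>(A 0 v - lin a v) $ i\<bar> \<le> tol * norm v" using hyp_linE[OF A[of 0]] by metis
  have V0: "V 0 = A 0 (V 1)" using V unfolding bwd_def by (metis One_nat_def)
  define e where "e i = (A 0 (V 1) - lin a (V 1)) $ i" for i :: 3
  have eq: "V 0 $ 1 = 8 * a * V 1 $ 1 + 3/10 * V 1 $ 2 + e 1" "V 0 $ 3 = \<xi> * V 1 $ 3 + V 1 $ 1 + e 3"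
    unfolding V0 e_def by (simp_all add: lin_def)
  have tn: "tol * norm (V 1) \<le> tol * (x + y + z)" unfolding x_def y_def z_def using tol by (intro mult_left_mono norm_le_sum3) auto
  have txy: "tol * x \<le> 1/1000000 * x" "tol * y \<le> 1/1000000 * y" 
    using mult_right_mono[OF tol(2) nn(1)] mult_right_mono[OF tol(2) nn(2)] by simp_all
  have e: "\<bar>e i\<bar> \<le> 1/1000000 * x + 1/1000000 * y + \<tau> * (wt * z)" for i
    using a(2)[of "V 1" i] tn txy tz unfolding e_def distrib_left by linarith
  have \<tau>Z: "0 \<le> \<tau> * (wt * z)" unfolding tz[symmetric] using tol nn by simp
  have cone': "y \<le> 3/10 * x + 2 * (\<tau> * (wt * z))" using cone by (simp add: mult.assoc)
  have p: "4 * x - 2 * \<tau> * (wt * z) \<le> \<bar>V 0 $ 1\<bar>"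
  proof -
    have "4136/1000 * x \<le> \<bar>8 * a\<bar> * x" using a(1) nn by (intro mult_right_mono) auto
    also have "\<dots> = \<bar>8 * a * V 1 $ 1\<bar>" unfolding x_def abs_mult ..
    also have "\<dots> \<le> \<bar>V 0 $ 1\<bar> + 3/10 * y + \<bar>e 1\<bar>" using eq(1) unfolding y_def by linarith
    finally have "4136/1000 * x \<le> \<bar>V 0 $ 1\<bar> + 3/10 * y + \<bar>e 1\<bar>" .
    then have "4 * x - 2 * (\<tau> * (wt * z)) \<le> \<bar>V 0 $ 1\<bar>" using e[of 1] cone' nn \<tau>Z by linarith
    then show ?thesis by (simp add: mult.assoc)
  qed
  have q: "(1 + 999/1000 * (\<xi> - 1)) * (wt * z) - (3/10) * (\<xi> - 1) * x \<le> wt * \<bar>V 0 $ 3\<bar>"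
  proof -
    have "\<xi> * z = \<bar>\<xi> * V 1 $ 3\<bar>" unfolding z_def abs_mult using xi by simp
    also have "\<dots> \<le> \<bar>V 0 $ 3\<bar> + x + \<bar>e 3\<bar>" using eq(2) unfolding x_def by linarith
    finally have "\<xi> * z \<le> \<bar>V 0 $ 3\<bar> + 11/10 * x + 11/10 * (\<tau> * (wt * z))" using e[of 3] cone' nn \<tau>Z by linarith
    then have 1: "wt * (\<xi> * z) \<le> wt * (\<bar>V 0 $ 3\<bar> + 11/10 * x + 11/10 * (\<tau> * (wt * z)))" using wt by (intro mult_left_mono) auto
    have "wt * \<tau> = tol" using wt by (simp add: \<tau>_def)
    then have 2: "wt * (\<tau> * (wt * z)) = tol * (wt * z)" by (simp add: mult.assoc[symmetric])
    have 3: "tol * (wt * z) \<le> (\<xi> - 1) / 1000000 * (wt * z)" using tol nn wt by (intro mult_right_mono) auto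
    have "wt * (11/10) \<le> 3/10 * (\<xi> - 1)" using xi by (simp add: wt_def)
    then have 4: "wt * (11/10) * x \<le> 3/10 * (\<xi> - 1) * x" using nn(1) by (rule mult_right_mono)
    have 5: "0 \<le> (\<xi> - 1) * (wt * z)" using xi wt nn by simp
    have "wt * (\<xi> * z) = wt * z + (\<xi> - 1) * (wt * z)" by (simp add: algebra_simps)
    moreover have "wt * (\<bar>V 0 $ 3\<bar> + 11/10 * x + 11/10 * (\<tau> * (wt * z))) = wt * \<bar>V 0 $ 3\<bar> + wt * (11/10) * x + 11/10 * (tol * (wt * z))"
      unfolding 2[symmetric] by (simp add: algebra_simps)
    moreover have "(1 + 999/1000 * (\<xi> - 1)) * (wt * z) = wt * z + 999/1000 * ((\<xi> - 1) * (wt * z))" by (simp add: algebra_simps)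
    moreover have "(\<xi> - 1) / 1000000 * (wt * z) = 1/1000000 * ((\<xi> - 1) * (wt * z))" by simp
    ultimately show ?thesis using 1 3 4 5 by linarith
  qed
  have "(1 + (\<xi> - 1)) * (x\<^sup>2 + y\<^sup>2 + (wt * z)\<^sup>2) \<le> \<bar>V 0 $ 1\<bar>\<^sup>2 + (wt * \<bar>V 0 $ 3\<bar>)\<^sup>2"
    by (rule quad_expansion[OF _ _ nn(1,2) _ _ _ cone p q]) (use xi wt nn \<tau> in auto)
  also have "\<dots> \<le> quad (V 0)" by (simp add: quad_def power_mult_distrib)
  also have "x\<^sup>2 + y\<^sup>2 + (wt * z)\<^sup>2 = quad (V 1)" by (simp add: quad_def power_mult_distrib x_def y_def z_def)
  finally show ?thesis by simp
qed

end

section \<open>Diffeomorphisms near the skew product\<close>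

definition DB :: "('a::euclidean_space \<Rightarrow> 'a) \<Rightarrow> 'a \<Rightarrow> 'a \<Rightarrow>\<^sub>L 'a" where
  "DB g x = Blinfun (Df g x)"

lemma
  assumes "C1_on UNIV g"
  shows C1_on_has_derivative: "(g has_derivative Df g x) (at x)"
    and DB_apply: "blinfun_apply (DB g x) = Df g x"
    and continuous_on_DB: "continuous_on UNIV (DB g)"
proof -
  obtain g' where g': "\<And>x. (g has_derivative blinfun_apply (g' x)) (at x)" "continuous_on UNIV g'"
    using assms by (auto simp: C1_on_def)
  have eq: "Df g x = blinfun_apply (g' x)" for x
    using frechet_derivative_at[OF g'(1)] by simp
  then have "DB g = g'" unfolding DB_def by (intro ext) (simp only: eq blinfun_apply_inverse)
  then show "(g has_derivative Df g x) (at x)" "blinfun_apply (DB g x) = Df g x" "continuous_on UNIV (DB g)"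
    using g' eq by auto
qed

lemma C1_on_continuous: "C1_on UNIV g \<Longrightarrow> continuous_on UNIV g" for g :: "'a::euclidean_space \<Rightarrow> 'a"
  by (rule has_derivative_continuous_on[of _ _ "Df g"]) (simp add: C1_on_has_derivative)

lemma onorm_Df_diff:
  assumes "C1_on UNIV f" "C1_on UNIV g"
  shows "onorm (\<lambda>v. Df f x v - Df g x v) = norm (DB f x - DB g x)"
  by (simp add: norm_blinfun.rep_eq minus_blinfun.rep_eq DB_apply[OF assms(1)] DB_apply[OF assms(2)])

text \<open>Strict inequalities on a compact set hold with a margin: the continuous function m
  attains its maximum below e, and the difference serves as radius around g.\<close>

lemma C1_open_C1_ball:
  assumes g0: "C1_diffeo g0" and K: "compact K"
  shows "C1_open {g. C1_diffeo g \<and> C1_close K e g0 g}"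
  unfolding C1_open_def
proof (intro conjI ballI)
  fix g assume g: "g \<in> {g. C1_diffeo g \<and> C1_close K e g0 g}"
  have C: "C1_on UNIV g0" "C1_on UNIV g" using g g0 by (auto simp: C1_diffeo_def)
  define m where "m x = max (dist (g0 x) (g x)) (norm (DB g0 x - DB g x))" for x
  have m_less: "m x < e" if "x \<in> K" for x
    using g that onorm_Df_diff[OF C] by (auto simp: m_def C1_close_def)
  have "continuous_on K m"
    unfolding m_def
    by (intro continuous_intros continuous_on_subset[OF C1_on_continuous[OF C(1)]] continuous_on_subset[OF C1_on_continuous[OF C(2)]]
        continuous_on_subset[OF continuous_on_DB[OF C(1)]] continuous_on_subset[OF continuous_on_DB[OF C(2)]]) auto
  then have "\<exists>d>0. \<forall>x\<in>K. m x + d \<le> e"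
  proof (cases "K = {}")
    case False
    then obtain y where y: "y \<in> K" "\<And>x. x \<in> K \<Longrightarrow> m x \<le> m y"
      using continuous_attains_sup[OF K _ \<open>continuous_on K m\<close>] by auto
    then have "0 < e - m y" "\<forall>x\<in>K. m x + (e - m y) \<le> e" using m_less by auto
    then show ?thesis by blast
  qed (auto intro: exI[of _ 1])
  then obtain d where d: "0 < d" "\<And>x. x \<in> K \<Longrightarrow> m x + d \<le> e" by auto
  have "g' \<in> {g. C1_diffeo g \<and> C1_close K e g0 g}" if g': "C1_diffeo g'" "C1_close K d g g'" for g'
  proof -
    have C': "C1_on UNIV g'" using g' by (auto simp: C1_diffeo_def)
    have "dist (g0 x) (g' x) < e \<and> norm (DB g0 x - DB g' x) < e" if x: "x \<in> K" for x
    proof -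
      have "dist (g x) (g' x) < d" "norm (DB g x - DB g' x) < d"
        using g'(2) x onorm_Df_diff[OF C(2) C'] by (auto simp: C1_close_def)
      moreover have "norm (DB g0 x - DB g' x) \<le> norm (DB g0 x - DB g x) + norm (DB g x - DB g' x)"
        using norm_triangle_ineq[of "DB g0 x - DB g x" "DB g x - DB g' x"] by simp
      moreover have "dist (g0 x) (g' x) \<le> dist (g0 x) (g x) + dist (g x) (g' x)" by (rule dist_triangle)
      moreover have "dist (g0 x) (g x) \<le> m x" "norm (DB g0 x - DB g x) \<le> m x" by (auto simp: m_def)
      ultimately show ?thesis using d(2)[OF x] by linarith
    qed
    then show ?thesis using g'(1) onorm_Df_diff[OF C(1) C'] by (auto simp: C1_close_def)
  qed
  then show "\<exists>K'. compact K' \<and> (\<exists>d>0. \<forall>g'. C1_diffeo g' \<and> C1_close K' d g g' \<longrightarrow> g' \<in> {g. C1_diffeo g \<and> C1_close K e g0 g})"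
    using K d(1) by blast
qed auto

lemma C1_close_refl: "0 < e \<Longrightarrow> C1_close K e g g"
  by (simp add: C1_close_def onorm_zero)

text \<open>Tailored to the map and its inverse, each with a single quadratic term: the derivative
  is a constant operator plus a scalar multiple of another, so its continuity is that of the
  scalar.\<close>

lemma C1_onI:
  fixes f :: "'a::euclidean_space \<Rightarrow> 'a"
  assumes L: "bounded_linear L" and B: "bounded_linear B" and c: "continuous_on UNIV c"
    and f: "\<And>x. (f has_derivative (\<lambda>v. L v + c x *\<^sub>R B v)) (at x)"
  shows "C1_on UNIV f"
proof -
  define f' where "f' x = Blinfun L + c x *\<^sub>R Blinfun B" for x
  have "blinfun_apply (f' x) = (\<lambda>v. L v + c x *\<^sub>R B v)" for x
    by (simp add: f'_def fun_eq_iff blinfun.add_left blinfun.scaleR_left bounded_linear_Blinfun_apply L B)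
  moreover have "continuous_on UNIV f'" unfolding f'_def by (intro continuous_intros c)
  ultimately show ?thesis unfolding C1_on_def using f by (intro exI[of _ f']) auto
qed

lemma vector3_axis: "(vector [a, b, c] :: real ^ 3) = a *\<^sub>R axis 1 1 + b *\<^sub>R axis 2 1 + c *\<^sub>R axis 3 1"
  by (rule vec3_eqI) (simp_all add: axis_def)

lemma henon_skew_has_derivative:
  "(henon_skew \<xi> has_derivative (\<lambda>v. vector [8 * p $ 1 * v $ 1 + 3/10 * v $ 2, v $ 1, \<xi> * v $ 3 + v $ 1])) (at p)"
  unfolding henon_skew_def vector3_axis
  by (auto intro!: derivative_eq_intros bounded_linear.has_derivative[OF bounded_linear_vec_nth] simp: algebra_simps)

context params
begin

lemma henon_skew_inverse:
  defines "h \<equiv> (\<lambda>p :: real ^ 3. vector [p $ 2, (p $ 1 - 4 * (p $ 2)\<^sup>2 + 2375/1000) / (3/10), (p $ 3 - p $ 2) / \<xi>] :: real ^ 3)"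
  shows "henon_skew \<xi> (h p) = p" "h (henon_skew \<xi> p) = p"
  using xi by (auto simp: h_def henon_skew_def field_simps intro!: vec3_eqI)

lemma C1_diffeo_henon_skew: "C1_diffeo (henon_skew \<xi>)"
proof -
  let ?h = "\<lambda>p :: real ^ 3. vector [p $ 2, (p $ 1 - 4 * (p $ 2)\<^sup>2 + 2375/1000) / (3/10), (p $ 3 - p $ 2) / \<xi>] :: real ^ 3"
  have "bij (henon_skew \<xi>)"
    using henon_skew_inverse by (intro bij_betw_byWitness[of _ ?h]) auto
  have inv: "inv (henon_skew \<xi>) = ?h" using henon_skew_inverse by (intro inv_equality) auto
  have "C1_on UNIV (henon_skew \<xi>)"
  proof (rule C1_onI)
    show "bounded_linear (\<lambda>v :: real ^ 3. vector [(3/10) * v $ 2, v $ 1, \<xi> * v $ 3 + v $ 1] :: real ^ 3)"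
      "bounded_linear (\<lambda>v :: real ^ 3. vector [v $ 1, 0, 0] :: real ^ 3)"
      unfolding vector3_axis by (intro bounded_linear_intros bounded_linear_vec_nth)+
    show "continuous_on UNIV (\<lambda>p :: real ^ 3. 8 * p $ 1)" by (intro continuous_intros)
    fix p :: "real ^ 3"
    have "vector [8 * p $ 1 * v $ 1 + 3/10 * v $ 2, v $ 1, \<xi> * v $ 3 + v $ 1] =
        vector [(3/10) * v $ 2, v $ 1, \<xi> * v $ 3 + v $ 1] + (8 * p $ 1) *\<^sub>R (vector [v $ 1, 0, 0] :: real ^ 3)" for v :: "real ^ 3"
      by (rule vec3_eqI) simp_all
    then show "(henon_skew \<xi> has_derivative (\<lambda>v. vector [(3/10) * v $ 2, v $ 1, \<xi> * v $ 3 + v $ 1] + (8 * p $ 1) *\<^sub>R vector [v $ 1, 0, 0])) (at p)"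
      using henon_skew_has_derivative[of \<xi> p] by simp
  qed
  moreover have "C1_on UNIV ?h"
  proof (rule C1_onI)
    show "bounded_linear (\<lambda>v :: real ^ 3. vector [v $ 2, v $ 1 / (3/10), (v $ 3 - v $ 2) / \<xi>] :: real ^ 3)"
      "bounded_linear (\<lambda>v :: real ^ 3. vector [0, v $ 2, 0] :: real ^ 3)"
      unfolding vector3_axis divide_inverse by (intro bounded_linear_intros bounded_linear_vec_nth)+
    show "continuous_on UNIV (\<lambda>p :: real ^ 3. - 8 / (3/10) * p $ 2)" by (intro continuous_intros)
    show "(?h has_derivative (\<lambda>v. vector [v $ 2, v $ 1 / (3/10), (v $ 3 - v $ 2) / \<xi>] + (- 8 / (3/10) * p $ 2) *\<^sub>R vector [0, v $ 2, 0])) (at p)" for p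
      unfolding vector3_axis using xi
      by (auto intro!: derivative_eq_intros bounded_linear.has_derivative[OF bounded_linear_vec_nth]
          simp: algebra_simps diff_divide_distrib)
  qed
  ultimately show ?thesis using \<open>bij (henon_skew \<xi>)\<close> inv by (simp add: C1_diffeo_def)
qed

lemma Df_henon_skew: "Df (henon_skew \<xi>) p = lin (p $ 1)"
  using frechet_derivative_at[OF henon_skew_has_derivative[of \<xi> p]] by (simp add: lin_def fun_eq_iff)

section \<open>The neighbourhood of admissible perturbations\<close>

definition "F = {g. C1_diffeo g \<and> C1_close (reg) tol (henon_skew \<xi>) g}"

lemma F_C1: assumes "g \<in> F" shows "C1_on UNIV g" "C1_on UNIV (inv g)" "bij g"
  using assms by (auto simp: F_def C1_diffeo_def)

lemma henon_skew_in_F: "henon_skew \<xi> \<in> F"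
  using C1_diffeo_henon_skew C1_close_refl tol by (simp add: F_def)

lemma C1_open_F: "C1_open F"
  unfolding F_def by (rule C1_open_C1_ball[OF C1_diffeo_henon_skew compact_region])

lemma Df_minus_lin_bound:
  assumes "g \<in> F" "p \<in> reg"
  shows "onorm (\<lambda>v. Df g p v - lin (p $ 1) v) \<le> tol" "norm (Df g p v - lin (p $ 1) v) \<le> tol * norm v"
proof -
  have C: "C1_on UNIV (henon_skew \<xi>)" "C1_on UNIV g" using assms henon_skew_in_F F_C1 by auto
  have n: "norm (DB (henon_skew \<xi>) p - DB g p) \<le> tol"
    using assms onorm_Df_diff[OF C] by (auto simp: F_def C1_close_def intro: less_imp_le)
  have eq: "Df g p v - lin (p $ 1) v = (DB g p - DB (henon_skew \<xi>) p) v" for v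
    by (simp add: minus_blinfun.rep_eq DB_apply C Df_henon_skew)
  show "onorm (\<lambda>v. Df g p v - lin (p $ 1) v) \<le> tol"
    unfolding eq using n by (simp add: norm_minus_commute norm_blinfun.rep_eq[symmetric])
  have "norm ((DB g p - DB (henon_skew \<xi>) p) v) \<le> norm (DB g p - DB (henon_skew \<xi>) p) * norm v" by (rule norm_blinfun)
  also have "\<dots> \<le> tol * norm v" using n by (intro mult_right_mono) (auto simp: norm_minus_commute)
  finally show "norm (Df g p v - lin (p $ 1) v) \<le> tol * norm v" unfolding eq .
qed

text \<open>The mean value inequality on the convex box turns the derivative bound for
  \<open>err g\<close> into the Lipschitz bound.\<close>

lemma F_near: assumes g: "g \<in> F" shows "near g"
  unfolding near_def
proof (intro conjI ballI)
  show "norm (err g p) \<le> tol" if "p \<in> reg" for p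
    using g that by (auto simp: F_def C1_close_def err_def dist_norm norm_minus_commute intro: less_imp_le)
  fix p q assume pq: "p \<in> reg" "q \<in> reg"
  show "norm (err g p - err g q) \<le> tol * norm (p - q)"
  proof (rule differentiable_bound[OF convex_region _ _ pq])
    show "(err g has_derivative (\<lambda>v. Df g r v - lin (r $ 1) v)) (at r within reg)" for r
      unfolding err_def lin_def
      by (intro has_derivative_diff has_derivative_at_withinI[OF C1_on_has_derivative[OF F_C1(1)[OF g]]]
          has_derivative_at_withinI[OF henon_skew_has_derivative])
  qed (rule Df_minus_lin_bound(1)[OF g])
qed

lemma hyp_lin_Df:
  assumes g: "g \<in> F" and p: "p \<in> reg" "g p \<in> reg"
  shows "hyp_lin (Df g p)"
  unfolding hyp_lin_def
proof (intro conjI exI allI)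
  show "linear (Df g p)" using C1_on_has_derivative[OF F_C1(1)[OF g]] by (rule has_derivative_linear)
  show "517/1000 \<le> \<bar>p $ 1\<bar>" by (rule x_bounds(1)[OF F_near[OF g] p])
  show "norm (Df g p v - lin (p $ 1) v) \<le> tol * norm v" for v by (rule Df_minus_lin_bound(2)[OF g p(1)])
qed

end

section \<open>Hyperbolicity of the maximal invariant set\<close>

lemma int_iterate_add1:
  assumes "bij g" shows "int_iterate g (k + 1) p = g (int_iterate g k p)"
proof -
  have gi: "g (inv g x) = x" for x using assms by (simp add: bij_is_surj surj_f_inv_f)
  consider "0 \<le> k" | "k = -1" | "k < -1" by linarith
  then show ?thesis
  proof cases
    case 1
    then have "nat (k + 1) = Suc (nat k)" by simp
    then show ?thesis using 1 by (simp add: int_iterate_def)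
  next
    case 2
    then show ?thesis by (simp add: int_iterate_def gi)
  next
    case 3
    then have "nat (- k) = Suc (nat (- (k + 1)))" by simp
    then show ?thesis using 3 by (simp add: int_iterate_def gi)
  qed
qed

lemma int_iterate_0 [simp]: "int_iterate g 0 p = p"
  by (simp add: int_iterate_def)

lemma int_iterate_unique:
  assumes "bij g" and P: "\<And>k. P (k + 1) = g (P k)"
  shows "P k = int_iterate g k (P 0)"
proof (induction k rule: int_induct[of _ 0])
  case base
  then show ?case by simp
next
  case (step1 i)
  then show ?case using P[of i] int_iterate_add1[OF assms(1), of i] by simp
next
  case (step2 i)
  have "g (P (i - 1)) = g (int_iterate g (i - 1) (P 0))"
    using step2 P[of "i - 1"] int_iterate_add1[OF assms(1), of "i - 1"] by simp
  then show ?case using assms(1) by (simp add: bij_is_inj inj_eq)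
qed

lemma int_iterate_add:
  assumes "bij g" shows "int_iterate g (k + m) p = int_iterate g k (int_iterate g m p)"
proof -
  have "int_iterate g (k + m) p = int_iterate g k (int_iterate g (0 + m) p)"
    by (rule int_iterate_unique[OF assms, where P = "\<lambda>k. int_iterate g (k + m) p"])
      (metis int_iterate_add1[OF assms] add.assoc add.commute)
  then show ?thesis by simp
qed

lemma int_iterate_shift:
  assumes "bij g" shows "int_iterate g k (g p) = int_iterate g (k + 1) p"
  using int_iterate_add[OF assms, of k 1 p] int_iterate_add1[OF assms, of 0 p] by simp

lemma int_iterate_minus1: "int_iterate g (-1) p = inv g p"
  by (simp add: int_iterate_def)

lemma continuous_on_funpow:
  fixes g :: "'a::topological_space \<Rightarrow> 'a"
  assumes "continuous_on UNIV g" shows "continuous_on UNIV (g ^^ n)"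
proof (induction n)
  case (Suc n)
  then show ?case unfolding funpow.simps using assms continuous_on_compose continuous_on_subset by blast
qed (simp add: continuous_on_id id_def[symmetric])

lemma continuous_on_int_iterate:
  fixes g :: "'a::topological_space \<Rightarrow> 'a"
  assumes "continuous_on UNIV g" "continuous_on UNIV (inv g)" shows "continuous_on UNIV (int_iterate g k)"
  unfolding int_iterate_def using assms by (cases "0 \<le> k") (auto intro: continuous_on_funpow)

text \<open>Coinduction over the set of constants, which directional derivatives preserve. It
  applies to the coefficients of \<open>weighted_metric\<close>, which do not depend on the base
  point.\<close>

lemma smooth_const: "smooth (\<lambda>_. c)"
proof -
  have "\<exists>c. \<phi> = (\<lambda>_. c) \<Longrightarrow> smooth \<phi>" for \<phi> :: "'a \<Rightarrow> real"
    by (coinduction arbitrary: \<phi>) (auto simp: frechet_derivative_const)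
  then show ?thesis by blast
qed

lemma inj_Df:
  assumes "C1_diffeo g" shows "Df (inv g) (g p) (Df g p v) = v"
proof -
  have C: "C1_on UNIV g" "C1_on UNIV (inv g)" "bij g" using assms by (auto simp: C1_diffeo_def)
  have "(inv g \<circ> g has_derivative Df (inv g) (g p) \<circ> Df g p) (at p)"
    by (rule diff_chain_at[OF C1_on_has_derivative[OF C(1)] C1_on_has_derivative[OF C(2)]])
  moreover have "inv g \<circ> g = id" using C(3) by (simp add: bij_is_inj)
  ultimately have "Df (inv g) (g p) \<circ> Df g p = id"
    using has_derivative_unique has_derivative_id by metis
  then show ?thesis by (simp add: fun_eq_iff)
qed

lemma surj_Df:
  assumes "C1_diffeo g" shows "Df g p (Df (inv g) (g p) v) = v"
proof -
  have C: "C1_on UNIV g" "C1_on UNIV (inv g)" "bij g" using assms by (auto simp: C1_diffeo_def)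
  have p: "inv g (g p) = p" using C(3) by (simp add: bij_is_inj)
  have "(g \<circ> inv g has_derivative Df g p \<circ> Df (inv g) (g p)) (at (g p))"
    using diff_chain_at[OF C1_on_has_derivative[OF C(2), of "g p"] C1_on_has_derivative[OF C(1)]] unfolding p .
  moreover have "g \<circ> inv g = id" using C(3) by (simp add: fun_eq_iff bij_is_surj surj_f_inv_f)
  ultimately have "Df g p \<circ> Df (inv g) (g p) = id"
    using has_derivative_unique has_derivative_id by metis
  then show ?thesis by (simp add: fun_eq_iff)
qed

context params
begin

section \<open>The maximal invariant set and its invariant bundles\<close>

definition "Lam g = {p. \<forall>k. int_iterate g k p \<in> reg}"

lemma Lam_iterate: "bij g \<Longrightarrow> p \<in> Lam g \<Longrightarrow> g p \<in> Lam g"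
  by (simp add: Lam_def int_iterate_shift)

lemma Lam_inv:
  assumes "bij g" "p \<in> Lam g" shows "inv g p \<in> Lam g"
proof -
  have "int_iterate g k (inv g p) = int_iterate g (k - 1) p" for k
    using int_iterate_shift[OF assms(1), of "k - 1" "inv g p"] assms(1) by (simp add: bij_is_surj surj_f_inv_f)
  then show ?thesis using assms(2) by (simp add: Lam_def)
qed

lemma image_Lam: "bij g \<Longrightarrow> g ` Lam g = Lam g"
  using Lam_iterate Lam_inv by (force simp: image_iff bij_is_surj surj_f_inv_f)

lemma Lam_region: "p \<in> Lam g \<Longrightarrow> int_iterate g k p \<in> reg"
  by (simp add: Lam_def)

lemma compact_Lam:
  assumes "g \<in> F" shows "compact (Lam g)"
proof -
  have "closed (int_iterate g k -` reg)" for k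
    using continuous_on_int_iterate[OF C1_on_continuous[OF F_C1(1)[OF assms]] C1_on_continuous[OF F_C1(2)[OF assms]], of k]
      closed_region continuous_closed_vimage continuous_on_eq_continuous_at by (metis open_UNIV UNIV_I)
  then have "closed (\<Inter>k. int_iterate g k -` reg)" by (intro closed_INT) auto
  moreover have "Lam g = reg \<inter> (\<Inter>k. int_iterate g k -` reg)"
    using Lam_region[of _ g 0] by (auto simp: Lam_def)
  ultimately show ?thesis by (simp add: compact_Int_closed compact_region)
qed

lemma hyp_lin_orbit:
  assumes "g \<in> F" "p \<in> Lam g" shows "hyp_lin (Df g (int_iterate g k p))"
  using assms int_iterate_add1[OF F_C1(3)[OF assms(1)], of k p] Lam_region[OF assms(2), of "k+1"]
  by (intro hyp_lin_Df Lam_region) auto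

abbreviation "fwd_cocycle g p \<equiv> (\<lambda>k. Df g (int_iterate g (int k) p))"
abbreviation "bwd_cocycle g p \<equiv> (\<lambda>k. Df g (int_iterate g (- int k - 1) p))"

text \<open>Perron's description: stable vectors have a bounded future under the derivative,
  unstable ones a bounded past. Invariance then becomes a shift of sequences.\<close>

definition "Es g p = {V 0 |V. fwd (fwd_cocycle g p) V}"
definition "Eu g p = {V 0 |V. bwd (bwd_cocycle g p) V}"

lemma EsI: "fwd (fwd_cocycle g p) V \<Longrightarrow> V 0 = v \<Longrightarrow> v \<in> Es g p"
  unfolding Es_def by blast

lemma EuI: "bwd (bwd_cocycle g p) V \<Longrightarrow> V 0 = v \<Longrightarrow> v \<in> Eu g p"
  unfolding Eu_def by blast

lemma nrm_scale: "nrm (c *\<^sub>R v) = \<bar>c\<bar> * nrm v"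
  by (simp add: nrm_def abs_mult max_mult_distrib_left mult_ac)

lemma subspace_initial_values:
  fixes S :: "(nat \<Rightarrow> 'v::real_vector) set"
  assumes "(\<lambda>_. 0) \<in> S" "\<And>V W. V \<in> S \<Longrightarrow> W \<in> S \<Longrightarrow> (\<lambda>k. V k + W k) \<in> S"
    "\<And>V c. V \<in> S \<Longrightarrow> (\<lambda>k. c *\<^sub>R V k) \<in> S"
  shows "subspace {V 0 |V. V \<in> S}"
  using assms by (intro subspaceI; clarsimp) metis+

lemma bounded_add_scale:
  assumes "\<exists>B. \<forall>k. nrm (V k) \<le> B"
  shows "\<exists>B. \<forall>k. nrm (W k) \<le> B \<Longrightarrow> \<exists>B. \<forall>k. nrm (V k + W k) \<le> B" "\<exists>B. \<forall>k. nrm (c *\<^sub>R V k) \<le> B"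
proof -
  obtain B where B: "\<And>k. nrm (V k) \<le> B" using assms by blast
  show "\<exists>B. \<forall>k. nrm (c *\<^sub>R V k) \<le> B"
    using B by (intro exI[of _ "\<bar>c\<bar> * B"]) (simp add: nrm_scale mult_left_mono)
  assume "\<exists>B. \<forall>k. nrm (W k) \<le> B"
  then obtain C where "\<And>k. nrm (W k) \<le> C" by blast
  then show "\<exists>B. \<forall>k. nrm (V k + W k) \<le> B"
    using B by (intro exI[of _ "B + C"] allI order.trans[OF nrm_triangle] add_mono)
qed

lemma subspace_Es:
  assumes "g \<in> F" "p \<in> Lam g" shows "subspace (Es g p)"
proof -
  have l: "linear (Df g (int_iterate g k p))" for k using hyp_lin_orbit[OF assms] by (simp add: hyp_lin_def)
  have "subspace {V 0 |V. V \<in> Collect (fwd (fwd_cocycle g p))}"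
    by (rule subspace_initial_values)
      (auto simp: fwd_def linear_0[OF l] linear_add[OF l] linear_scale[OF l] intro: bounded_add_scale)
  then show ?thesis by (simp add: Es_def)
qed

lemma subspace_Eu:
  assumes "g \<in> F" "p \<in> Lam g" shows "subspace (Eu g p)"
proof -
  have l: "linear (Df g (int_iterate g k p))" for k using hyp_lin_orbit[OF assms] by (simp add: hyp_lin_def)
  have "subspace {V 0 |V. V \<in> Collect (bwd (bwd_cocycle g p))}"
  proof (rule subspace_initial_values, unfold mem_Collect_eq bwd_def linear_0[OF l] linear_add[OF l] linear_scale[OF l], goal_cases)
    case (2 V W)
    then show ?case using bounded_add_scale(1)[of V W] by (intro conjI allI arg_cong2[where f = "(+)"]) blast+
  next
    case (3 V c)
    then show ?case using bounded_add_scale(2)[of V c] by (intro conjI allI arg_cong[where f = "(*\<^sub>R) c"]) blast+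
  qed auto
  then show ?thesis by (simp add: Eu_def)
qed

text \<open>Dropping the first vector gives one inclusion; for the other, the preimage of w under
  the derivative is put in front, supplied by the derivative of the inverse.\<close>

lemma Df_image_Es:
  assumes g: "g \<in> F" and p: "p \<in> Lam g" shows "Df g p ` Es g p = Es g (g p)"
proof -
  have b: "bij g" and d: "C1_diffeo g" using g by (auto simp: F_def C1_diffeo_def)
  have sh: "int_iterate g (int k) (g p) = int_iterate g (int (Suc k)) p" for k
    using int_iterate_shift[OF b, of "int k" p] by (simp add: add.commute)
  have "Df g p v \<in> Es g (g p)" if "v \<in> Es g p" for v
  proof -
    obtain V where V: "fwd (fwd_cocycle g p) V" "V 0 = v" using \<open>v \<in> Es g p\<close> unfolding Es_def by blast
    then have "fwd (fwd_cocycle g (g p)) (\<lambda>k. V (Suc k))" unfolding fwd_def sh by blast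
    moreover have "V (Suc 0) = Df g p v" using V unfolding fwd_def by (metis int_iterate_0 of_nat_0)
    ultimately show ?thesis by (rule EsI)
  qed
  moreover have "w \<in> Df g p ` Es g p" if w: "w \<in> Es g (g p)" for w
  proof -
    obtain W B where W: "\<And>k. W (Suc k) = Df g (int_iterate g (int (Suc k)) p) (W k)" "\<And>k. nrm (W k) \<le> B" "W 0 = w"
      using w unfolding Es_def fwd_def sh by blast
    define v where "v = Df (inv g) (g p) w"
    define V where "V k = (case k of 0 \<Rightarrow> v | Suc k \<Rightarrow> W k)" for k
    have v: "Df g p v = w" unfolding v_def by (rule surj_Df[OF d])
    have "V (Suc k) = Df g (int_iterate g (int k) p) (V k)" for k
      using W(1,3) v by (cases k) (auto simp: V_def)
    moreover have "nrm (V k) \<le> max B (nrm v)" for k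
      using W(2) by (cases k) (auto simp: V_def le_max_iff_disj)
    ultimately have "fwd (fwd_cocycle g p) V" unfolding fwd_def by blast
    then have "v \<in> Es g p" by (rule EsI) (simp add: V_def)
    then show ?thesis using v by blast
  qed
  ultimately show ?thesis by blast
qed

lemma Df_image_Eu:
  assumes g: "g \<in> F" and p: "p \<in> Lam g" shows "Df g p ` Eu g p = Eu g (g p)"
proof -
  have b: "bij g" using g by (auto simp: F_def C1_diffeo_def)
  have sh: "int_iterate g (- int k - 1) (g p) = int_iterate g (- int k) p" for k
    using int_iterate_shift[OF b, of "- int k - 1" p] by simp
  have "Df g p v \<in> Eu g (g p)" if "v \<in> Eu g p" for v
  proof -
    obtain V B where V: "\<And>k. V k = Df g (int_iterate g (- int k - 1) p) (V (Suc k))" "\<And>k. nrm (V k) \<le> B" "V 0 = v"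
      using \<open>v \<in> Eu g p\<close> unfolding Eu_def bwd_def by blast
    define W where "W k = (case k of 0 \<Rightarrow> Df g p v | Suc k \<Rightarrow> V k)" for k
    have "W k = Df g (int_iterate g (- int k) p) (W (Suc k))" for k
    proof (cases k)
      case (Suc j)
      have e: "- int (Suc j) = - int j - 1" by simp
      show ?thesis unfolding W_def Suc nat.case e by (rule V(1))
    qed (simp add: W_def V(3))
    moreover have "nrm (W k) \<le> max B (nrm (Df g p v))" for k
      using V(2) by (cases k) (auto simp: W_def le_max_iff_disj)
    ultimately have "bwd (bwd_cocycle g (g p)) W" unfolding bwd_def sh by blast
    then show ?thesis by (rule EuI) (simp add: W_def)
  qed
  moreover have "w \<in> Df g p ` Eu g p" if w: "w \<in> Eu g (g p)" for w
  proof -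
    obtain W B where W: "\<And>k. W k = Df g (int_iterate g (- int k) p) (W (Suc k))" "\<And>k. nrm (W k) \<le> B" "W 0 = w"
      using w unfolding Eu_def bwd_def sh by blast
    have "- int (Suc k) = - int k - 1" for k by simp
    then have "bwd (bwd_cocycle g p) (\<lambda>k. W (Suc k))"
      unfolding bwd_def using W(1)[of "Suc k" for k] W(2) by metis
    then have "W (Suc 0) \<in> Eu g p" by (rule EuI) simp
    moreover have "w = Df g p (W (Suc 0))" using W(1)[of 0] W(3) by simp
    ultimately show ?thesis by blast
  qed
  ultimately show ?thesis by blast
qed


lemma EsE:
  assumes "v \<in> Es g p" obtains V where "fwd (fwd_cocycle g p) V" "V 0 = v"
  using assms unfolding Es_def by blast

lemma EuE:
  assumes "v \<in> Eu g p" obtains V where "bwd (bwd_cocycle g p) V" "V 0 = v"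
  using assms unfolding Eu_def by blast

lemma Es_bound:
  assumes "g \<in> F" "p \<in> Lam g" "v \<in> Es g p"
  shows "nrm v \<le> \<bar>v $ 2\<bar> / 2" "\<bar>v $ 1\<bar> \<le> rate * (\<bar>v $ 2\<bar> / 2)" "wt * \<bar>v $ 3\<bar> \<le> rate * (\<bar>v $ 2\<bar> / 2)"
proof -
  obtain V where V: "fwd (fwd_cocycle g p) V" "V 0 = v" by (rule EsE[OF assms(3)])
  note A = hyp_lin_orbit[OF assms(1,2)]
  have b: "nrm (V k) \<le> \<bar>v $ 2\<bar> / 2" for k using fwd_bound[OF A V(1), of k] V(2) by simp
  then show "nrm v \<le> \<bar>v $ 2\<bar> / 2" using V(2) by metis
  have eq: "V (Suc 0) = Df g (int_iterate g (int 0) p) (V 0)" using V(1) unfolding fwd_def by blast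
  have "\<bar>V 0 $ 1\<bar> \<le> rate * (\<bar>v $ 2\<bar> / 2) + 0"
    by (rule lin_step_x(2)[where A = "Df g (int_iterate g (int 0) p)" and u = "V 0" and u' = "V (Suc 0)", OF A _ _ b b]) (auto simp: eq)
  moreover have "wt * \<bar>V 0 $ 3\<bar> \<le> rate * (\<bar>v $ 2\<bar> / 2) + 0"
    by (rule lin_step_z[where A = "Df g (int_iterate g (int 0) p)" and u = "V 0" and u' = "V (Suc 0)", OF A _ _ b b]) (auto simp: eq)
  ultimately show "\<bar>v $ 1\<bar> \<le> rate * (\<bar>v $ 2\<bar> / 2)" "wt * \<bar>v $ 3\<bar> \<le> rate * (\<bar>v $ 2\<bar> / 2)" using V(2) by auto
qed

lemma Eu_bound:
  assumes "g \<in> F" "p \<in> Lam g" "v \<in> Eu g p"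
  shows "nrm v \<le> max \<bar>v $ 1\<bar> (wt * \<bar>v $ 3\<bar>)"
proof -
  obtain V where V: "bwd (bwd_cocycle g p) V" "V 0 = v" by (rule EuE[OF assms(3)])
  show ?thesis using bwd_bound[OF hyp_lin_orbit[OF assms(1,2)] V(1), of 0] V(2) by simp
qed

text \<open>Unstable vectors are dominated by x and z, and for stable vectors these are at most
  \<open>rate\<close> times |y|/2 in weighted form; together |y| <= \<open>rate\<close> |y|.\<close>

lemma Es_Int_Eu:
  assumes "g \<in> F" "p \<in> Lam g" shows "Eu g p \<inter> Es g p = {0}"
proof -
  have "v = 0" if v: "v \<in> Es g p" "v \<in> Eu g p" for v
  proof -
    have "nrm v \<le> rate * (\<bar>v $ 2\<bar> / 2)"
      using Eu_bound[OF assms v(2)] Es_bound(2,3)[OF assms v(1)] by simp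
    then have "(1 - rate) * \<bar>v $ 2\<bar> \<le> 0" unfolding nrm_le_iff by (simp add: algebra_simps)
    then have "\<bar>v $ 2\<bar> \<le> 0" using rate by (simp add: mult_le_0_iff)
    then show ?thesis using Es_bound(1)[OF assms v(1)] nrm_eq_0[of v] by simp
  qed
  then show ?thesis using subspace_0[OF subspace_Es[OF assms]] subspace_0[OF subspace_Eu[OF assms]] by blast
qed

section \<open>Continuous frames\<close>

text \<open>The frames are normalised by their free data: the stable line is a graph over the
  y-axis, the unstable plane one over the xz-plane, so these values determine the vectors.\<close>

definition "fs g p = (SOME v. v \<in> Es g p \<and> v $ 2 = 1)"
definition "fu g p i = (SOME v. v \<in> Eu g p \<and> v $ 1 = (if i = (0::nat) then 1 else 0) \<and> v $ 3 = (if i = 0 then 0 else 1))"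

lemma fs:
  assumes "g \<in> F" "p \<in> Lam g" shows "fs g p \<in> Es g p" "fs g p $ 2 = 1"
proof -
  obtain V where "fwd (fwd_cocycle g p) V" "V 0 $ 2 = 1"
    by (rule exists_fwd[OF hyp_lin_orbit[OF assms]])
  then have "\<exists>v. v \<in> Es g p \<and> v $ 2 = 1" using EsI by blast
  then have "fs g p \<in> Es g p \<and> fs g p $ 2 = 1" unfolding fs_def by (rule someI_ex)
  then show "fs g p \<in> Es g p" "fs g p $ 2 = 1" by auto
qed

lemma fu:
  assumes "g \<in> F" "p \<in> Lam g"
  shows "fu g p i \<in> Eu g p" "fu g p i $ 1 = (if i = 0 then 1 else 0)" "fu g p i $ 3 = (if i = 0 then 0 else 1)"
proof -
  obtain V where "bwd (bwd_cocycle g p) V" "V 0 $ 1 = (if i = 0 then 1 else 0)" "V 0 $ 3 = (if i = 0 then 0 else 1)"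
    by (rule exists_bwd[OF hyp_lin_orbit[OF assms]])
  then have "\<exists>v. v \<in> Eu g p \<and> v $ 1 = (if i = 0 then 1 else 0) \<and> v $ 3 = (if i = 0 then 0 else 1)" using EuI by blast
  then have "fu g p i \<in> Eu g p \<and> fu g p i $ 1 = (if i = 0 then 1 else 0) \<and> fu g p i $ 3 = (if i = 0 then 0 else 1)"
    unfolding fu_def by (rule someI_ex)
  then show "fu g p i \<in> Eu g p" "fu g p i $ 1 = (if i = 0 then 1 else 0)" "fu g p i $ 3 = (if i = 0 then 0 else 1)" by auto
qed

lemma span_Es:
  assumes "g \<in> F" "p \<in> Lam g" shows "span {fs g p} = Es g p" "dim (Es g p) = 1"
proof -
  note S = subspace_Es[OF assms] and f = fs[OF assms]
  have "v \<in> span {fs g p}" if v: "v \<in> Es g p" for v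
  proof -
    have "v - v $ 2 *\<^sub>R fs g p \<in> Es g p" by (intro subspace_diff subspace_scale S v f(1))
    from Es_bound(1)[OF assms this] have "v = v $ 2 *\<^sub>R fs g p" using nrm_eq_0[of "v - v $ 2 *\<^sub>R fs g p"] f(2) by simp
    then show ?thesis by (metis span_base span_scale singletonI)
  qed
  moreover have "span {fs g p} \<subseteq> Es g p" by (rule span_minimal) (use S f(1) in auto)
  ultimately show eq: "span {fs g p} = Es g p" by blast
  have "fs g p \<noteq> 0" using f(2) by auto
  then show "dim (Es g p) = 1" unfolding eq[symmetric] by simp
qed

lemma span_Eu:
  assumes "g \<in> F" "p \<in> Lam g" shows "span {fu g p 0, fu g p 1} = Eu g p" "dim (Eu g p) = 2"
proof -
  note S = subspace_Eu[OF assms] and f = fu[OF assms]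
  have "v \<in> span {fu g p 0, fu g p 1}" if v: "v \<in> Eu g p" for v
  proof -
    have "v - (v $ 1 *\<^sub>R fu g p 0 + v $ 3 *\<^sub>R fu g p 1) \<in> Eu g p" by (intro subspace_diff subspace_add subspace_scale S v f(1))
    from Eu_bound[OF assms this] have "v = v $ 1 *\<^sub>R fu g p 0 + v $ 3 *\<^sub>R fu g p 1"
      using nrm_eq_0[of "v - (v $ 1 *\<^sub>R fu g p 0 + v $ 3 *\<^sub>R fu g p 1)"] by (simp add: f(2,3))
    then show ?thesis by (metis span_add span_base span_scale insertI1 insertI2 singletonI)
  qed
  moreover have "span {fu g p 0, fu g p 1} \<subseteq> Eu g p" by (rule span_minimal) (use S f(1) in auto)
  ultimately show eq: "span {fu g p 0, fu g p 1} = Eu g p" by blast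
  have "fu g p 0 \<notin> span {fu g p 1}"
  proof
    assume "fu g p 0 \<in> span {fu g p 1}"
    then obtain c where "fu g p 0 = c *\<^sub>R fu g p 1" by (auto simp: span_singleton)
    then have "fu g p 0 $ 1 = c * fu g p 1 $ 1" by simp
    then show False by (simp add: f(2))
  qed
  moreover have "fu g p 1 \<noteq> 0" using f(3)[of 1] by auto
  ultimately have "independent {fu g p 0, fu g p 1}" "fu g p 0 \<noteq> fu g p 1"
    by (auto simp: independent_insert intro: span_base)
  then have "dim {fu g p 0, fu g p 1} = 2" by (simp add: dim_eq_card_independent)
  then show "dim (Eu g p) = 2" unfolding eq[symmetric] by simp
qed

lemma Eu_plus_Es:
  assumes "g \<in> F" "p \<in> Lam g" shows "{v + w |v w. v \<in> Eu g p \<and> w \<in> Es g p} = UNIV"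
proof -
  note S = subspace_Eu[OF assms] subspace_Es[OF assms]
  have "dim {v + w |v w. v \<in> Eu g p \<and> w \<in> Es g p} + dim (Eu g p \<inter> Es g p) = dim (Eu g p) + dim (Es g p)"
    by (rule dim_sums_Int[OF S])
  then have "dim {v + w |v w. v \<in> Eu g p \<and> w \<in> Es g p} = DIM(real ^ 3)"
    by (simp add: Es_Int_Eu[OF assms] span_Es(2)[OF assms] span_Eu(2)[OF assms])
  then have full: "span {v + w |v w. v \<in> Eu g p \<and> w \<in> Es g p} = UNIV" by (simp only: dim_eq_full)
  have "subspace {v + w |v w. v \<in> Eu g p \<and> w \<in> Es g p}" by (rule subspace_sums[OF S])
  then have "span {v + w |v w. v \<in> Eu g p \<and> w \<in> Es g p} = {v + w |v w. v \<in> Eu g p \<and> w \<in> Es g p}"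
    by (rule iffD2[OF span_eq_iff])
  then show ?thesis using full by (rule trans[OF sym])
qed

text \<open>For fixed n, continuity makes finitely many derivatives along nearby orbits
  \<tau>-close. C weighs the unseen rest of the orbit, D the sensitivity to \<tau>, and
  \<open>idx\<close> selects future or past.\<close>

lemma continuous_frame:
  fixes X :: "real ^ 3 \<Rightarrow> real ^ 3" and idx :: "nat \<Rightarrow> int"
  assumes g: "g \<in> F" and C: "0 \<le> C" "0 \<le> D"
    and X: "\<And>p q n \<tau>. p \<in> Lam g \<Longrightarrow> q \<in> Lam g \<Longrightarrow> 0 \<le> \<tau> \<Longrightarrow>
      (\<And>k. k \<le> n \<Longrightarrow> norm (DB g (int_iterate g (idx k) q) - DB g (int_iterate g (idx k) p)) \<le> \<tau>) \<Longrightarrow>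
      nrm (X q - X p) \<le> rate ^ (n + 1) * C + \<tau> * D"
  shows "continuous_on (Lam g) X"
  unfolding continuous_on_eq_continuous_within continuous_within tendsto_iff
proof (intro ballI allI impI)
  fix p and e :: real assume p: "p \<in> Lam g" and e: "0 < e"
  define e' where "e' = e / (2 * nrmC)"
  have e': "0 < e'" using e nrmC by (simp add: e'_def)
  have "(\<lambda>n. rate ^ n * C) \<longlonglongrightarrow> 0 * C"
    using rate by (intro tendsto_intros LIMSEQ_realpow_zero) auto
  then have "\<forall>\<^sub>F n in sequentially. rate ^ n * C < e'" using order_tendstoD(2)[of _ 0 _ e'] e' by simp
  then obtain N where N: "\<And>n. N \<le> n \<Longrightarrow> rate ^ n * C < e'" by (auto simp: eventually_sequentially)
  have n: "rate ^ (N + 1) * C < e'" by (rule N) simp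
  define \<tau> where "\<tau> = e' / (D + 1)"
  have \<tau>: "0 < \<tau>" "\<tau> * D \<le> e'" using e' C by (auto simp: \<tau>_def field_simps)
  have "\<forall>\<^sub>F q in at p within Lam g. \<forall>k\<in>{..N}. norm (DB g (int_iterate g (idx k) q) - DB g (int_iterate g (idx k) p)) < \<tau>"
  proof (rule eventually_ball_finite)
    show "\<forall>k\<in>{..N}. \<forall>\<^sub>F q in at p within Lam g. norm (DB g (int_iterate g (idx k) q) - DB g (int_iterate g (idx k) p)) < \<tau>"
    proof
      fix k
      have "continuous_on UNIV (\<lambda>q. DB g (int_iterate g (idx k) q))"
        using continuous_on_int_iterate[OF C1_on_continuous[OF F_C1(1)[OF g]] C1_on_continuous[OF F_C1(2)[OF g]]]
        by (intro continuous_on_compose2[OF continuous_on_DB[OF F_C1(1)[OF g]]]) auto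
      then have "((\<lambda>q. DB g (int_iterate g (idx k) q)) \<longlongrightarrow> DB g (int_iterate g (idx k) p)) (at p within Lam g)"
        by (meson UNIV_I continuous_on_def subset_UNIV tendsto_within_subset)
      then show "\<forall>\<^sub>F q in at p within Lam g. norm (DB g (int_iterate g (idx k) q) - DB g (int_iterate g (idx k) p)) < \<tau>"
        using \<tau>(1) by (simp add: tendsto_iff dist_norm)
    qed
  qed simp
  moreover have "\<forall>\<^sub>F q in at p within Lam g. q \<in> Lam g" by (simp add: eventually_at_filter)
  ultimately show "\<forall>\<^sub>F q in at p within Lam g. dist (X q) (X p) < e"
  proof eventually_elim
    case (elim q)
    have "nrm (X q - X p) \<le> rate ^ (N + 1) * C + \<tau> * D"
      by (rule X[OF p elim(2)]) (use elim(1) \<tau> in \<open>auto intro: less_imp_le\<close>)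
    then have "nrm (X q - X p) < 2 * e'" using n \<tau>(2) by linarith
    then have "nrmC * nrm (X q - X p) < nrmC * (2 * e')" using nrmC by (intro mult_strict_left_mono) auto
    also have "\<dots> = e" using nrmC(1) by (simp add: e'_def)
    finally show ?case using norm_le_nrm[of "X q - X p"] by (simp add: dist_norm)
  qed
qed

lemma Df_diff_le:
  assumes "g \<in> F" "norm (DB g r - DB g r') \<le> \<tau>" shows "norm (Df g r v - Df g r' v) \<le> \<tau> * norm v"
proof -
  have "norm ((DB g r - DB g r') v) \<le> norm (DB g r - DB g r') * norm v" by (rule norm_blinfun)
  also have "\<dots> \<le> \<tau> * norm v" using assms by (intro mult_right_mono) auto
  finally show ?thesis by (simp add: minus_blinfun.rep_eq DB_apply[OF F_C1(1)[OF assms(1)]])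
qed

lemma continuous_fs:
  assumes g: "g \<in> F" shows "continuous_on (Lam g) (fs g)"
proof (rule continuous_frame[OF g, where idx = int])
  show "0 \<le> (1::real)" "0 \<le> nrmC * (1 / 2) / (1 - rate)" using nrmC rate by auto
  fix p q n \<tau> assume p: "p \<in> Lam g" and q: "q \<in> Lam g" and \<tau>: "0 \<le> \<tau>"
    and d: "\<And>k. k \<le> n \<Longrightarrow> norm (DB g (int_iterate g (int k) q) - DB g (int_iterate g (int k) p)) \<le> \<tau>"
  obtain V where V: "fwd (fwd_cocycle g q) V" "V 0 = fs g q" by (rule EsE[OF fs(1)[OF g q]])
  obtain W where W: "fwd (fwd_cocycle g p) W" "W 0 = fs g p" by (rule EsE[OF fs(1)[OF g p]])
  have "nrm (V 0 - W 0) \<le> rate ^ (n + 1) * (2 * (1 / 2)) + \<tau> * (nrmC * (1 / 2)) / (1 - rate)"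
    by (rule fwd_compare[OF hyp_lin_orbit[OF g q] V(1) _ W(1) _ _ \<tau>])
      (use fwd_bound[OF hyp_lin_orbit[OF g q] V(1)] fwd_bound[OF hyp_lin_orbit[OF g p] W(1)] V(2) W(2) fs(2)[OF g] p q
        Df_diff_le[OF g d] in simp_all)
  then show "nrm (fs g q - fs g p) \<le> rate ^ (n + 1) * 1 + \<tau> * (nrmC * (1 / 2) / (1 - rate))" using V(2) W(2) by simp
qed

lemma continuous_fu:
  assumes g: "g \<in> F" shows "continuous_on (Lam g) (\<lambda>p. fu g p i)"
proof (rule continuous_frame[OF g, where idx = "\<lambda>k. - int k - 1"])
  show "0 \<le> (2::real)" "0 \<le> nrmC * 1 / (1 - rate)" using nrmC rate by auto
  fix p q n \<tau> assume p: "p \<in> Lam g" and q: "q \<in> Lam g" and \<tau>: "0 \<le> \<tau>"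
    and d: "\<And>k. k \<le> n \<Longrightarrow> norm (DB g (int_iterate g (- int k - 1) q) - DB g (int_iterate g (- int k - 1) p)) \<le> \<tau>"
  obtain V where V: "bwd (bwd_cocycle g q) V" "V 0 = fu g q i" by (rule EuE[OF fu(1)[OF g q]])
  obtain W where W: "bwd (bwd_cocycle g p) W" "W 0 = fu g p i" by (rule EuE[OF fu(1)[OF g p]])
  have m: "max \<bar>fu g r i $ 1\<bar> (wt * \<bar>fu g r i $ 3\<bar>) \<le> 1" if "r \<in> Lam g" for r
    using wt by (simp add: fu(2,3)[OF g that])
  have "nrm (V 0 - W 0) \<le> rate ^ (n + 1) * (2 * 1) + \<tau> * (nrmC * 1) / (1 - rate)"
  proof (rule bwd_compare[OF hyp_lin_orbit[OF g q] V(1) _ W(1) _ _ _ \<tau>])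
    show "nrm (V k) \<le> 1" for k using bwd_bound[OF hyp_lin_orbit[OF g q] V(1), of k] m[OF q] unfolding V(2) by linarith
    show "nrm (W k) \<le> 1" for k using bwd_bound[OF hyp_lin_orbit[OF g p] W(1), of k] m[OF p] unfolding W(2) by linarith
  qed (use V(2) W(2) fu(2,3)[OF g] p q Df_diff_le[OF g d] in simp_all)
  then show "nrm (fu g q i - fu g p i) \<le> rate ^ (n + 1) * 2 + \<tau> * (nrmC * 1 / (1 - rate))" using V(2) W(2) by simp
qed

lemma continuous_subbundle_Es:
  assumes g: "g \<in> F" shows "continuous_subbundle (Lam g) (Es g)"
proof -
  have "span ((\<lambda>i. fs g q) ` {..<1::nat}) = Es g q" if "q \<in> Lam g" for q
  proof -
    have "(\<lambda>i. fs g q) ` {..<1::nat} = {fs g q}" by auto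
    then show ?thesis using span_Es(1)[OF g that] by (simp only:)
  qed
  then show ?thesis
    unfolding continuous_subbundle_def using subspace_Es[OF g] span_Es(2)[OF g] continuous_fs[OF g]
    by (intro conjI ballI exI[of _ UNIV] exI[of _ "\<lambda>_. fs g"]) auto
qed

lemma continuous_subbundle_Eu:
  assumes g: "g \<in> F" shows "continuous_subbundle (Lam g) (Eu g)"
proof -
  have "span ((\<lambda>i. fu g q i) ` {..<2}) = Eu g q" if "q \<in> Lam g" for q
  proof -
    have "{..<2} = {0, 1::nat}" by auto
    then have "(\<lambda>i. fu g q i) ` {..<2} = {fu g q 0, fu g q 1}" by (simp only: image_insert image_empty)
    then show ?thesis using span_Eu(1)[OF g that] by (simp only:)
  qed
  then show ?thesis
    unfolding continuous_subbundle_def using subspace_Eu[OF g] span_Eu(2)[OF g] continuous_fu[OF g]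
    by (intro conjI ballI exI[of _ UNIV] exI[of _ "\<lambda>i p. fu g p i"]) auto
qed

section \<open>The adapted metric and hyperbolicity\<close>

definition "weighted_metric = (\<lambda>(p :: real ^ 3) (v :: real ^ 3) (w :: real ^ 3). v $ 1 * w $ 1 + v $ 2 * w $ 2 + wt\<^sup>2 * (v $ 3 * w $ 3))"

lemma riemannian_metric_weighted: "riemannian_metric weighted_metric"
  unfolding riemannian_metric_def weighted_metric_def
proof (intro conjI allI impI)
  show "bilinear (\<lambda>v w :: real ^ 3. v $ 1 * w $ 1 + v $ 2 * w $ 2 + wt\<^sup>2 * (v $ 3 * w $ 3))"
    unfolding bilinear_def by (auto intro!: linearI simp: algebra_simps)
  fix v :: "real ^ 3" assume "v \<noteq> 0"
  then have "v $ 1 \<noteq> 0 \<or> v $ 2 \<noteq> 0 \<or> v $ 3 \<noteq> 0" by (simp add: vec_eq_iff forall_3)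
  then have "v $ 1 * v $ 1 > 0 \<or> v $ 2 * v $ 2 > 0 \<or> wt\<^sup>2 * (v $ 3 * v $ 3) > 0" using wt by (auto simp: zero_less_mult_iff linorder_neq_iff)
  moreover have "0 \<le> v $ 1 * v $ 1" "0 \<le> v $ 2 * v $ 2" "0 \<le> wt\<^sup>2 * (v $ 3 * v $ 3)" by auto
  ultimately show "0 < v $ 1 * v $ 1 + v $ 2 * v $ 2 + wt\<^sup>2 * (v $ 3 * v $ 3)" by linarith
qed (auto simp: smooth_const algebra_simps)

lemma riemannian_norm_weighted: "riemannian_norm weighted_metric p v = sqrt (quad v)"
  by (simp add: riemannian_norm_def weighted_metric_def quad_def power2_eq_square mult_ac)

lemma quad_pos: "v \<noteq> 0 \<Longrightarrow> 0 < quad v"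
  using riemannian_metric_weighted unfolding riemannian_metric_def weighted_metric_def quad_def
  by (simp add: power2_eq_square mult_ac)

lemma hyperbolic_splitting_Lam:
  assumes g: "g \<in> F" shows "hyperbolic_splitting g (Lam g) (Eu g) (Es g)"
proof -
  have b: "bij g" and d: "C1_diffeo g" using g by (auto simp: F_def C1_diffeo_def)
  define q where "q = 1 / sqrt \<xi>"
  \<comment> \<open>The unstable rate q = 1 / sqrt \<xi> is not strict. The midpoint of q and 1
    makes it strict for nonzero vectors and, being above 1/2, also covers the stable
    direction.\<close>
  define \<kappa> where "\<kappa> = (1 + q) / 2"
  have "0 < q" "q < 1" using xi by (auto simp: q_def)
  then have \<kappa>: "q < \<kappa>" "\<kappa> < 1" "1 / 2 < \<kappa>" by (auto simp: \<kappa>_def)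
  have s_rate: "riemannian_norm weighted_metric (g p) (Df g p v) < \<kappa> * riemannian_norm weighted_metric p v"
    if p: "p \<in> Lam g" and v: "v \<in> Es g p" "v \<noteq> 0" for p v
  proof -
    obtain V where V: "fwd (fwd_cocycle g p) V" "V 0 = v" by (rule EsE[OF v(1)])
    have "V 1 = Df g p v" using V unfolding fwd_def by (metis int_iterate_0 of_nat_0 One_nat_def)
    then have "quad (Df g p v) \<le> 1/10 * quad v" using fwd_rate[OF hyp_lin_orbit[OF g p] V(1)] V(2) by simp
    also have "\<dots> \<le> (1 / 2)\<^sup>2 * quad v" using quad_pos[OF v(2)] by (simp add: power2_eq_square)
    finally have "sqrt (quad (Df g p v)) \<le> sqrt ((1 / 2)\<^sup>2 * quad v)" by (rule real_sqrt_le_mono)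
    also have "\<dots> = 1 / 2 * sqrt (quad v)" by (simp add: real_sqrt_mult real_sqrt_divide)
    also have "\<dots> < \<kappa> * sqrt (quad v)" using \<kappa> quad_pos[OF v(2)] by (intro mult_strict_right_mono) auto
    finally show ?thesis by (simp add: riemannian_norm_weighted)
  qed
  have u_rate: "riemannian_norm weighted_metric (inv g p) (Df (inv g) p v) < \<kappa> * riemannian_norm weighted_metric p v"
    if p: "p \<in> Lam g" and v: "v \<in> Eu g p" "v \<noteq> 0" for p v
  proof -
    obtain V where V: "bwd (bwd_cocycle g p) V" "V 0 = v" by (rule EuE[OF v(1)])
    have p': "g (inv g p) = p" using b by (simp add: bij_is_surj surj_f_inv_f)
    have "V 0 = Df g (int_iterate g (- int 0 - 1) p) (V (Suc 0))" using V(1) unfolding bwd_def by blast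
    then have "v = Df g (inv g p) (V 1)" using V(2) int_iterate_minus1[of g p] by simp
    then have "Df (inv g) p v = V 1" using inj_Df[OF d, of "inv g p" "V 1"] p' by simp
    moreover have "quad (V 1) \<le> quad v / \<xi>" using bwd_rate[OF hyp_lin_orbit[OF g p] V(1)] V(2) xi by (simp add: field_simps)
    ultimately have "sqrt (quad (Df (inv g) p v)) \<le> sqrt (quad v / \<xi>)" by (simp add: real_sqrt_le_mono)
    also have "\<dots> = q * sqrt (quad v)" by (simp add: q_def real_sqrt_divide)
    also have "\<dots> < \<kappa> * sqrt (quad v)" using \<kappa> quad_pos[OF v(2)] by (intro mult_strict_right_mono) auto
    finally show ?thesis by (simp add: riemannian_norm_weighted)
  qed
  have "\<exists>G \<kappa>. riemannian_metric G \<and> \<kappa> < 1 \<and> (\<forall>p\<in>Lam g.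
      (\<forall>v\<in>Eu g p - {0}. riemannian_norm G (inv g p) (Df (inv g) p v) < \<kappa> * riemannian_norm G p v) \<and>
      (\<forall>v\<in>Es g p - {0}. riemannian_norm G (g p) (Df g p v) < \<kappa> * riemannian_norm G p v))"
    using riemannian_metric_weighted \<kappa>(2) s_rate u_rate by (intro exI[of _ weighted_metric] exI[of _ \<kappa>]) auto
  then show ?thesis
    unfolding hyperbolic_splitting_def
    using continuous_subbundle_Eu[OF g] continuous_subbundle_Es[OF g] Es_Int_Eu[OF g] Eu_plus_Es[OF g]
      Df_image_Es[OF g] Df_image_Eu[OF g] by simp
qed

lemma hyperbolic_set_Lam: "g \<in> F \<Longrightarrow> hyperbolic_set g (Lam g)"
  unfolding hyperbolic_set_def using compact_Lam image_Lam[OF F_C1(3)] hyperbolic_splitting_Lam by blast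

end

section \<open>Continuation, transitivity and the blender\<close>

lemma int_iterate_of_nat: "int_iterate g (int n) p = (g ^^ n) p"
  by (simp add: int_iterate_def)

text \<open>Concatenation of all finite words in the enumeration \<open>from_nat\<close>; b k is the
  position where word k starts, and disjointness of the blocks gives s the intended values.\<close>

lemma universal_word:
  obtains s :: "nat \<Rightarrow> bool" where "\<And>(w :: nat \<Rightarrow> bool) N. \<exists>m. \<forall>i<N. s (m + i) = w i"
proof -
  define u where "u k = (from_nat k :: bool list)" for k
  define b where "b k = (\<Sum>j<k. length (u j))" for k
  define s where "s n \<longleftrightarrow> (\<exists>k i. n = b k + i \<and> i < length (u k) \<and> u k ! i)" for n
  have mono: "b k + length (u k) \<le> b l" if "k < l" for k l
  proof -
    have "b (Suc k) \<le> b l" unfolding b_def using that by (intro sum_mono2) auto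
    then show ?thesis by (simp add: b_def)
  qed
  have s: "s (b k + i) = u k ! i" if i: "i < length (u k)" for k i
  proof -
    have "k' = k" if "b k + i = b k' + i'" "i' < length (u k')" for k' i'
      using mono[of k k'] mono[of k' k] that i by (cases k k' rule: linorder_cases) auto
    then show ?thesis unfolding s_def using i by (metis add_left_cancel)
  qed
  have "\<exists>m. \<forall>i<N. s (m + i) = w i" for w :: "nat \<Rightarrow> bool" and N
  proof -
    obtain k where "u k = map w [0..<N]" unfolding u_def by (metis from_nat_to_nat)
    then have "\<forall>i<N. s (b k + i) = w i" using s[of _ k] by simp
    then show ?thesis by blast
  qed
  note m = this
  show thesis by (rule that) (rule m)
qed

definition "x_segment = {vector [t, 0, 0] :: real ^ 3 |t. \<bar>t\<bar> \<le> 1}"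

context params
begin

abbreviation "f0 \<equiv> henon_skew \<xi>"

section \<open>Coding of the invariant set by itineraries\<close>

definition "itin g p = (\<lambda>k. 0 < int_iterate g k p $ 1)"

lemma coded_itin:
  assumes "g \<in> F" "p \<in> Lam g" shows "coded g (itin g p) (\<lambda>k. int_iterate g k p)"
  unfolding coded_def using Lam_region[OF assms(2)] int_iterate_add1[OF F_C1(3)[OF assms(1)]] by (simp add: itin_def)

lemma coded_iterate:
  assumes "g \<in> F" "coded g s P" shows "P k = int_iterate g k (P 0)" "P 0 \<in> Lam g" "itin g (P 0) = s"
proof -
  show *: "P k = int_iterate g k (P 0)" for k
    by (rule int_iterate_unique[OF F_C1(3)[OF assms(1)]]) (use assms(2) in \<open>simp add: coded_def\<close>)
  have "int_iterate g k (P 0) \<in> reg" "0 < int_iterate g k (P 0) $ 1 \<longleftrightarrow> s k" for k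
    using assms(2) unfolding coded_def *[of k, symmetric] by blast+
  then show "P 0 \<in> Lam g" "itin g (P 0) = s" by (auto simp: Lam_def itin_def)
qed

definition "pt g s = (SOME P. coded g s P) 0"

lemma pt_coded:
  assumes "g \<in> F" shows "coded g s (\<lambda>k. int_iterate g k (pt g s))"
proof -
  have "\<exists>P. coded g s P" using exists_coded[OF F_near[OF assms]] by metis
  then have c: "coded g s (SOME P. coded g s P)" by (rule someI_ex)
  have "(SOME P. coded g s P) = (\<lambda>k. int_iterate g k (pt g s))"
    unfolding pt_def using coded_iterate(1)[OF assms c] by blast
  then show ?thesis using c by simp
qed

lemma pt_Lam: "g \<in> F \<Longrightarrow> pt g s \<in> Lam g"
  using coded_iterate(2)[OF _ pt_coded] by simp

lemma itin_pt: "g \<in> F \<Longrightarrow> itin g (pt g s) = s"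
  using coded_iterate(3)[OF _ pt_coded] by simp

lemma pt_eqI: "g \<in> F \<Longrightarrow> coded g s P \<Longrightarrow> pt g s = P 0"
  using coded_unique[OF F_near pt_coded, of g s P] by (metis int_iterate_0)

lemma pt_itin: "g \<in> F \<Longrightarrow> p \<in> Lam g \<Longrightarrow> pt g (itin g p) = p"
  using pt_eqI[OF _ coded_itin] by simp

lemma pt_compare:
  assumes g: "g \<in> F" "g' \<in> F" "\<And>r. r \<in> reg \<Longrightarrow> norm (g r - g' r) \<le> \<rho>" "0 \<le> \<rho>"
    and s: "\<And>k. \<bar>k\<bar> \<le> int n \<Longrightarrow> s k = s' k"
  shows "nrm (pt g s - pt g' s') \<le> rate ^ (n + 1) * 2 + \<rho> / (1 - rate)"
proof -
  have "nrm (int_iterate g 0 (pt g s) - int_iterate g' 0 (pt g' s')) \<le> rate ^ (n + 1) * 2 + \<rho> / (1 - rate)"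
    by (rule coded_compare[where P = "\<lambda>k. int_iterate g k (pt g s)" and Q = "\<lambda>k. int_iterate g' k (pt g' s')" and c = 0
          and s = s and s' = s', OF F_near[OF g(1)] F_near[OF g(2)] g(3,4) pt_coded[OF g(1)] pt_coded[OF g(2)]])
      (use s in auto)
  then show ?thesis by simp
qed

lemma itin_close:
  assumes e: "0 < e" obtains n :: nat where "\<And>g s s'. g \<in> F \<Longrightarrow> (\<And>k. \<bar>k\<bar> \<le> int n \<Longrightarrow> s k = s' k) \<Longrightarrow> dist (pt g s) (pt g s') < e"
proof -
  have "(\<lambda>n. nrmC * (rate ^ n * 2)) \<longlonglongrightarrow> nrmC * (0 * 2)"
    using rate by (intro tendsto_intros LIMSEQ_realpow_zero) auto
  then have "\<forall>\<^sub>F n in sequentially. nrmC * (rate ^ n * 2) < e" using order_tendstoD(2)[of _ 0 _ e] e by simp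
  then obtain N where N: "\<And>n. N \<le> n \<Longrightarrow> nrmC * (rate ^ n * 2) < e" by (auto simp: eventually_sequentially)
  have "dist (pt g s) (pt g s') < e" if g: "g \<in> F" and s: "\<And>k. \<bar>k\<bar> \<le> int N \<Longrightarrow> s k = s' k" for g s s'
  proof -
    have "nrm (pt g s - pt g s') \<le> rate ^ (N + 1) * 2 + 0 / (1 - rate)"
      by (rule pt_compare[OF g g _ _ s]) auto
    then have "nrmC * nrm (pt g s - pt g s') \<le> nrmC * (rate ^ (N + 1) * 2)" using nrmC by (intro mult_left_mono) auto
    moreover have "nrmC * (rate ^ (N + 1) * 2) < e" by (rule N) simp
    ultimately show ?thesis using norm_le_nrm[of "pt g s - pt g s'"] by (simp add: dist_norm)
  qed
  then show thesis using that by blast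
qed

text \<open>On the invariant set |x| is at least 0.517, so no sign changes under a small
  displacement; finitely many symbols are thus locally constant.\<close>

lemma eventually_itin:
  assumes g: "g \<in> F" and p: "p \<in> Lam g"
  shows "\<forall>\<^sub>F q in at p within Lam g. \<forall>k\<in>{-int n..int n}. itin g q k = itin g p k"
proof (rule eventually_ball_finite)
  show "\<forall>k\<in>{-int n..int n}. \<forall>\<^sub>F q in at p within Lam g. itin g q k = itin g p k"
  proof
    fix k
    have "continuous_on UNIV (int_iterate g k)"
      by (rule continuous_on_int_iterate[OF C1_on_continuous[OF F_C1(1)[OF g]] C1_on_continuous[OF F_C1(2)[OF g]]])
    then have "continuous_on UNIV (\<lambda>q. int_iterate g k q $ 1)" by (intro continuous_intros)
    then have lim: "((\<lambda>q. int_iterate g k q $ 1) \<longlongrightarrow> int_iterate g k p $ 1) (at p within Lam g)"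
      by (meson UNIV_I continuous_on_def subset_UNIV tendsto_within_subset)
    have "517/1000 \<le> \<bar>int_iterate g k p $ 1\<bar>"
      using x_bounds(1)[OF F_near[OF g] Lam_region[OF p, of k]] Lam_region[OF p, of "k+1"] int_iterate_add1[OF F_C1(3)[OF g]] by simp
    then consider "0 < int_iterate g k p $ 1" | "int_iterate g k p $ 1 < 0" by linarith
    then show "\<forall>\<^sub>F q in at p within Lam g. itin g q k = itin g p k"
    proof cases
      case 1
      then show ?thesis using order_tendstoD(1)[OF lim 1] by (auto simp: itin_def)
    next
      case 2
      then show ?thesis using order_tendstoD(2)[OF lim 2] by (auto simp: itin_def elim: eventually_mono)
    qed
  qed
qed simp

section \<open>The continuation\<close>

definition "h g x = pt g (itin f0 x)"

lemma h_image:
  assumes "g \<in> F" shows "h g ` Lam f0 = Lam g"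
proof (intro equalityI subsetI)
  fix p assume p: "p \<in> Lam g"
  have "h g (pt f0 (itin g p)) = p" by (simp add: h_def itin_pt henon_skew_in_F pt_itin assms p)
  then show "p \<in> h g ` Lam f0" using pt_Lam[OF henon_skew_in_F] by (metis imageI)
qed (auto simp: h_def pt_Lam assms)

lemma h_inj: "g \<in> F \<Longrightarrow> inj_on (h g) (Lam f0)"
  by (rule inj_onI) (metis h_def itin_pt pt_itin henon_skew_in_F)

lemma h_continuous:
  assumes g: "g \<in> F" shows "continuous_on (Lam f0) (h g)"
  unfolding continuous_on_eq_continuous_within continuous_within tendsto_iff
proof (intro ballI allI impI)
  fix p and e :: real assume p: "p \<in> Lam f0" and e: "0 < e"
  obtain n :: nat where n: "\<And>g s s'. g \<in> F \<Longrightarrow> (\<And>k. \<bar>k\<bar> \<le> int n \<Longrightarrow> s k = s' k) \<Longrightarrow> dist (pt g s) (pt g s') < e"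
    using itin_close[OF e] by blast
  show "\<forall>\<^sub>F q in at p within Lam f0. dist (h g q) (h g p) < e"
    using eventually_itin[OF henon_skew_in_F p, of n]
  proof eventually_elim
    case (elim q)
    show ?case unfolding h_def by (rule n[OF g]) (use elim in \<open>auto simp: abs_le_iff\<close>)
  qed
qed

lemma h_conjugacy:
  assumes g: "g \<in> F" and x: "x \<in> Lam f0" shows "h g (f0 x) = g (h g x)"
proof -
  note b = F_C1(3)[OF henon_skew_in_F]
  have "itin f0 (f0 x) = (\<lambda>k. itin f0 x (k + 1))" by (simp add: itin_def int_iterate_shift[OF b])
  moreover have "coded g (\<lambda>k. itin f0 x (k + 1)) (\<lambda>k. int_iterate g (k + 1) (h g x))"
    using pt_coded[OF g, of "itin f0 x"] unfolding coded_def h_def by blast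
  ultimately have "h g (f0 x) = int_iterate g (0 + 1) (h g x)" unfolding h_def[of g "f0 x"] using pt_eqI[OF g] by metis
  then show ?thesis using int_iterate_add1[OF F_C1(3)[OF g], of 0] by simp
qed

lemma h_stable:
  assumes g: "g \<in> F" and e: "0 < e"
  shows "\<exists>V. C1_open V \<and> g \<in> V \<and> (\<forall>g'\<in>V \<inter> F. \<forall>x\<in>Lam f0. dist (h g' x) (h g x) < e)"
proof -
  \<comment> \<open>Chosen so that the comparison bound \<open>nrmC * (\<tau> / (1 - rate))\<close>
    equals e / 2.\<close>
  define \<tau> where "\<tau> = e * (1 - rate) / (2 * nrmC)"
  have \<tau>: "0 < \<tau>" "nrmC * (\<tau> / (1 - rate)) < e" using e rate nrmC(1) by (auto simp: \<tau>_def)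
  have d: "C1_diffeo g" using g by (simp add: F_def)
  define V where "V = {g'. C1_diffeo g' \<and> C1_close (reg) \<tau> g g'}"
  have "dist (h g' x) (h g x) < e" if g': "g' \<in> V \<inter> F" for g' x
  proof -
    have "norm (g' r - g r) \<le> \<tau>" if "r \<in> reg" for r
      using g' that by (auto simp: V_def C1_close_def dist_norm norm_minus_commute intro: less_imp_le)
    then have "nrm (h g' x - h g x) \<le> rate ^ n * (rate * 2) + \<tau> / (1 - rate)" for n
      using pt_compare[of g' g \<tau> n "itin f0 x" "itin f0 x"] g g' \<tau> by (simp add: h_def mult_ac)
    then have "nrm (h g' x - h g x) \<le> \<tau> / (1 - rate)" by (rule geometric_bound_imp_le[rotated 2]) (use rate in auto)
    then have "nrmC * nrm (h g' x - h g x) \<le> nrmC * (\<tau> / (1 - rate))" using nrmC by (intro mult_left_mono) auto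
    then show ?thesis using norm_le_nrm[of "h g' x - h g x"] \<tau>(2) by (simp add: dist_norm)
  qed
  moreover have "C1_open V" unfolding V_def by (rule C1_open_C1_ball[OF d compact_region])
  moreover have "g \<in> V" using d C1_close_refl[OF \<tau>(1)] by (simp add: V_def)
  ultimately show ?thesis by blast
qed

lemma hyperbolic_continuation_h: "hyperbolic_continuation f0 (Lam f0) F h"
  unfolding hyperbolic_continuation_def
proof (intro conjI ballI allI impI)
  show "h f0 x = x" if "x \<in> Lam f0" for x using that by (simp add: h_def pt_itin henon_skew_in_F)
  fix g assume g: "g \<in> F"
  show "hyperbolic_set g (h g ` Lam f0)" using hyperbolic_set_Lam[OF g] by (simp add: h_image[OF g])
  show "\<exists>k. homeomorphism (Lam f0) (h g ` Lam f0) (h g) k"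
    using homeomorphism_compact[OF compact_Lam[OF henon_skew_in_F] h_continuous[OF g] refl h_inj[OF g]] by metis
qed (use C1_open_F henon_skew_in_F h_conjugacy h_stable in auto)

lemma transitive_Lam: "transitive_set f0 (Lam f0)"
proof -
  note F0 = henon_skew_in_F and b = F_C1(3)[OF henon_skew_in_F]
  obtain s :: "nat \<Rightarrow> bool" where s: "\<And>(w :: nat \<Rightarrow> bool) N. \<exists>m. \<forall>i<N. s (m + i) = w i" using universal_word by blast
  define x where "x = pt f0 (\<lambda>k. s (nat k))"
  have x: "x \<in> Lam f0" "itin f0 x = (\<lambda>k. s (nat k))" unfolding x_def using pt_Lam[OF F0] itin_pt[OF F0] by auto
  have it: "(f0 ^^ m) x \<in> Lam f0" for m by (induction m) (auto simp: x(1) Lam_iterate[OF b])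
  have itm: "itin f0 ((f0 ^^ m) x) = (\<lambda>k. s (nat (k + int m)))" for m
    using fun_cong[OF x(2)] by (simp add: itin_def int_iterate_of_nat[symmetric] int_iterate_add[OF b, symmetric])
  have "\<exists>m. dist ((f0 ^^ m) x) y < e" if y: "y \<in> Lam f0" and e: "0 < e" for y e
  proof -
    obtain n :: nat where n: "\<And>g s s'. g \<in> F \<Longrightarrow> (\<And>k. \<bar>k\<bar> \<le> int n \<Longrightarrow> s k = s' k) \<Longrightarrow> dist (pt g s) (pt g s') < e"
      using itin_close[OF e] by blast
    obtain m where m: "\<And>i. i < 2 * n + 1 \<Longrightarrow> s (m + i) = itin f0 y (int i - int n)"
      using s[of "2 * n + 1" "\<lambda>i. itin f0 y (int i - int n)"] by blast
    \<comment> \<open>The block found at position m is centred at m + n, which aligns its middle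
      with symbol 0 of y.\<close>
    have "dist (pt f0 (itin f0 ((f0 ^^ (m + n)) x))) (pt f0 (itin f0 y)) < e"
    proof (rule n[OF F0])
      fix k assume k: "\<bar>k\<bar> \<le> int n"
      then have "nat (k + int n) < 2 * n + 1" "m + nat (k + int n) = nat (k + int (m + n))" "int (nat (k + int n)) - int n = k" by auto
      then show "itin f0 ((f0 ^^ (m + n)) x) k = itin f0 y k" using m[of "nat (k + int n)"] unfolding itm by simp
    qed
    then show ?thesis using pt_itin[OF F0 it] pt_itin[OF F0 y] by auto
  qed
  then have "Lam f0 \<subseteq> closure (range (\<lambda>m. (f0 ^^ m) x))" by (auto simp: closure_approachable)
  moreover have "closure (range (\<lambda>m. (f0 ^^ m) x)) \<subseteq> Lam f0"
    using it compact_imp_closed[OF compact_Lam[OF F0]] by (intro closure_minimal) auto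
  ultimately show ?thesis unfolding transitive_set_def using x(1) by blast
qed

section \<open>The blender property\<close>

lemma segment_meets_stable_set:
  assumes g: "g \<in> F" shows "x_segment \<inter> local_stable_set (reg) g (h g ` Lam f0) \<noteq> {}"
proof -
  note n = F_near[OF g]
  obtain s where s: "height g s = 0" by (rule exists_height_0[OF n])
  define q where "q = leaf g s 0"
  have q: "fcoded g s q" "q $ 2 = 0" "q $ 3 = 0" using leaf0[OF n] s by (auto simp: q_def height_def)
  have "q \<in> reg" using q(1) unfolding fcoded_def by (metis funpow_0)
  then have "q = vector [q $ 1, 0, 0]" "\<bar>q $ 1\<bar> \<le> 1" using q(2,3) by (auto simp: region_def intro: vec3_eqI)
  then have 1: "q \<in> x_segment" unfolding x_segment_def by blast
  \<comment> \<open>Any past would do; \<open>nat\<close> repeats s 0 at negative times. The future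
    alone decides which leaf contains p.\<close>
  define p where "p = pt g (\<lambda>k. s (nat k))"
  have "fcoded g s p" using coded_imp_fcoded[OF pt_coded[OF g, of "\<lambda>k. s (nat k)"]] by (simp add: p_def)
  then have "q \<in> local_stable_manifold (reg) g p" by (rule fcoded_in_local_stable[OF n _ q(1)])
  moreover have "p \<in> h g ` Lam f0" unfolding h_image[OF g] p_def by (rule pt_Lam[OF g])
  ultimately show ?thesis using 1 unfolding local_stable_set_def by blast
qed

end

lemma is_disc_segment: "is_disc TYPE(1) x_segment"
proof -
  let ?\<phi> = "\<lambda>v :: real ^ 1. (v $ 1) *\<^sub>R axis 1 1 :: real ^ 3"
  have bl: "bounded_linear ?\<phi>" by (intro bounded_linear_intros bounded_linear_vec_nth)
  have "C1_on (cball 0 1) ?\<phi>"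
    unfolding C1_on_def
    by (intro exI[of _ "\<lambda>_. Blinfun ?\<phi>"])
      (auto simp: bounded_linear_Blinfun_apply[OF bl] intro!: bounded_linear_imp_has_derivative bl)
  moreover have "x_segment = ?\<phi> ` cball 0 1"
  proof -
    have eq: "?\<phi> v = vector [v $ 1, 0, 0]" for v by (simp add: vector3_axis)
    have "vector [t, 0, 0] \<in> ?\<phi> ` cball 0 1" if "\<bar>t\<bar> \<le> 1" for t :: real
      using that by (intro image_eqI[of _ _ "vec t"]) (auto simp: vector3_axis norm_real)
    moreover have "\<bar>v $ 1\<bar> \<le> 1" if "v \<in> cball 0 1" for v :: "real ^ 1" using that by (simp add: norm_real)
    ultimately show ?thesis unfolding x_segment_def by (auto simp: eq)
  qed
  ultimately show ?thesis unfolding is_disc_def by blast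
qed

theorem theorem1p2:
  fixes a b c \<xi> :: real and f :: "real ^ 3 \<Rightarrow> real ^ 3" and R \<Lambda> :: "(real ^ 3) set"
  assumes "a = 4" and "b = 0.3" and "c = - 2.375" and "\<xi> \<in> {1<..1.712}"
    and "f = (\<lambda>p. vector [a * (p $ 1)\<^sup>2 + b * p $ 2 + c, p $ 1, \<xi> * p $ 3 + p $ 1])"
    and "R = {p. p $ 1 \<in> {-1..1} \<and> p $ 2 \<in> {-1..1} \<and> p $ 3 \<in> {- (1 / (\<xi> - 1))..1 / (\<xi> - 1)}}"
    and "\<Lambda> = (\<Inter>n. int_iterate f n ` R)"
  shows "\<exists>\<Gamma>. hyperbolic_cu_blender TYPE(1) R f \<Lambda> \<Gamma>"
proof -
  interpret params \<xi> using assms(4) by unfold_locales auto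
  have f: "f = henon_skew \<xi>" unfolding assms(5) by (simp add: assms(1,2,3) henon_skew_def fun_eq_iff)
  have R: "R = region \<xi>" unfolding assms(6) region_def by (auto simp: abs_le_iff)
  note F0 = henon_skew_in_F and bij = F_C1(3)[OF henon_skew_in_F]
  have cancel: "int_iterate f0 n (int_iterate f0 (- n) p) = p" for n p
    using int_iterate_add[OF bij, of n "- n" p] by simp
  \<comment> \<open>Passing to inverse iterates identifies the intersection of images with the set
    of points whose full orbit stays in the box.\<close>
  have "p \<in> int_iterate f0 n ` reg \<longleftrightarrow> int_iterate f0 (- n) p \<in> reg" for n p
  proof
    assume "int_iterate f0 (- n) p \<in> reg"
    then show "p \<in> int_iterate f0 n ` reg" by (rule image_eqI[rotated]) (simp add: cancel)
  qed (use cancel[of "- n"] in auto)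
  then have "\<Lambda> = {p. \<forall>n. int_iterate f0 (- n) p \<in> reg}" unfolding assms(7) f R by auto
  also have "\<dots> = Lam f0" unfolding Lam_def by (metis minus_minus)
  finally have L: "\<Lambda> = Lam f0" .
  have "hyperbolic_cu_blender TYPE(1) (reg) f0 (Lam f0) {x_segment}"
    unfolding hyperbolic_cu_blender_def
  proof (intro conjI)
    show "\<exists>Eu Es. hyperbolic_splitting f0 (Lam f0) Eu Es \<and> (\<forall>p\<in>Lam f0. CARD(1) < dim (Eu p))"
      using hyperbolic_splitting_Lam[OF F0] span_Eu(2)[OF F0] by (intro exI[of _ "Eu f0"] exI[of _ "Es f0"]) simp
    show "\<exists>G k. hyperbolic_continuation f0 (Lam f0) G k \<and>
        (\<forall>g\<in>G. \<forall>\<gamma>\<in>{x_segment}. \<gamma> \<inter> local_stable_set (reg) g (k g ` Lam f0) \<noteq> {})"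
      using hyperbolic_continuation_h segment_meets_stable_set by (intro exI[of _ F] exI[of _ h]) simp
  qed (use C1_diffeo_henon_skew hyperbolic_set_Lam[OF F0] transitive_Lam is_disc_segment in auto)
  then show ?thesis unfolding R f L by blast
qed

end
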